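(* Let $\mathcal M$ be a finite-dimensional von Neumann algebra with faithful trace $\tau$, let $\mathcal N\subset\mathcal M$ be a von Neumann subalgebra, let $\rho,\sigma$ be faithful states on $\mathcal M$ with reductions $\rho_{\mathcal N},\sigma_{\mathcal N}$, and let $Q_{x^{-1}}(\rho\|\sigma)=\tau(\rho^2\sigma^{-1})$. Then for all $\varepsilon\in(0,1/2)$ and $t\in\mathbb R$, \begin{align*} D(\rho\|\sigma)-D(\rho_{\mathcal N}\|\sigma_{\mathcal N})&\ge\left(K\,\frac{\pi}{2}\|\rho-R_\sigma(\rho_{\mathcal N})\|_1\right)^{\frac{1}{1/2-\varepsilon}},\\ D(\rho\|\sigma)-D(\rho_{\mathcal N}\|\sigma_{\mathcal N})&\ge\left(K\,\frac{\pi}{2\cosh(\pi t)}\|\rho-R^t_\sigma(\rho_{\mathcal N})\|_1\right)^{\frac{1}{1/2-\varepsilon}},\\ D(\rho\|\sigma)-D(\rho_{\mathcal N}\|\sigma_{\mathcal N})&\ge\left(K\,\|\rho-R^u_\sigma(\rho_{\mathcal N})\|_1\right)^{\frac{1}{1/2-\varepsilon}}, \end{align*} where $K=K(Q_{x^{-1}}(\rho\|\sigma),\varepsilon)=\left(4\sqrt{Q_{x^{-1}}(\rho\|\sigma)}+4+(\varepsilon e)^{-1/2}\right)^{-1}$.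
   Context: $\mathcal M$ is a finite-dimensional von Neumann algebra with faithful trace $\tau$; $\mathcal N\subset\mathcal M$ is a von Neumann subalgebra containing the identity, and $E:\mathcal M\to\mathcal N$ is the trace-preserving conditional expectation. A state is a density operator $\rho\ge0$ with $\tau(\rho)=1$; faithful means invertible. $\rho_{\mathcal N}:=E(\rho)$, $\sigma_{\mathcal N}:=E(\sigma)$. $\|x\|_1=\tau(|x|)$. $D(\rho\|\sigma)=\tau(\rho\log\rho-\rho\log\sigma)$. For faithful $\sigma$ and $t\in\mathbb R$, $R^t_\sigma(x)=\sigma^{\frac12-it}\sigma_{\mathcal N}^{-\frac12+it}\,x\,\sigma_{\mathcal N}^{-\frac12-it}\sigma^{\frac12+it}$ for $x\in\mathcal N$; $R_\sigma:=R^0_\sigma$; $R^u_\sigma(x)=\int_{\mathbb R}R_\sigma^{t/2}(x)\,d\beta(t)$ with $d\beta(t)=\frac{\pi}{2}(\cosh(\pi t)+1)^{-1}dt$. *)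

theory Defs
  imports "Jordan_Normal_Form.Matrix" "HOL-Analysis.Analysis"
begin

text \<open>Finite-dimensional von Neumann algebras are realised concretely as unital
  *-subalgebras of the complex n x n matrices (every finite-dimensional von Neumann
  algebra is of this form).  The trace is an abstract faithful positive tracial
  linear functional on the algebra (not necessarily the matrix trace).\<close>

definition adj :: "complex mat \<Rightarrow> complex mat" where
  "adj A = Matrix.mat (dim_col A) (dim_row A) (\<lambda>(i,j). cnj (A $$ (j,i)))"

definition star_subalg :: "nat \<Rightarrow> complex mat set \<Rightarrow> bool" where
  "star_subalg n M \<longleftrightarrow> M \<subseteq> carrier_mat n n \<and> 1\<^sub>m n \<in> M \<and>
     (\<forall>x\<in>M. \<forall>y\<in>M. x + y \<in> M \<and> x * y \<in> M) \<and>
     (\<forall>x\<in>M. \<forall>c::complex. c \<cdot>\<^sub>m x \<in> M) \<and>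
     (\<forall>x\<in>M. adj x \<in> M)"

definition faithful_trace :: "nat \<Rightarrow> complex mat set \<Rightarrow> (complex mat \<Rightarrow> complex) \<Rightarrow> bool" where
  "faithful_trace n M \<tau> \<longleftrightarrow>
     (\<forall>x\<in>M. \<forall>y\<in>M. \<tau> (x + y) = \<tau> x + \<tau> y \<and> \<tau> (x * y) = \<tau> (y * x)) \<and>
     (\<forall>x\<in>M. \<forall>c. \<tau> (c \<cdot>\<^sub>m x) = c * \<tau> x) \<and>
     (\<forall>x\<in>M. Im (\<tau> (adj x * x)) = 0 \<and> Re (\<tau> (adj x * x)) \<ge> 0) \<and>
     (\<forall>x\<in>M. x \<noteq> 0\<^sub>m n n \<longrightarrow> Re (\<tau> (adj x * x)) > 0)"

definition psd :: "nat \<Rightarrow> complex mat \<Rightarrow> bool" where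
  "psd n A \<longleftrightarrow> A \<in> carrier_mat n n \<and> adj A = A \<and>
     (\<forall>v\<in>carrier_vec n. Im (scalar_prod (conjugate v) (A *\<^sub>v v)) = 0 \<and> Re (scalar_prod (conjugate v) (A *\<^sub>v v)) \<ge> 0)"

definition is_state :: "nat \<Rightarrow> complex mat set \<Rightarrow> (complex mat \<Rightarrow> complex) \<Rightarrow> complex mat \<Rightarrow> bool" where
  "is_state n M \<tau> \<rho> \<longleftrightarrow> \<rho> \<in> M \<and> psd n \<rho> \<and> \<tau> \<rho> = 1"

definition faithful_state :: "nat \<Rightarrow> complex mat set \<Rightarrow> (complex mat \<Rightarrow> complex) \<Rightarrow> complex mat \<Rightarrow> bool" where
  "faithful_state n M \<tau> \<rho> \<longleftrightarrow> is_state n M \<tau> \<rho> \<and> invertible_mat \<rho>"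

text \<open>The tau-preserving conditional expectation E : M \<rightarrow> N (extended by 0 outside M
  so that it is uniquely determined as a function).\<close>
definition cond_exp :: "nat \<Rightarrow> complex mat set \<Rightarrow> complex mat set \<Rightarrow> (complex mat \<Rightarrow> complex)
    \<Rightarrow> complex mat \<Rightarrow> complex mat" where
  "cond_exp n M N \<tau> = (THE E.
     (\<forall>x\<in>M. E x \<in> N) \<and> (\<forall>x\<in>N. E x = x) \<and>
     (\<forall>x\<in>M. \<forall>y\<in>M. E (x + y) = E x + E y) \<and>
     (\<forall>x\<in>M. \<forall>c. E (c \<cdot>\<^sub>m x) = c \<cdot>\<^sub>m E x) \<and>
     (\<forall>x\<in>M. \<forall>a\<in>N. \<forall>b\<in>N. E (a * x * b) = a * E x * b) \<and>
     (\<forall>x\<in>M. psd n x \<longrightarrow> psd n (E x)) \<and>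
     (\<forall>x\<in>M. \<tau> (E x) = \<tau> x) \<and>
     (\<forall>x. x \<notin> M \<longrightarrow> E x = 0\<^sub>m n n))"

definition dmat :: "nat \<Rightarrow> (nat \<Rightarrow> complex) \<Rightarrow> complex mat" where
  "dmat n g = Matrix.mat n n (\<lambda>(i,j). if i = j then g i else 0)"

definition hfun :: "nat \<Rightarrow> (real \<Rightarrow> complex) \<Rightarrow> complex mat \<Rightarrow> complex mat" where
  "hfun n f A = (SOME B. \<exists>U (d::nat \<Rightarrow> real). U \<in> carrier_mat n n \<and>
      adj U * U = 1\<^sub>m n \<and> U * adj U = 1\<^sub>m n \<and>
      A = U * dmat n (\<lambda>i. complex_of_real (d i)) * adj U \<and>
      B = U * dmat n (\<lambda>i. f (d i)) * adj U)"

definition mlog :: "nat \<Rightarrow> complex mat \<Rightarrow> complex mat" where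
  "mlog n A = hfun n (\<lambda>x. complex_of_real (ln x)) A"

definition mpow :: "nat \<Rightarrow> complex mat \<Rightarrow> complex \<Rightarrow> complex mat" where
  "mpow n A z = hfun n (\<lambda>x. exp (z * complex_of_real (ln x))) A"

definition minv :: "nat \<Rightarrow> complex mat \<Rightarrow> complex mat" where
  "minv n A = hfun n (\<lambda>x. complex_of_real (inverse x)) A"

definition mabs :: "nat \<Rightarrow> complex mat \<Rightarrow> complex mat" where
  "mabs n x = hfun n (\<lambda>s. complex_of_real (sqrt s)) (adj x * x)"

definition norm1 :: "nat \<Rightarrow> (complex mat \<Rightarrow> complex) \<Rightarrow> complex mat \<Rightarrow> real" where
  "norm1 n \<tau> x = Re (\<tau> (mabs n x))"

definition rel_ent :: "nat \<Rightarrow> (complex mat \<Rightarrow> complex) \<Rightarrow> complex mat \<Rightarrow> complex mat \<Rightarrow> real" where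
  "rel_ent n \<tau> \<rho> \<sigma> = Re (\<tau> (\<rho> * mlog n \<rho> - \<rho> * mlog n \<sigma>))"

text \<open>Rotated Petz recovery map R^t_sigma, with sN = E(sigma).\<close>
definition Rrot :: "nat \<Rightarrow> complex mat \<Rightarrow> complex mat \<Rightarrow> real \<Rightarrow> complex mat \<Rightarrow> complex mat" where
  "Rrot n \<sigma> sN t x =
     mpow n \<sigma> (1/2 - \<i> * of_real t) * mpow n sN (-1/2 + \<i> * of_real t) * x *
     mpow n sN (-1/2 - \<i> * of_real t) * mpow n \<sigma> (1/2 + \<i> * of_real t)"

definition Runiv :: "nat \<Rightarrow> complex mat \<Rightarrow> complex mat \<Rightarrow> complex mat \<Rightarrow> complex mat" where
  "Runiv n \<sigma> sN x = Matrix.mat n n (\<lambda>(i,j).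
     integral\<^sup>L lborel (\<lambda>t. ((pi/2) / (cosh (pi * t) + 1)) *\<^sub>R (Rrot n \<sigma> sN (t/2) x $$ (i,j))))"

end

theory Submission
  imports Defs "Jordan_Normal_Form.Spectral_Radius" "HOL-Real_Asymp.Real_Asymp"
begin

text \<open>
  On the Hilbert space of the trace let \<open>\<Delta> x = \<rho> x \<sigma>\<inverse>\<close>, let \<open>\<Delta>\<^sub>N\<close> be its analogue for the
  reduced states and \<open>V x = x \<sigma>\<^sub>N\<^bsup>-1/2\<^esup> \<sigma>\<^bsup>1/2\<^esup>\<close>, an isometry with \<open>V\<^sup>* \<Delta> V = \<Delta>\<^sub>N\<close>. With
  \<open>w\<^sub>s = (s + \<Delta>)\<inverse> V h - V (s + \<Delta>\<^sub>N)\<inverse> h\<close> at \<open>h = \<sigma>\<^sub>N\<^bsup>1/2\<^esup>\<close>, the entropy difference \<open>D\<close> equals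
  \<open>\<integral> s \<langle>w\<^sub>s, (s + \<Delta>) w\<^sub>s\<rangle> ds\<close>, hence is at least \<open>\<integral> \<parallel>s w\<^sub>s\<parallel>\<^sup>2 ds\<close>.
  For \<open>z = 1/2 + i t\<close> the integral of \<open>s\<^bsup>z\<^esup> w\<^sub>s\<close> represents \<open>\<Delta>\<^bsup>z\<^esup> V h - V \<Delta>\<^sub>N\<^bsup>z\<^esup> h\<close> up to the factor \<open>\<pi> / cosh (\<pi> t)\<close>.
  It is estimated by \<open>\<parallel>s w\<^sub>s\<parallel> \<le> 2\<close> for \<open>s < \<delta>\<close>, by \<open>\<parallel>s w\<^sub>s\<parallel> \<le> 2 \<surd>Q / s\<close> for \<open>s > 1/\<delta>\<close>
  and by Cauchy--Schwarz in between; \<open>\<delta> = D\<close> gives the constant \<open>K\<close>. The squared moduli of the two vectors are, after a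
  unitary rotation, \<open>\<rho>\<close> and its rotated recovery, which turns the bound into one for the trace norm.
  Averaging over \<open>t\<close> yields the universal map.
\<close>

section \<open>Resolvent integrals\<close>

text \<open>The exponent falls short of 1/2 because the middle range contributes
  \<open>\<integral> ds / s = 2 ln (1 / \<delta>)\<close>: no choice of \<open>\<delta>\<close>
  leaves a pure square root of the entropy difference. Trading this logarithm for a power costs
  \<open>\<epsilon>\<close> and the term \<open>(\<epsilon> e)^(-1/2)\<close> of the constant. Large
  \<open>s\<close> is controlled by the second moment of the spectral measure of \<Delta> at
  \<open>V h = \<sigma>^(1/2)\<close>, which is \<open>\<tau>(\<rho>^2 \<sigma>^(-1))\<close>; this
  is where the square root of \<open>Q\<close> enters. The operator \<open>V\<close> is never
  formed. Its images of the eigencomponents of \<open>h\<close> are used directly, so that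
  everything reduces to finite families of eigenvalues and weights, and the entropy difference is an
  integral of rational functions with a logarithmic primitive. Vector-valued integrals are avoided
  as well: the difference vector is tested against itself, which leaves a scalar integral and a
  common factor to cancel. The third bound carries no \<open>pi / 2\<close>, since the rotated bound
  at \<open>t / 2\<close> loses the factor \<open>2 cosh (pi t / 2) / pi\<close>, whose average over
  the density is 1.\<close>

lemma borel_measurable_of_real_powr [measurable]:
  "(\<lambda>t. complex_of_real t powr w) \<in> borel_measurable borel"
proof -
  have "complex_of_real t powr w = (if t = 0 then 0 else
      exp (w * (of_real (ln \<bar>t\<bar>) + (if t < 0 then \<i> * of_real pi else 0))))" for t
    by (auto simp: powr_def Ln_of_real' mult.commute)
  then show ?thesis by simp
qed

text \<open>Gauge integrals are recast as Lebesgue integrals, because the exchange of integrals that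
  follows is Fubini's theorem for Bochner integrals.\<close>

lemma Gamma_lebesgue_integral:
  assumes "Re z > 0"
  shows "set_integrable lborel {0<..} (\<lambda>t. of_real t powr (z - 1) / of_real (exp t))"
    and "(LINT t:{0<..}|lborel. of_real t powr (z - 1) / of_real (exp t)) = Gamma z"
proof -
  let ?f = "\<lambda>t. complex_of_real t powr (z - 1) / of_real (exp t)"
  have ai: "?f absolutely_integrable_on {0<..}"
    by (rule absolutely_integrable_Gamma_integral'[OF assms])
  show i: "set_integrable lborel {0<..} ?f"
    using ai unfolding set_integrable_def by (subst (asm) integrable_completion) auto
  have "integral {0<..} ?f = (LINT t:{0<..}|lborel. ?f t)"
    using set_borel_integral_eq_integral(2)[OF i] by simp
  with Gamma_integral_complex'[OF assms] show "(LINT t:{0<..}|lborel. ?f t) = Gamma z"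
    by (simp add: has_integral_iff)
qed

text \<open>The substitution is \<open>t = y s\<close>. Both orders of integration in Euler's
  integral use this form: rate \<open>y\<close> for the integral over \<open>s\<close>, and
  \<open>z = 1\<close> with rate \<open>1 + s\<close> for the integral over
  \<open>y\<close>.\<close>

lemma Gamma_lebesgue_integral_scaled:
  assumes "Re z > 0" and y: "y > 0"
  shows "set_integrable lborel {0<..} (\<lambda>s. of_real s powr (z - 1) * of_real (exp (- (y * s))))"
    and "(LINT s:{0<..}|lborel. of_real s powr (z - 1) * of_real (exp (- (y * s)))) = Gamma z * of_real y powr (- z)"
proof -
  let ?g = "\<lambda>t. indicator {0<..} t *\<^sub>R (complex_of_real t powr (z - 1) / of_real (exp t))"
  let ?h = "\<lambda>s. indicator {0<..} s *\<^sub>R (complex_of_real s powr (z - 1) * of_real (exp (- (y * s))))"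
  have e: "?g (0 + y * s) = of_real y powr (z - 1) * ?h s" for s
  proof (cases "s > 0")
    case True
    have "complex_of_real (y * s) powr (z - 1) = of_real y powr (z - 1) * of_real s powr (z - 1)"
      using True y by (simp add: powr_times_real)
    then show ?thesis using True y by (simp add: exp_minus divide_simps)
  qed (use y in \<open>simp add: zero_less_mult_iff\<close>)
  have gi: "integrable lborel ?g" using Gamma_lebesgue_integral(1)[OF assms(1)] unfolding set_integrable_def .
  have y0: "y \<noteq> 0" using y by simp
  have cy: "complex_of_real y powr (z - 1) \<noteq> 0" using y by simp
  have hi: "integrable lborel ?h"
    using integrable_mult_right[OF lborel_integrable_real_affine[OF gi y0, of 0],
        of "1 / complex_of_real y powr (z - 1)"] cy unfolding e by simp
  then show "set_integrable lborel {0<..} (\<lambda>s. of_real s powr (z - 1) * of_real (exp (- (y * s))))"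
    unfolding set_integrable_def .
  have "Gamma z = (LINT t|lborel. ?g t)"
    using Gamma_lebesgue_integral(2)[OF assms(1)] unfolding set_lebesgue_integral_def by simp
  also have "\<dots> = \<bar>y\<bar> *\<^sub>R (LINT s|lborel. ?g (0 + y * s))"
    by (rule lborel_integral_real_affine[OF y0])
  also have "\<dots> = of_real y * of_real y powr (z - 1) * (LINT s|lborel. ?h s)"
    unfolding e integral_mult_right_zero using y by (simp add: scaleR_conv_of_real)
  also have "of_real y * of_real y powr (z - 1) = complex_of_real y powr z"
    using y by (simp add: powr_diff)
  finally have "Gamma z = of_real y powr z * (LINT s|lborel. ?h s)" .
  then show "(LINT s:{0<..}|lborel. of_real s powr (z - 1) * of_real (exp (- (y * s)))) = Gamma z * of_real y powr (- z)"
    unfolding set_lebesgue_integral_def using y by (simp add: powr_minus)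
qed

text \<open>Euler's integral \<open>\<Gamma>(z) \<Gamma>(1 - z) = \<integral> s\<^bsup>z - 1\<^esup> / (1 + s) ds\<close>, by exchanging the order of integration in
  \<open>\<integral>\<integral> s\<^bsup>z - 1\<^esup> e\<^bsup>- y (1 + s)\<^esup> ds dy\<close>.\<close>
lemma powr_over_one_plus_integral:
  assumes z: "0 < Re z" "Re z < 1"
  shows "set_integrable lborel {0<..} (\<lambda>s. of_real s powr (z - 1) * of_real (1 / (1 + s)))"
    and "(LINT s:{0<..}|lborel. of_real s powr (z - 1) * of_real (1 / (1 + s))) = of_real pi / sin (of_real pi * z)"
proof -
  let ?i = "indicator {0<..} :: real \<Rightarrow> real"
  define F where "F = (\<lambda>(y, s). (?i y * ?i s) *\<^sub>R (complex_of_real s powr (z - 1) * of_real (exp (- (y * (1 + s))))))"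
  have meas: "F \<in> borel_measurable (lborel \<Otimes>\<^sub>M lborel)"
    unfolding F_def by (subst measurable_cong_sets[OF sets_pair_measure_cong[OF sets_lborel sets_lborel] refl]) measurable
  have split: "F (y, s) = (?i y * exp (- y)) *\<^sub>R (?i s *\<^sub>R (complex_of_real s powr (z - 1) * of_real (exp (- (y * s)))))" for y s
    unfolding F_def by (simp add: exp_add[symmetric] algebra_simps scaleR_conv_of_real of_real_mult[symmetric] del: of_real_mult)
  have inner1: "integrable lborel (\<lambda>s. F (y, s))" for y
  proof (cases "y > 0")
    case True
    show ?thesis unfolding split
      using Gamma_lebesgue_integral_scaled(1)[OF z(1) True] unfolding set_integrable_def
      by (rule integrable_scaleR_right)
  qed (simp add: split)
  have inner2: "(LINT s|lborel. F (y, s)) = (?i y * exp (- y)) *\<^sub>R (Gamma z * of_real y powr (- z))" for y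
  proof (cases "y > 0")
    case True
    then show ?thesis unfolding split integral_scaleR_right
      using Gamma_lebesgue_integral_scaled(2)[OF z(1) True] unfolding set_lebesgue_integral_def
      by (simp del: scaleR_scaleR)
  qed (simp add: split)
  \<comment> \<open>The modulus of \<open>s powr (z - 1)\<close> depends on \<open>Re z\<close>
    only, so absolute integrability is the same computation with the real exponents
    \<open>Re z\<close> and \<open>1 - Re z\<close>.\<close>
  have Rz: "Re (complex_of_real (Re z)) > 0" "Re (complex_of_real (1 - Re z)) > 0" using z by auto
  have nrm: "norm (F (y, s)) = (?i y * exp (- y)) * (?i s * (s powr (Re z - 1) * exp (- (y * s))))" for y s
  proof (cases "s > 0")
    case True
    have "norm (complex_of_real s powr (z - 1)) = s powr (Re z - 1)"
      using True by (simp add: norm_powr_real_powr)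
    then show ?thesis unfolding split by (simp add: norm_mult)
  qed (simp add: split)
  have inner3: "(LINT s|lborel. norm (F (y, s))) = Gamma (Re z) * (?i y * (y powr (1 - Re z - 1) * exp (- y)))" for y
  proof (cases "y > 0")
    case True
    have e: "complex_of_real (norm (F (y, s))) = (?i y * exp (- y)) *\<^sub>R (?i s *\<^sub>R (complex_of_real s powr (of_real (Re z) - 1) * of_real (exp (- (y * s)))))" for s
    proof (cases "s > 0")
      case s: True
      have "complex_of_real s powr (of_real (Re z) - 1) = of_real (s powr (Re z - 1))"
        using s by (metis less_eq_real_def of_real_1 of_real_diff powr_of_real)
      then show ?thesis unfolding nrm by (simp add: scaleR_conv_of_real)
    qed (simp add: nrm)
    have "complex_of_real (LINT s|lborel. norm (F (y, s))) = (LINT s|lborel. complex_of_real (norm (F (y, s))))"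
      by simp
    also have "\<dots> = (?i y * exp (- y)) *\<^sub>R (Gamma (of_real (Re z)) * of_real y powr (- of_real (Re z)))"
      unfolding e integral_scaleR_right using Gamma_lebesgue_integral_scaled(2)[OF Rz(1) True]
      unfolding set_lebesgue_integral_def by (simp del: scaleR_scaleR)
    also have "\<dots> = of_real (Gamma (Re z) * (?i y * (y powr (1 - Re z - 1) * exp (- y))))"
      using True by (simp add: Gamma_complex_of_real powr_of_real[symmetric] scaleR_conv_of_real)
    finally show ?thesis by (simp only: of_real_eq_iff)
  qed (simp add: nrm)
  have outer: "integrable lborel (\<lambda>y. LINT s|lborel. norm (F (y, s)))"
  proof -
    have "integrable lborel (\<lambda>y. ?i y *\<^sub>R (complex_of_real y powr (of_real (1 - Re z) - 1) * of_real (exp (- (1 * y)))))"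
      using Gamma_lebesgue_integral_scaled(1)[OF Rz(2), of 1] unfolding set_integrable_def by simp
    then have "integrable lborel (\<lambda>y. Gamma (Re z) * norm (?i y *\<^sub>R (complex_of_real y powr (of_real (1 - Re z) - 1) * of_real (exp (- (1 * y))))))"
      by (intro integrable_mult_right integrable_norm)
    moreover have "norm (?i y *\<^sub>R (complex_of_real y powr (of_real (1 - Re z) - 1) * of_real (exp (- (1 * y)))))
        = ?i y * (y powr (1 - Re z - 1) * exp (- y))" for y
      by (cases "y > 0") (simp_all add: norm_mult norm_powr_real_powr)
    ultimately show ?thesis unfolding inner3 by (simp only:)
  qed
  have FI: "integrable (lborel \<Otimes>\<^sub>M lborel) F"
    by (rule lborel_pair.Fubini_integrable[OF meas outer]) (simp add: inner1)
  have other: "(LINT y|lborel. F (y, s)) = ?i s *\<^sub>R (of_real s powr (z - 1) * of_real (1 / (1 + s)))" for s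
  proof (cases "s > 0")
    case True
    have s1: "1 + s > 0" using True by simp
    have e: "F (y, s) = of_real s powr (z - 1) * (?i y *\<^sub>R (of_real y powr (1 - 1) * of_real (exp (- ((1 + s) * y)))))" for y
      unfolding F_def using True by (cases "y > 0") (simp_all add: mult.commute)
    have "(LINT y|lborel. F (y, s)) = of_real s powr (z - 1) * (Gamma 1 * of_real (1 + s) powr (- 1))"
      unfolding e integral_mult_right_zero
      using Gamma_lebesgue_integral_scaled(2)[of 1, OF _ s1] unfolding set_lebesgue_integral_def by simp
    then show ?thesis using True s1 by (simp add: powr_minus divide_inverse powr_to_1 del: of_real_add)
  qed (simp add: F_def)
  have "integrable lborel (\<lambda>s. LINT y|lborel. F (y, s))"
    by (rule lborel_pair.integrable_snd) (simp add: FI case_prod_unfold)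
  then show "set_integrable lborel {0<..} (\<lambda>s. of_real s powr (z - 1) * of_real (1 / (1 + s)))"
    unfolding other set_integrable_def .
  have "(LINT s:{0<..}|lborel. of_real s powr (z - 1) * of_real (1 / (1 + s))) = (LINT s|lborel. LINT y|lborel. F (y, s))"
    unfolding other set_lebesgue_integral_def ..
  also have "\<dots> = (LINT y|lborel. LINT s|lborel. F (y, s))"
    by (rule lborel_pair.Fubini_integral) (simp add: FI case_prod_unfold)
  also have "\<dots> = Gamma z * (LINT y|lborel. ?i y *\<^sub>R (of_real y powr ((1 - z) - 1) * of_real (exp (- (1 * y)))))"
    unfolding inner2 by (simp add: integral_mult_right_zero[symmetric] del: integral_mult_right_zero) (simp add: scaleR_conv_of_real mult_ac)
  also have "\<dots> = Gamma z * Gamma (1 - z)"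
    using Gamma_lebesgue_integral_scaled(2)[of "1 - z" 1] z unfolding set_lebesgue_integral_def by simp
  also have "\<dots> = of_real pi / sin (of_real pi * z)" by (rule Gamma_reflection_complex)
  finally show "(LINT s:{0<..}|lborel. of_real s powr (z - 1) * of_real (1 / (1 + s))) = of_real pi / sin (of_real pi * z)" .
qed

text \<open>Euler's integral is the case \<open>l = 1\<close>, and the substitution
  \<open>s = l t\<close> does the rest. With \<open>l\<close> in the numerator the value is
  \<open>l powr z\<close> times a constant independent of \<open>l\<close>, so combinations of
  resolvents integrate to combinations of powers.\<close>

lemma has_integral_powr_resolvent:
  assumes z: "0 < Re z" "Re z < 1" and l: "l > 0"
  shows "((\<lambda>s. of_real s powr (z - 1) * of_real (l / (s + l))) has_integral
     (of_real l powr z * (of_real pi / sin (of_real pi * z)))) {0<..}"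
proof -
  let ?g = "\<lambda>t. indicator {0<..} t *\<^sub>R (complex_of_real t powr (z - 1) * of_real (1 / (1 + t)))"
  let ?h = "\<lambda>s. indicator {0<..} s *\<^sub>R (complex_of_real s powr (z - 1) * of_real (l / (s + l)))"
  have e: "?g (0 + (1 / l) * s) = of_real l powr (1 - z) * ?h s" for s
  proof (cases "s > 0")
    case True
    have "complex_of_real ((1 / l) * s) powr (z - 1) = of_real (1 / l) powr (z - 1) * of_real s powr (z - 1)"
      unfolding of_real_mult using True l by (subst powr_times_real) auto
    moreover have "complex_of_real (1 / l) powr (z - 1) = of_real l powr (1 - z)"
    proof -
      have "complex_of_real (1 / l) powr (z - 1) = exp ((z - 1) * of_real (ln (1 / l)))"
        using l by (simp add: powr_def Ln_of_real del: of_real_divide)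
      also have "(z - 1) * of_real (ln (1 / l)) = (1 - z) * complex_of_real (ln l)"
        using l by (simp add: ln_div algebra_simps)
      also have "exp \<dots> = of_real l powr (1 - z)" using l by (simp add: powr_def Ln_of_real)
      finally show ?thesis .
    qed
    moreover have "1 / (1 + (0 + (1 / l) * s)) = l / (s + l)" using l True by (simp add: field_simps)
    ultimately show ?thesis using True l by (simp del: of_real_mult of_real_divide)
  qed (use l in \<open>simp add: zero_less_divide_iff\<close>)
  have gi: "integrable lborel ?g" using powr_over_one_plus_integral(1)[OF z] unfolding set_integrable_def .
  have l0: "1 / l \<noteq> 0" using l by simp
  have cl: "complex_of_real l powr (1 - z) \<noteq> 0" using l by simp
  have hi: "integrable lborel ?h"
    using integrable_mult_right[OF lborel_integrable_real_affine[OF gi l0, of 0],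
        of "1 / complex_of_real l powr (1 - z)"] cl unfolding e by simp
  have "of_real pi / sin (of_real pi * z) = (LINT t|lborel. ?g t)"
    using powr_over_one_plus_integral(2)[OF z] unfolding set_lebesgue_integral_def by simp
  also have "\<dots> = \<bar>1 / l\<bar> *\<^sub>R (LINT s|lborel. ?g (0 + (1 / l) * s))"
    by (rule lborel_integral_real_affine[OF l0])
  also have "\<dots> = (of_real l powr (1 - z) / of_real l) * (LINT s|lborel. ?h s)"
    unfolding e integral_mult_right_zero using l by (simp add: scaleR_conv_of_real)
  also have "of_real l powr (1 - z) / of_real l = 1 / (complex_of_real l powr z)"
    using l by (simp add: powr_diff)
  finally have I: "(LINT s|lborel. ?h s) = of_real l powr z * (of_real pi / sin (of_real pi * z))"
    using l by (simp add: field_simps)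
  have "set_integrable lborel {0<..} (\<lambda>s. complex_of_real s powr (z - 1) * of_real (l / (s + l)))"
    using hi unfolding set_integrable_def .
  from set_borel_integral_eq_integral[OF this] show ?thesis
    using I unfolding has_integral_iff set_lebesgue_integral_def by simp
qed

text \<open>This stands in for the Cauchy--Schwarz inequality for integrals. The best weight is
  \<open>c = sqrt (D / L)\<close>, but \<open>L\<close> and \<open>D\<close> may vanish
  (\<open>\<delta> = 1\<close> gives \<open>L = 0\<close>), so both are enlarged by
  \<open>e\<close>, which then tends to 0.\<close>

lemma le_of_forall_weighted_mean:
  fixes X A B L D :: real
  assumes B: "B \<ge> 0" and L: "L \<ge> 0" and D: "D \<ge> 0"
    and H: "\<And>c. c > 0 \<Longrightarrow> X \<le> A + B / 2 * (c * L + D / c)"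
  shows "X \<le> A + B * sqrt (L * D)"
proof -
  have lim: "X \<le> A + B * sqrt ((L + e) * (D + e))" if e: "e > 0" for e
  proof -
    define u v where "u = sqrt (L + e)" and "v = sqrt (D + e)"
    have uv: "u > 0" "v > 0" "L + e = u * u" "D + e = v * v" "sqrt ((L + e) * (D + e)) = u * v"
      unfolding u_def v_def using e L D by (simp_all add: real_sqrt_mult)
    define c where "c = v / u"
    have c: "c > 0" "c * (L + e) = u * v" "(D + e) / c = u * v"
      unfolding c_def uv(3,4) using uv(1,2) by simp_all
    have "c * L + D / c \<le> c * (L + e) + (D + e) / c"
      using c e by (intro add_mono mult_left_mono divide_right_mono) auto
    also have "\<dots> = 2 * sqrt ((L + e) * (D + e))" using c uv by simp
    finally have "B / 2 * (c * L + D / c) \<le> B / 2 * (2 * sqrt ((L + e) * (D + e)))"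
      using B by (intro mult_left_mono) auto
    with H[OF c(1)] show ?thesis by linarith
  qed
  have "((\<lambda>e. A + B * sqrt ((L + e) * (D + e))) \<longlongrightarrow> A + B * sqrt ((L + 0) * (D + 0))) (at_right 0)"
    by (intro tendsto_intros)
  then have "X \<le> A + B * sqrt ((L + 0) * (D + 0))"
    by (rule tendsto_lowerbound) (auto simp: eventually_at_right_less lim intro!: eventually_at_rightI[of 0 1])
  then show ?thesis by simp
qed

section \<open>Comparison of two spectral measures\<close>

lemma sum_resolvent_complement:
  fixes c :: "'i \<Rightarrow> 'a :: real_field"
  assumes "\<And>i. i \<in> I \<Longrightarrow> l i > 0" "s \<ge> 0"
  shows "(\<Sum>i\<in>I. c i * of_real (s / (s + l i))) = sum c I - (\<Sum>i\<in>I. c i * of_real (l i / (s + l i)))"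
  unfolding sum_subtractf[symmetric]
proof (intro sum.cong refl)
  fix i assume "i \<in> I"
  then have "s + l i \<noteq> 0" using assms by (metis add_nonneg_pos less_irrefl)
  then have "s / (s + l i) = 1 - l i / (s + l i)" by (simp add: field_simps)
  then show "c i * of_real (s / (s + l i)) = c i - c i * of_real (l i / (s + l i))"
    by (simp only: of_real_diff of_real_1 right_diff_distrib mult_1_right)
qed

text \<open>\<open>l\<close> and \<open>p\<close> are the eigenvalues and masses of the spectral
  measure of \<Delta> at \<open>V h\<close>, \<open>m\<close> and \<open>q\<close> those of its
  compression at \<open>h\<close>. Equal means reflect the compression, and
  \<open>gap_nonneg\<close> is the scalar form of the resolvent inequality.\<close>

locale resolvent_weights =
  fixes I :: "'i set" and J :: "'j set" and l p :: "'i \<Rightarrow> real" and m q :: "'j \<Rightarrow> real"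
  assumes finI: "finite I" and finJ: "finite J"
    and l_pos: "\<And>i. i \<in> I \<Longrightarrow> l i > 0" and m_pos: "\<And>j. j \<in> J \<Longrightarrow> m j > 0"
    and sum_eq: "sum p I = sum q J" and mean_eq: "(\<Sum>i\<in>I. p i * l i) = (\<Sum>j\<in>J. q j * m j)"
    and gap_nonneg: "\<And>s. s > 0 \<Longrightarrow> (\<Sum>j\<in>J. q j * s / (s + m j)) \<le> (\<Sum>i\<in>I. p i * s / (s + l i))"
begin

text \<open>\<open>\<Phi>\<close> is a primitive of \<open>gap\<close> with \<open>\<Phi> 0 = - D\<close> and limit \<open>0\<close> at infinity, so \<open>D\<close> is the integral of \<open>gap\<close>.\<close>
definition gap :: "real \<Rightarrow> real" where
  "gap s = (\<Sum>i\<in>I. p i * s / (s + l i)) - (\<Sum>j\<in>J. q j * s / (s + m j))"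

definition \<Phi> :: "real \<Rightarrow> real" where
  "\<Phi> s = (\<Sum>j\<in>J. q j * m j * ln (s + m j)) - (\<Sum>i\<in>I. p i * l i * ln (s + l i))"

definition D :: real where
  "D = (\<Sum>i\<in>I. p i * l i * ln (l i)) - (\<Sum>j\<in>J. q j * m j * ln (m j))"

lemma gap_alt: "gap s = (\<Sum>j\<in>J. q j * m j / (s + m j)) - (\<Sum>i\<in>I. p i * l i / (s + l i))" if "s \<ge> 0"
  using sum_resolvent_complement[of I l s p] sum_resolvent_complement[of J m s q] l_pos m_pos that
  unfolding gap_def by (simp add: sum_eq)

lemma gap_ge_0: "s > 0 \<Longrightarrow> gap s \<ge> 0"
  unfolding gap_def using gap_nonneg by simp

lemma \<Phi>_deriv: "(\<Phi> has_real_derivative gap s) (at s)" if "s \<ge> 0"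
  unfolding \<Phi>_def gap_alt[OF that]
  by (auto intro!: derivative_eq_intros sum.cong simp: sum_distrib_left)
     (use that l_pos m_pos in \<open>force simp: divide_simps add_nonneg_pos\<close>)+

lemma \<Phi>_mono: "\<Phi> a \<le> \<Phi> b" if "0 \<le> a" "a \<le> b"
proof (cases "a = b")
  case False
  have "\<exists>z>a. z < b \<and> \<Phi> b - \<Phi> a = (b - a) * gap z"
    by (rule MVT2) (use that False \<Phi>_deriv in auto)
  then obtain z where "z > a" "z < b" "\<Phi> b - \<Phi> a = (b - a) * gap z" by blast
  moreover have "gap z \<ge> 0" using gap_ge_0 that \<open>z > a\<close> by simp
  ultimately show ?thesis using that by (smt (verit) mult_nonneg_nonneg)
qed simp

text \<open>Because of \<open>mean_eq\<close>, \<open>ln s\<close> may be subtracted from every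
  logarithm without changing \<Phi>, and \<open>ln (s + y) - ln s\<close> tends to 0. A monotone
  function with limit 0 at infinity is nonpositive.\<close>

lemma \<Phi>_le_0: "\<Phi> b \<le> 0" if "0 \<le> b"
proof -
  have aux: "((\<lambda>s. ln (s + y) - ln s) \<longlongrightarrow> 0) at_top" for y :: real
    by real_asymp
  have "((\<lambda>s. (\<Sum>j\<in>J. q j * m j * (ln (s + m j) - ln s)) - (\<Sum>i\<in>I. p i * l i * (ln (s + l i) - ln s)))
      \<longlongrightarrow> (\<Sum>j\<in>J. q j * m j * 0) - (\<Sum>i\<in>I. p i * l i * 0)) at_top"
    by (intro tendsto_intros aux)
  moreover have "(\<Sum>j\<in>J. q j * m j * (ln (s + m j) - ln s)) - (\<Sum>i\<in>I. p i * l i * (ln (s + l i) - ln s)) = \<Phi> s" for s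
    unfolding \<Phi>_def by (simp add: right_diff_distrib sum_subtractf sum_distrib_right[symmetric] mean_eq)
  ultimately have "(\<Phi> \<longlongrightarrow> 0) at_top" by simp
  then show ?thesis
    by (rule tendsto_lowerbound) (use \<Phi>_mono that in \<open>auto intro: eventually_at_top_linorderI[of b]\<close>)
qed

lemma gap_integral:
  assumes "0 < a" "a \<le> b"
  shows "(gap has_integral (\<Phi> b - \<Phi> a)) {a..b}" "\<Phi> b - \<Phi> a \<le> D"
proof -
  show "(gap has_integral (\<Phi> b - \<Phi> a)) {a..b}"
    by (rule fundamental_theorem_of_calculus)
       (use assms \<Phi>_deriv in \<open>auto simp: has_real_derivative_iff_has_vector_derivative[symmetric]
          intro: has_field_derivative_at_within\<close>)
  have "\<Phi> 0 = - D" unfolding \<Phi>_def D_def by simp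
  then show "\<Phi> b - \<Phi> a \<le> D" using \<Phi>_mono[of 0 a] \<Phi>_le_0[of b] assms by simp
qed

lemma D_nonneg: "D \<ge> 0"
  using gap_integral[of 1 1] by simp

text \<open>The integral over \<open>s\<close> is split at \<open>\<delta>\<close> and \<open>1 / \<delta>\<close>; the three assumed bounds on \<open>W\<close> serve the three pieces.\<close>
theorem resolvent_bound:
  fixes c :: "'i \<Rightarrow> complex" and d :: "'j \<Rightarrow> complex" and B R \<delta> t :: real
  defines "W \<equiv> \<lambda>s. (\<Sum>i\<in>I. c i * of_real (s / (s + l i))) - (\<Sum>j\<in>J. d j * of_real (s / (s + m j)))"
  defines "z \<equiv> Complex (1/2) t"
  assumes cd: "sum c I = sum d J" and B: "B \<ge> 0" and R: "R \<ge> 0"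
    and W2: "\<And>s. s > 0 \<Longrightarrow> norm (W s) \<le> 2 * B"
    and WR: "\<And>s. s > 0 \<Longrightarrow> norm (W s) \<le> 2 * B * R / s"
    and Wk: "\<And>s. s > 0 \<Longrightarrow> norm (W s) \<le> B * sqrt (gap s)"
    and \<delta>: "0 < \<delta>" "\<delta> \<le> 1"
  shows "norm ((\<Sum>i\<in>I. c i * of_real (l i) powr z) - (\<Sum>j\<in>J. d j * of_real (m j) powr z))
    \<le> cosh (pi * t) / pi * (B * (4 * sqrt \<delta> * (1 + R) + sqrt (2 * ln (1 / \<delta>) * D)))"
proof -
  let ?S = "(\<Sum>i\<in>I. c i * of_real (l i) powr z) - (\<Sum>j\<in>J. d j * of_real (m j) powr z)"
  let ?K = "of_real pi / sin (of_real pi * z)"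
  let ?f = "\<lambda>s. of_real s powr (z - 1) * W s"
  have z: "0 < Re z" "Re z < 1" unfolding z_def by auto
  \<comment> \<open>In this form each term is integrable against \<open>s powr (z - 1)\<close>; a
    single term with \<open>s / (s + l i)\<close> is not, as it tends to a constant at
    infinity.\<close>
  have W_alt: "W s = (\<Sum>j\<in>J. d j * of_real (m j / (s + m j))) - (\<Sum>i\<in>I. c i * of_real (l i / (s + l i)))"
    if "s > 0" for s
    unfolding W_def using sum_resolvent_complement[of I l s c] sum_resolvent_complement[of J m s d] l_pos m_pos that cd
    by simp
  have "((\<lambda>s. (\<Sum>j\<in>J. d j * (of_real s powr (z - 1) * of_real (m j / (s + m j))))
       - (\<Sum>i\<in>I. c i * (of_real s powr (z - 1) * of_real (l i / (s + l i))))) has_integral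
      ((\<Sum>j\<in>J. d j * (of_real (m j) powr z * ?K)) - (\<Sum>i\<in>I. c i * (of_real (l i) powr z * ?K)))) {0<..}"
    by (intro has_integral_diff has_integral_sum has_integral_mult_right has_integral_powr_resolvent z
        finI finJ l_pos m_pos)
  then have "(?f has_integral ((\<Sum>j\<in>J. d j * (of_real (m j) powr z * ?K)) - (\<Sum>i\<in>I. c i * (of_real (l i) powr z * ?K)))) {0<..}"
    by (rule has_integral_eq[rotated])
       (simp add: W_alt right_diff_distrib sum_distrib_left mult_ac del: of_real_divide of_real_add)
  moreover have "(\<Sum>j\<in>J. d j * (of_real (m j) powr z * ?K)) - (\<Sum>i\<in>I. c i * (of_real (l i) powr z * ?K)) = - (?S * ?K)"
    by (simp only: mult.assoc[symmetric] sum_distrib_right[symmetric] left_diff_distrib minus_diff_eq)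
  ultimately have f: "(?f has_integral (- (?S * ?K))) {0<..}" by simp
  \<comment> \<open>The null set \<open>{0}\<close> is added because the three pieces below cover
    \<open>{0..}\<close>.\<close>
  then have f0: "(?f has_integral (- (?S * ?K))) {0..}"
    by (subst (asm) has_integral_spike_set_eq[of _ "{0..}"]) (auto intro: negligible_subset[of "{0}"])
  \<comment> \<open>On the line \<open>Re z = 1/2\<close> the sine becomes a hyperbolic cosine of
    the imaginary part, the origin of the factor \<open>pi / cosh (pi * t)\<close>.\<close>
  have "sin (of_real pi * z) = of_real (cosh (pi * t))"
  proof -
    have "of_real pi * z = of_real (pi / 2) + \<i> * of_real (pi * t)"
      unfolding z_def by (simp add: complex_eq_iff)
    then have "sin (of_real pi * z) = cos (\<i> * of_real (pi * t))"
      by (simp add: sin_add sin_of_real cos_of_real del: of_real_divide of_real_mult)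
    also have "\<dots> = cosh (of_real (pi * t))" by (simp add: cosh_conv_cos del: of_real_mult)
    also have "\<dots> = of_real (cosh (pi * t))"
      by (simp only: cosh_field_def of_real_divide of_real_add of_real_minus[symmetric] exp_of_real of_real_numeral)
    finally show ?thesis .
  qed
  then have nK: "norm ?K = pi / cosh (pi * t)"
    by (simp add: norm_divide del: of_real_mult)
  have nf: "norm (?f s) = s powr (-1/2) * norm (W s)" if "s > 0" for s
    using that by (simp add: norm_mult norm_powr_real_powr z_def)
  have "norm (?S * ?K) \<le> B * (4 * sqrt \<delta> * (1 + R)) + B * sqrt (2 * ln (1 / \<delta>) * D)"
  proof (rule le_of_forall_weighted_mean)
    show "0 \<le> B" "0 \<le> 2 * ln (1 / \<delta>)" "0 \<le> D" using B \<delta> D_nonneg by auto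
    fix y :: real assume y: "y > 0"
    \<comment> \<open>The majorant rests on \<open>W2\<close>, \<open>Wk\<close> and
      \<open>WR\<close> in turn. In the middle, \<open>norm (W s) / sqrt s\<close> is at most
      \<open>B\<close> times the product of \<open>sqrt (y / s)\<close> and
      \<open>sqrt (gap s / y)\<close>, to which the inequality of means applies.\<close>
    let ?g = "\<lambda>s. if s \<le> \<delta> then 2 * B * s powr (-1/2) else if s \<le> 1 / \<delta>
        then B / 2 * (y * (1 / s) + gap s / y) else 2 * B * R * s powr (-3/2)"
    have d1: "\<delta> \<le> 1 / \<delta>" using \<delta> by (smt (verit) divide_le_eq_1_pos le_divide_eq_1_pos)
    have g1: "(?g has_integral (2 * B * (\<delta> powr (-1/2 + 1) / (-1/2 + 1)))) {0..\<delta>}"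
      by (rule has_integral_eq[rotated, OF has_integral_mult_right[OF has_integral_powr_from_0]])
         (use \<delta> in auto)
    have "((\<lambda>s. B / 2 * (y * (1 / s) + gap s / y)) has_integral
         (B / 2 * (y * (ln (1 / \<delta>) - ln \<delta>) + (\<Phi> (1 / \<delta>) - \<Phi> \<delta>) / y))) {\<delta>..1 / \<delta>}"
    proof (intro has_integral_mult_right has_integral_add has_integral_divide gap_integral \<delta> d1)
      show "((\<lambda>s. 1 / s) has_integral (ln (1 / \<delta>) - ln \<delta>)) {\<delta>..1 / \<delta>}"
        by (rule fundamental_theorem_of_calculus[OF d1])
           (use \<delta> in \<open>auto simp: has_real_derivative_iff_has_vector_derivative[symmetric] divide_inverse
              intro!: derivative_eq_intros\<close>)
    qed
    then have g2: "(?g has_integral (B / 2 * (y * (ln (1 / \<delta>) - ln \<delta>) + (\<Phi> (1 / \<delta>) - \<Phi> \<delta>) / y))) {\<delta>..1 / \<delta>}"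
      by (rule has_integral_spike_finite[rotated 2, of _ _ _ "{\<delta>}"]) auto
    have "((\<lambda>s. 2 * B * R * s powr (-3/2)) has_integral (2 * B * R * (- ((1 / \<delta>) powr (-3/2 + 1)) / (-3/2 + 1)))) {1 / \<delta>..}"
      by (intro has_integral_mult_right has_integral_powr_to_inf) (use \<delta> in auto)
    then have g3: "(?g has_integral (2 * B * R * (- ((1 / \<delta>) powr (-3/2 + 1)) / (-3/2 + 1)))) {1 / \<delta>..}"
      by (rule has_integral_spike_finite[rotated 2, of _ _ _ "{1 / \<delta>}"]) (use d1 in auto)
    have "{0..\<delta>} \<inter> {\<delta>..1/\<delta>} = {\<delta>}" "({0..\<delta>} \<union> {\<delta>..1/\<delta>}) \<inter> {1/\<delta>..} = {1/\<delta>}"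
        "({0..\<delta>} \<union> {\<delta>..1/\<delta>}) \<union> {1/\<delta>..} = {0..}" using \<delta> d1 by auto
    then have g: "(?g has_integral (2 * B * (\<delta> powr (-1/2 + 1) / (-1/2 + 1))
        + B / 2 * (y * (ln (1 / \<delta>) - ln \<delta>) + (\<Phi> (1 / \<delta>) - \<Phi> \<delta>) / y)
        + 2 * B * R * (- ((1 / \<delta>) powr (-3/2 + 1)) / (-3/2 + 1)))) {0..}"
      using has_integral_Un[OF has_integral_Un[OF g1 g2] g3] by simp
    have fg: "norm (?f s) \<le> ?g s" if "s \<in> {0..}" for s
    proof (cases "s = 0")
      case False
      then have s: "s > 0" using that by simp
      have m: "s powr (-1/2) * norm (W s) \<le> B / 2 * (y * (1 / s) + gap s / y)"
      proof -
        let ?a = "sqrt (y / s)" and ?b = "sqrt (gap s / y)"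
        have "s powr (-1/2) * norm (W s) \<le> s powr (-1/2) * (B * sqrt (gap s))"
          by (intro mult_left_mono Wk s) auto
        also have "\<dots> = B * (?a * ?b)"
          using powr_minus[of s "1/2"] s y by (simp add: powr_half_sqrt real_sqrt_divide inverse_eq_divide)
        also have "\<dots> \<le> B * ((?a\<^sup>2 + ?b\<^sup>2) / 2)"
          using B sum_squares_bound[of ?a ?b] by (intro mult_left_mono) auto
        also have "\<dots> = B / 2 * (y * (1 / s) + gap s / y)"
          using s y gap_ge_0[OF s] by simp
        finally show ?thesis .
      qed
      have sm: "s powr (-1/2) * norm (W s) \<le> 2 * B * s powr (-1/2)"
        using mult_left_mono[OF W2[OF s], of "s powr (-1/2)"] by (simp add: mult_ac)
      have la: "s powr (-1/2) * norm (W s) \<le> 2 * B * R * s powr (-3/2)"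
      proof -
        have "s powr (-3/2) = s powr (-1/2) / s"
          using s powr_diff[of s "-1/2" 1] by simp
        then show ?thesis
          using mult_left_mono[OF WR[OF s], of "s powr (-1/2)"] by (simp add: mult_ac)
      qed
      show ?thesis unfolding nf[OF s] using m sm la by simp
    qed (use \<delta> in simp)
    have "norm (integral {0..} ?f) \<le> integral {0..} ?g"
      by (rule integral_norm_bound_integral) (use f0 g fg in \<open>auto simp: has_integral_iff\<close>)
    also have "integral {0..} ?g = 2 * B * (\<delta> powr (-1/2 + 1) / (-1/2 + 1))
        + B / 2 * (y * (ln (1 / \<delta>) - ln \<delta>) + (\<Phi> (1 / \<delta>) - \<Phi> \<delta>) / y)
        + 2 * B * R * (- ((1 / \<delta>) powr (-3/2 + 1)) / (-3/2 + 1))"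
      using g by (rule integral_unique)
    \<comment> \<open>The integrals of \<open>s powr (-1/2)\<close> up to \<open>\<delta>\<close>
      and of \<open>s powr (-3/2)\<close> from \<open>1 / \<delta>\<close> on both equal
      \<open>2 * sqrt \<delta>\<close>; with the 2 of the bounds this makes the 4.\<close>
    also have "\<dots> = 4 * B * sqrt \<delta> + B / 2 * (y * (2 * ln (1 / \<delta>)) + (\<Phi> (1 / \<delta>) - \<Phi> \<delta>) / y) + 4 * B * R * sqrt \<delta>"
      using powr_minus[of "1 / \<delta>" "1/2"] \<delta> by (simp add: powr_half_sqrt real_sqrt_divide ln_div)
    also have "\<dots> \<le> 4 * B * sqrt \<delta> + B / 2 * (y * (2 * ln (1 / \<delta>)) + D / y) + 4 * B * R * sqrt \<delta>"
      using gap_integral(2)[OF \<delta>(1) d1] B y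
      by (intro add_mono mult_left_mono divide_right_mono order_refl) auto
    finally show "norm (?S * ?K) \<le> B * (4 * sqrt \<delta> * (1 + R)) + B / 2 * (y * (2 * ln (1 / \<delta>)) + D / y)"
      unfolding integral_unique[OF f0] norm_minus_cancel by (simp only: distrib_left) (simp add: mult_ac)
  qed
  then have "norm ?S * (pi / cosh (pi * t)) \<le> B * (4 * sqrt \<delta> * (1 + R) + sqrt (2 * ln (1 / \<delta>) * D))"
    unfolding norm_mult nK by (simp add: algebra_simps)
  then show ?thesis using cosh_real_pos[of "pi * t"] by (simp add: field_simps)
qed

end

text \<open>For \<open>0 < D < 1\<close> the choice is \<open>\<delta> = D\<close>, and
  \<open>ln y \<le> y / e\<close> at \<open>y = D powr (- 2 \<epsilon>)\<close> absorbs the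
  logarithm. For \<open>D \<ge> 1\<close>, \<open>\<delta> = 1\<close> suffices since
  \<open>D powr (1/2 - \<epsilon>) \<ge> 1\<close>. For \<open>D = 0\<close>,
  \<open>\<delta>\<close> tends to 0.\<close>

lemma powr_le_of_log_bound:
  fixes X D R \<epsilon> :: real
  assumes X: "X \<ge> 0" and D: "D \<ge> 0" and R: "R \<ge> 0" and e: "0 < \<epsilon>" "\<epsilon> < 1/2"
    and H: "\<And>\<delta>. 0 < \<delta> \<Longrightarrow> \<delta> \<le> 1 \<Longrightarrow> X \<le> 4 * sqrt \<delta> * (1 + R) + sqrt (2 * ln (1 / \<delta>) * D)"
  shows "(1 / (4 * R + 4 + 1 / sqrt (\<epsilon> * exp 1)) * X) powr (1 / (1/2 - \<epsilon>)) \<le> D"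
proof (cases "D = 0")
  case True
  have "((\<lambda>\<delta>. 4 * sqrt \<delta> * (1 + R)) \<longlongrightarrow> 4 * sqrt 0 * (1 + R)) (at_right 0)"
    by (intro tendsto_intros)
  then have "X \<le> 4 * sqrt 0 * (1 + R)"
    by (rule tendsto_lowerbound) (use H True in \<open>auto intro!: eventually_at_rightI[of 0 1]\<close>)
  then show ?thesis using X D by simp
next
  case False
  then have D: "D > 0" using D by simp
  let ?C = "4 * R + 4 + 1 / sqrt (\<epsilon> * exp 1)"
  have C: "?C > 0" using R e by (simp add: add_pos_nonneg)
  have "X \<le> ?C * D powr (1/2 - \<epsilon>)"
  proof (cases "D \<ge> 1")
    case True
    have "X \<le> 4 * (1 + R)" using H[of 1] by simp
    also have "\<dots> \<le> ?C * 1" using e by simp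
    also have "\<dots> \<le> ?C * D powr (1/2 - \<epsilon>)"
      using True C e by (intro mult_left_mono ge_one_powr_ge_zero) auto
    finally show ?thesis .
  next
    case False
    then have D1: "D < 1" by simp
    have ln_le: "ln y \<le> y / exp 1" if "y > 0" for y :: real
      using ln_le_minus_one[of "y / exp 1"] that by (simp add: ln_div)
    have "2 * \<epsilon> * ln (1 / D) = ln (D powr (- (2 * \<epsilon>)))"
      using D by (simp add: ln_powr ln_div)
    also have "\<dots> \<le> D powr (- (2 * \<epsilon>)) / exp 1" using D by (intro ln_le) simp
    finally have "2 * ln (1 / D) \<le> D powr (- (2 * \<epsilon>)) / (\<epsilon> * exp 1)"
      using e by (simp add: field_simps)
    then have "2 * ln (1 / D) * D \<le> D powr (- (2 * \<epsilon>)) / (\<epsilon> * exp 1) * D"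
      using D by (intro mult_right_mono) auto
    also have "\<dots> = D powr (1 - 2 * \<epsilon>) / (\<epsilon> * exp 1)"
      using D powr_add[of D "- (2 * \<epsilon>)" 1] by (simp add: add.commute)
    finally have "sqrt (2 * ln (1 / D) * D) \<le> sqrt (D powr (1 - 2 * \<epsilon>) / (\<epsilon> * exp 1))" by simp
    also have "\<dots> = D powr (1/2 - \<epsilon>) * (1 / sqrt (\<epsilon> * exp 1))"
      using D by (simp add: real_sqrt_divide powr_half_sqrt[symmetric] powr_powr algebra_simps)
    finally have 1: "sqrt (2 * ln (1 / D) * D) \<le> D powr (1/2 - \<epsilon>) * (1 / sqrt (\<epsilon> * exp 1))" .
    have 2: "sqrt D \<le> D powr (1/2 - \<epsilon>)"
      unfolding powr_half_sqrt[symmetric, OF less_imp_le[OF D]] using D D1 e by (intro powr_mono') auto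
    have "X \<le> 4 * sqrt D * (1 + R) + sqrt (2 * ln (1 / D) * D)" using H[of D] D D1 by simp
    also have "\<dots> \<le> 4 * D powr (1/2 - \<epsilon>) * (1 + R) + D powr (1/2 - \<epsilon>) * (1 / sqrt (\<epsilon> * exp 1))"
      using R by (intro add_mono 1 mult_right_mono mult_left_mono 2) auto
    also have "\<dots> = ?C * D powr (1/2 - \<epsilon>)" by (simp add: algebra_simps)
    finally show ?thesis .
  qed
  then have "1 / ?C * X \<le> D powr (1/2 - \<epsilon>)" using C by (simp add: field_simps)
  then have "(1 / ?C * X) powr (1 / (1/2 - \<epsilon>)) \<le> (D powr (1/2 - \<epsilon>)) powr (1 / (1/2 - \<epsilon>))"
    using X C e by (intro powr_mono2) (auto intro: mult_nonneg_nonneg)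
  also have "\<dots> = D" using D e by (simp add: powr_powr)
  finally show ?thesis .
qed

section \<open>Integrals against the averaging density\<close>

lemma cosh_double_half: "cosh (pi * t) + 1 = 2 * (cosh (pi * (t / 2)))\<^sup>2" for t :: real
proof -
  have "cosh (2 * (pi * (t / 2))) + 1 = 2 * (cosh (pi * (t / 2)))\<^sup>2"
    by (simp only: cosh_double sinh_square_eq)
  then show ?thesis by simp
qed

lemma lborel_integral_FTC_nonneg:
  fixes f F :: "real \<Rightarrow> real"
  assumes der: "\<And>x. (F has_real_derivative f x) (at x)" and cont: "\<And>x. isCont f x" and nonneg: "\<And>x. f x \<ge> 0"
    and lim: "(F \<longlongrightarrow> B) at_top" "(F \<longlongrightarrow> A) at_bot"
  shows "integrable lborel f" "(LINT x|lborel. f x) = B - A"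
proof -
  have nn: "AE x in lborel. - \<infinity> < ereal x \<longrightarrow> ereal x < \<infinity> \<longrightarrow> 0 \<le> f x"
    using nonneg by simp
  have l: "((F \<circ> real_of_ereal) \<longlongrightarrow> A) (at_right (- \<infinity>))" "((F \<circ> real_of_ereal) \<longlongrightarrow> B) (at_left \<infinity>)"
    using lim by (simp_all add: ereal_tendsto_simps)
  have "- \<infinity> < (\<infinity> :: ereal)" by simp
  note FTC = interval_integral_FTC_nonneg[OF this der cont nn l]
  show "integrable lborel f" using FTC(1) by (simp add: set_integrable_def)
  show "(LINT x|lborel. f x) = B - A"
    using FTC(2) by (simp add: interval_lebesgue_integral_def set_lebesgue_integral_def)
qed

text \<open>By the half-angle identity the density is a multiple of \<open>1 / cosh^2\<close>, the
  derivative of \<open>tanh\<close>.\<close>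

lemma beta_density_integral:
  "integrable lborel (\<lambda>t::real. (pi/2) / (cosh (pi * t) + 1))"
  "(LINT t|lborel. (pi/2) / (cosh (pi * t) + 1)) = 1"
proof -
  let ?f = "\<lambda>t::real. (pi/2) / (cosh (pi * t) + 1)" and ?F = "\<lambda>t::real. tanh (pi * (t / 2)) / 2"
  have pos: "cosh (pi * t) + 1 > 0" for t :: real using cosh_real_pos[of "pi * t"] by linarith
  have der: "(?F has_real_derivative ?f t) (at t)" for t
  proof -
    have c: "cosh (pi * (t / 2)) \<noteq> 0" by simp
    have "1 - (tanh (pi * (t / 2)))\<^sup>2 = 1 / (cosh (pi * (t / 2)))\<^sup>2"
      using c hyperbolic_pythagoras[of "pi * (t / 2)"]
      by (simp add: tanh_def power_divide eq_divide_eq left_diff_distrib del: cosh_square_eq)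
    then have "?f t = (1 - (tanh (pi * (t / 2)))\<^sup>2) * (pi / 2) / 2"
      unfolding cosh_double_half by simp
    moreover have "(?F has_real_derivative (1 - (tanh (pi * (t / 2)))\<^sup>2) * (pi / 2) / 2) (at t)"
      using c by (auto intro!: derivative_eq_intros)
    ultimately show ?thesis by (simp only:)
  qed
  have cont: "isCont ?f t" for t
    using pos[of t] by (intro continuous_intros) simp_all
  have lim: "(?F \<longlongrightarrow> 1 / 2) at_top" "(?F \<longlongrightarrow> - 1 / 2) at_bot"
  proof -
    have "filterlim (\<lambda>t. pi * (t / 2)) at_top at_top" "filterlim (\<lambda>t. pi * (t / 2)) at_bot at_bot"
      by real_asymp+
    then have "((\<lambda>t. tanh (pi * (t / 2))) \<longlongrightarrow> 1) at_top" "((\<lambda>t. tanh (pi * (t / 2))) \<longlongrightarrow> - 1) at_bot"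
      using filterlim_compose tanh_real_at_top tanh_real_at_bot by blast+
    then show "(?F \<longlongrightarrow> 1 / 2) at_top" "(?F \<longlongrightarrow> - 1 / 2) at_bot"
      by (intro tendsto_divide tendsto_const; simp)+
  qed
  have nn: "?f t \<ge> 0" for t using pos[of t] by simp
  show "integrable lborel ?f" "(LINT t|lborel. ?f t) = 1"
    using lborel_integral_FTC_nonneg[OF der cont nn lim] by simp_all
qed

text \<open>The integrand simplifies to \<open>(pi / 4) / cosh (pi * (t / 2))\<close>, with
  primitive \<open>arctan (exp (pi * (t / 2)))\<close>. The value \<open>pi / 2\<close> cancels the
  loss of the rotated bounds under averaging.\<close>

lemma beta_density_cosh_integral:
  "integrable lborel (\<lambda>t::real. (pi/2) / (cosh (pi * t) + 1) * cosh (pi * (t / 2)))"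
  "(LINT t|lborel. (pi/2) / (cosh (pi * t) + 1) * cosh (pi * (t / 2))) = pi / 2"
proof -
  let ?f = "\<lambda>t::real. (pi/2) / (cosh (pi * t) + 1) * cosh (pi * (t / 2))" and ?F = "\<lambda>t::real. arctan (exp (pi * (t / 2)))"
  have pos: "cosh (pi * t) + 1 > 0" for t :: real using cosh_real_pos[of "pi * t"] by linarith
  have der: "(?F has_real_derivative ?f t) (at t)" for t
  proof -
    let ?e = "exp (pi * (t / 2))"
    have e: "?e > 0" by simp
    have "?f t = (pi / 4) / cosh (pi * (t / 2))"
      unfolding cosh_double_half by (simp add: power2_eq_square)
    also have "\<dots> = ?e * (pi / 2) / (1 + ?e\<^sup>2)"
      unfolding cosh_field_def exp_minus using e
      by (simp add: field_simps power2_eq_square add_pos_pos)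
    finally show ?thesis
      by (auto intro!: derivative_eq_intros simp: field_simps)
  qed
  have cont: "isCont ?f t" for t
    using pos[of t] by (intro continuous_intros) simp_all
  have lim: "(?F \<longlongrightarrow> pi / 2) at_top" "(?F \<longlongrightarrow> 0) at_bot"
    by real_asymp+
  have nn: "?f t \<ge> 0" for t using pos[of t] by simp
  show "integrable lborel ?f" "(LINT t|lborel. ?f t) = pi / 2"
    using lborel_integral_FTC_nonneg[OF der cont nn lim] by simp_all
qed

section \<open>Finitely supported matrices\<close>

text \<open>A single type for the matrices of all sizes: it is a \<open>ring\<close> (without unit), so that sums and products need no
  carrier conditions; the unit of the \<open>n \<times> n\<close> matrices becomes the idempotent \<open>idm n\<close>.\<close>
typedef fsmat = "{f :: nat \<Rightarrow> nat \<Rightarrow> complex. \<exists>m. \<forall>i j. m \<le> i \<or> m \<le> j \<longrightarrow> f i j = 0}"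
  morphisms ent Abs_fsmat
  by (rule exI[of _ "\<lambda>_ _. 0"]) simp

setup_lifting type_definition_fsmat

lemma fsmat_eqI: "(\<And>i j. ent x i j = ent y i j) \<Longrightarrow> x = y"
  by (metis ent_inject ext)

definition bounded_by :: "nat \<Rightarrow> fsmat \<Rightarrow> bool" where
  "bounded_by m x \<longleftrightarrow> (\<forall>i j. m \<le> i \<or> m \<le> j \<longrightarrow> ent x i j = 0)"

lemma ex_bounded_by: "\<exists>m. bounded_by m x"
  using ent[of x] unfolding bounded_by_def by simp

lemma bounded_by_mono: "bounded_by m x \<Longrightarrow> m \<le> m' \<Longrightarrow> bounded_by m' x"
  unfolding bounded_by_def by (meson order_trans)

lemma ent_Abs: "(\<And>i j. m \<le> i \<or> m \<le> j \<Longrightarrow> f i j = 0) \<Longrightarrow> ent (Abs_fsmat f) = f"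
  by (rule Abs_fsmat_inverse) blast

instantiation fsmat :: ring
begin

lift_definition zero_fsmat :: fsmat is "\<lambda>_ _. 0" by simp

lift_definition plus_fsmat :: "fsmat \<Rightarrow> fsmat \<Rightarrow> fsmat" is "\<lambda>f g i j. f i j + g i j"
proof -
  fix f g :: "nat \<Rightarrow> nat \<Rightarrow> complex"
  assume "\<exists>m. \<forall>i j. m \<le> i \<or> m \<le> j \<longrightarrow> f i j = 0" "\<exists>m. \<forall>i j. m \<le> i \<or> m \<le> j \<longrightarrow> g i j = 0"
  then obtain m m' where "\<forall>i j. m \<le> i \<or> m \<le> j \<longrightarrow> f i j = 0" "\<forall>i j. m' \<le> i \<or> m' \<le> j \<longrightarrow> g i j = 0"
    by blast
  then show "\<exists>m. \<forall>i j. m \<le> i \<or> m \<le> j \<longrightarrow> f i j + g i j = 0"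
    by (intro exI[of _ "max m m'"]) auto
qed

lift_definition uminus_fsmat :: "fsmat \<Rightarrow> fsmat" is "\<lambda>f i j. - f i j" by simp

definition minus_fsmat :: "fsmat \<Rightarrow> fsmat \<Rightarrow> fsmat" where
  "x - y = x + (- y :: fsmat)"

text \<open>Summing over the finite support of row \<open>i\<close> of \<open>x\<close> avoids
  choosing a common size; \<open>ent_times_left\<close> and \<open>ent_times_right\<close> then
  allow any bound of either factor as the range.\<close>

definition times_fsmat :: "fsmat \<Rightarrow> fsmat \<Rightarrow> fsmat" where
  "x * y = Abs_fsmat (\<lambda>i j. \<Sum>k\<in>{k. ent x i k \<noteq> 0}. ent x i k * ent y k j)"

lemma ent_times: "ent (x * y) i j = (\<Sum>k\<in>{k. ent x i k \<noteq> 0}. ent x i k * ent y k j)"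
proof -
  obtain m m' where m: "bounded_by m x" "bounded_by m' y" using ex_bounded_by by meson
  show ?thesis unfolding times_fsmat_def
  proof (subst ent_Abs[of "max m m'"])
    fix i j assume ij: "max m m' \<le> i \<or> max m m' \<le> j"
    show "(\<Sum>k | ent x i k \<noteq> 0. ent x i k * ent y k j) = 0"
    proof (rule sum.neutral, rule ballI)
      fix k show "ent x i k * ent y k j = 0"
        using ij m unfolding bounded_by_def by auto
    qed
  qed (rule refl)
qed

lemma ent_times_left: "ent (x * y) i j = (\<Sum>k<m. ent x i k * ent y k j)" if "bounded_by m x"
  unfolding ent_times
proof (rule sum.mono_neutral_left)
  show "{k. ent x i k \<noteq> 0} \<subseteq> {..<m}"
  proof
    fix k assume "k \<in> {k. ent x i k \<noteq> 0}"
    then have "\<not> m \<le> k" using that unfolding bounded_by_def by blast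
    then show "k \<in> {..<m}" by simp
  qed
qed auto

lemma ent_times_right: "ent (x * y) i j = (\<Sum>k<m. ent x i k * ent y k j)" if "bounded_by m y"
proof -
  obtain m' where m': "bounded_by m' x" using ex_bounded_by by blast
  have "ent (x * y) i j = (\<Sum>k<max m m'. ent x i k * ent y k j)"
    by (rule ent_times_left) (rule bounded_by_mono[OF m'], simp)
  also have "\<dots> = (\<Sum>k<m. ent x i k * ent y k j)"
    by (rule sum.mono_neutral_right) (use that in \<open>auto simp: bounded_by_def\<close>)
  finally show ?thesis .
qed

instance
proof
  fix a b c :: fsmat
  obtain m m' where m: "bounded_by m a" "bounded_by m' c" using ex_bounded_by by meson
  show "a * b * c = a * (b * c)"
  proof (rule fsmat_eqI)
    fix i j
    have "ent (a * b * c) i j = (\<Sum>l<m'. (\<Sum>k<m. ent a i k * ent b k l) * ent c l j)"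
      unfolding ent_times_right[OF m(2)] ent_times_left[OF m(1)] ..
    also have "\<dots> = (\<Sum>k<m. ent a i k * (\<Sum>l<m'. ent b k l * ent c l j))"
      unfolding sum_distrib_left sum_distrib_right by (subst sum.swap) (simp add: mult.assoc)
    also have "\<dots> = ent (a * (b * c)) i j"
      unfolding ent_times_right[OF m(2)] ent_times_left[OF m(1)] ..
    finally show "ent (a * b * c) i j = ent (a * (b * c)) i j" .
  qed
  show "(a + b) * c = a * c + b * c"
    by (rule fsmat_eqI) (simp add: ent_times_right[OF m(2)] plus_fsmat.rep_eq distrib_right sum.distrib)
  show "a * (b + c) = a * b + a * c"
    by (rule fsmat_eqI) (simp add: ent_times_left[OF m(1)] plus_fsmat.rep_eq distrib_left sum.distrib)
qed ((unfold minus_fsmat_def)?; transfer; simp add: fun_eq_iff)+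

end

lift_definition scl :: "complex \<Rightarrow> fsmat \<Rightarrow> fsmat" is "\<lambda>c f i j. c * f i j" by fastforce

lift_definition star :: "fsmat \<Rightarrow> fsmat" is "\<lambda>f i j. cnj (f j i)" by fastforce

lemma ent_diff: "ent (x - y) i j = ent x i j - ent y i j"
  unfolding minus_fsmat_def plus_fsmat.rep_eq uminus_fsmat.rep_eq by simp

lemmas ent_simps = zero_fsmat.rep_eq plus_fsmat.rep_eq ent_diff uminus_fsmat.rep_eq scl.rep_eq star.rep_eq

lemma ent_sum: "ent (sum f S) i j = (\<Sum>x\<in>S. ent (f x) i j)"
  by (induction S rule: infinite_finite_induct) (simp_all add: ent_simps)

text \<open>Complex scaling is registered as a vector space to obtain spans and independent sets,
  from which the conditional expectation is built as an orthogonal projection.\<close>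

global_interpretation scl: vector_space scl
  by standard (auto intro!: fsmat_eqI simp: ent_simps algebra_simps)

lemma scl_mult_left [simp]: "scl c x * y = scl c (x * y)"
proof -
  obtain m where m: "bounded_by m y" using ex_bounded_by by blast
  show ?thesis
    by (rule fsmat_eqI) (simp add: ent_times_right[OF m] ent_simps sum_distrib_left mult.assoc)
qed

lemma scl_mult_right [simp]: "x * scl c y = scl c (x * y)"
proof -
  obtain m where m: "bounded_by m x" using ex_bounded_by by blast
  show ?thesis
    by (rule fsmat_eqI) (simp add: ent_times_left[OF m] ent_simps sum_distrib_left mult_ac)
qed

lemma star_star [simp]: "star (star x) = x"
  by (rule fsmat_eqI) (simp add: ent_simps)

lemma star_zero [simp]: "star 0 = 0"
  by (rule fsmat_eqI) (simp add: ent_simps)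

lemma star_add: "star (x + y) = star x + star y"
  by (rule fsmat_eqI) (simp add: ent_simps)

lemma star_diff: "star (x - y) = star x - star y"
  by (rule fsmat_eqI) (simp add: ent_simps)

lemma star_scl: "star (scl c x) = scl (cnj c) (star x)"
  by (rule fsmat_eqI) (simp add: ent_simps)

lemma star_sum: "star (sum f S) = (\<Sum>x\<in>S. star (f x))"
  by (rule fsmat_eqI) (simp add: ent_simps ent_sum)

lemma star_mult: "star (x * y) = star y * star x"
proof -
  obtain m where m: "bounded_by m x" using ex_bounded_by by blast
  then have m': "bounded_by m (star x)" unfolding bounded_by_def by (auto simp: ent_simps)
  show ?thesis
    by (rule fsmat_eqI) (simp add: ent_times_left[OF m] ent_times_right[OF m'] ent_simps mult.commute)
qed

section \<open>Embedding of the \<open>n x n\<close> matrices\<close>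

definition emb :: "nat \<Rightarrow> complex mat \<Rightarrow> fsmat" where
  "emb n A = Abs_fsmat (\<lambda>i j. if i < n \<and> j < n then A $$ (i, j) else 0)"

lemma ent_emb: "ent (emb n A) i j = (if i < n \<and> j < n then A $$ (i, j) else 0)"
  unfolding emb_def by (subst ent_Abs[of n]) auto

lemma bounded_emb [simp]: "bounded_by n (emb n A)"
  unfolding bounded_by_def by (simp add: ent_emb)

definition unemb :: "nat \<Rightarrow> fsmat \<Rightarrow> complex mat" where
  "unemb n x = Matrix.mat n n (\<lambda>(i, j). ent x i j)"

lemma unemb_carrier [simp]: "unemb n x \<in> carrier_mat n n"
  unfolding unemb_def by simp

lemma emb_unemb: "bounded_by n x \<Longrightarrow> emb n (unemb n x) = x"
  by (rule fsmat_eqI) (auto simp: ent_emb unemb_def bounded_by_def not_less)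

lemma unemb_emb: "A \<in> carrier_mat n n \<Longrightarrow> unemb n (emb n A) = A"
  by (rule eq_matI) (auto simp: ent_emb unemb_def)

lemma emb_eq_iff: "A \<in> carrier_mat n n \<Longrightarrow> B \<in> carrier_mat n n \<Longrightarrow> emb n A = emb n B \<longleftrightarrow> A = B"
  by (metis unemb_emb)

lemma emb_add: "A \<in> carrier_mat n n \<Longrightarrow> B \<in> carrier_mat n n \<Longrightarrow> emb n (A + B) = emb n A + emb n B"
  by (rule fsmat_eqI) (auto simp: ent_emb ent_simps)

lemma emb_diff: "A \<in> carrier_mat n n \<Longrightarrow> B \<in> carrier_mat n n \<Longrightarrow> emb n (A - B) = emb n A - emb n B"
  by (rule fsmat_eqI) (auto simp: ent_emb ent_simps)

lemma emb_smult: "A \<in> carrier_mat n n \<Longrightarrow> emb n (c \<cdot>\<^sub>m A) = scl c (emb n A)"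
  by (rule fsmat_eqI) (auto simp: ent_emb ent_simps)

lemma emb_zero: "emb n (0\<^sub>m n n) = 0"
  by (rule fsmat_eqI) (auto simp: ent_emb ent_simps)

lemma adj_carrier [simp]: "A \<in> carrier_mat n n \<Longrightarrow> adj A \<in> carrier_mat n n"
  unfolding adj_def by simp

lemma emb_adj: "A \<in> carrier_mat n n \<Longrightarrow> emb n (adj A) = star (emb n A)"
  by (rule fsmat_eqI) (auto simp: ent_emb ent_simps adj_def)

lemma emb_mult: "A \<in> carrier_mat n n \<Longrightarrow> B \<in> carrier_mat n n \<Longrightarrow> emb n (A * B) = emb n A * emb n B"
  by (rule fsmat_eqI)
     (auto simp: ent_times_left[OF bounded_emb] ent_emb scalar_prod_def atLeast0LessThan)

definition idm :: "nat \<Rightarrow> fsmat" where "idm n = emb n (1\<^sub>m n)"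

definition diag :: "nat \<Rightarrow> (nat \<Rightarrow> complex) \<Rightarrow> fsmat" where "diag n g = emb n (dmat n g)"

lemma ent_idm: "ent (idm n) i j = (if i = j \<and> i < n then 1 else 0)"
  unfolding idm_def by (auto simp: ent_emb)

lemma ent_diag: "ent (diag n g) i j = (if i = j \<and> i < n then g i else 0)"
  unfolding diag_def dmat_def by (auto simp: ent_emb)

lemma bounded_idm [simp]: "bounded_by n (idm n)" and bounded_diag [simp]: "bounded_by n (diag n g)"
  unfolding idm_def diag_def by simp_all

lemma dmat_carrier [simp]: "dmat n g \<in> carrier_mat n n"
  unfolding dmat_def by simp

lemma ent_diag_left: "ent (diag n g * x) i j = (if i < n then g i * ent x i j else 0)"
proof (cases "i < n")
  case True
  have "(\<Sum>k<n. ent (diag n g) i k * ent x k j) = (\<Sum>k\<in>{i}. ent (diag n g) i k * ent x k j)"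
    by (rule sum.mono_neutral_right) (use True in \<open>auto simp: ent_diag\<close>)
  then show ?thesis using True by (simp add: ent_times_left[OF bounded_diag] ent_diag)
qed (simp add: ent_times_left[OF bounded_diag] ent_diag)

lemma ent_diag_right: "ent (x * diag n g) i j = (if j < n then ent x i j * g j else 0)"
proof (cases "j < n")
  case True
  have "(\<Sum>k<n. ent x i k * ent (diag n g) k j) = (\<Sum>k\<in>{j}. ent x i k * ent (diag n g) k j)"
    by (rule sum.mono_neutral_right) (use True in \<open>auto simp: ent_diag\<close>)
  then show ?thesis using True by (simp add: ent_times_right[OF bounded_diag] ent_diag)
qed (auto simp: ent_times_right[OF bounded_diag] ent_diag intro!: sum.neutral)

lemma idm_eq_diag: "idm n = diag n (\<lambda>_. 1)"
  by (rule fsmat_eqI) (simp add: ent_idm ent_diag)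

lemma idm_left: "bounded_by n x \<Longrightarrow> idm n * x = x"
  by (rule fsmat_eqI) (auto simp: idm_eq_diag ent_diag_left bounded_by_def)

lemma idm_right: "bounded_by n x \<Longrightarrow> x * idm n = x"
  by (rule fsmat_eqI) (auto simp: idm_eq_diag ent_diag_right bounded_by_def)

lemma bounded_mult: "bounded_by n x \<Longrightarrow> bounded_by n y \<Longrightarrow> bounded_by n (x * y)"
  unfolding bounded_by_def ent_times by (metis (no_types, lifting) mult_zero_left mult_zero_right sum.neutral)

lemma bounded_star: "bounded_by n x \<Longrightarrow> bounded_by n (star x)"
  unfolding bounded_by_def by (simp add: ent_simps)

lemma bounded_add: "bounded_by n x \<Longrightarrow> bounded_by n y \<Longrightarrow> bounded_by n (x + y)"
  unfolding bounded_by_def by (simp add: ent_simps)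

lemma bounded_diff: "bounded_by n x \<Longrightarrow> bounded_by n y \<Longrightarrow> bounded_by n (x - y)"
  unfolding bounded_by_def by (simp add: ent_simps)

lemma bounded_scl: "bounded_by n x \<Longrightarrow> bounded_by n (scl c x)"
  unfolding bounded_by_def by (simp add: ent_simps)

lemmas bounded_intros = bounded_mult bounded_star bounded_add bounded_diff bounded_scl bounded_idm bounded_diag bounded_emb

lemma star_idm [simp]: "star (idm n) = idm n"
  by (rule fsmat_eqI) (auto simp: ent_simps ent_idm)

lemma diag_mult: "diag n f * diag n g = diag n (\<lambda>i. f i * g i)"
  by (rule fsmat_eqI) (auto simp: ent_diag_left ent_diag)

lemma star_diag: "star (diag n f) = diag n (\<lambda>i. cnj (f i))"
  by (rule fsmat_eqI) (auto simp: ent_simps ent_diag)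

section \<open>Unitary diagonalization of Hermitian matrices\<close>

definition unitary :: "nat \<Rightarrow> fsmat \<Rightarrow> bool" where
  "unitary n U \<longleftrightarrow> bounded_by n U \<and> star U * U = idm n \<and> U * star U = idm n"

text \<open>An eigenvector exists because the spectrum of a complex matrix of positive size is
  nonempty. It is scaled to unit length and by a phase; the sign of the last entry matters since
  \<open>1 - c\<close> becomes a denominator in the reflection.\<close>

lemma exists_normalized_eigenvector:
  assumes a: "bounded_by (Suc n) a"
  obtains k f c where "\<And>i. i < Suc n \<Longrightarrow> (\<Sum>l<Suc n. ent a i l * f l) = k * f i"
    and "(\<Sum>i<Suc n. cnj (f i) * f i) = 1" and "f n = complex_of_real c" and "c \<le> 0"
proof -
  let ?A = "unemb (Suc n) a"
  have "spectrum ?A \<noteq> {}" by (rule spectrum_non_empty[of _ "Suc n"]) simp_all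
  then obtain k v where v: "eigenvector ?A v k" unfolding spectrum_def eigenvalue_def by blast
  have dim: "dim_row ?A = Suc n" unfolding unemb_def by simp
  from v have vc: "v \<in> carrier_vec (Suc n)" "v \<noteq> 0\<^sub>v (Suc n)" "?A *\<^sub>v v = k \<cdot>\<^sub>v v"
    unfolding eigenvector_def dim by auto
  have ev: "(\<Sum>l<Suc n. ent a i l * v $ l) = k * v $ i" if "i < Suc n" for i
  proof -
    have "(?A *\<^sub>v v) $ i = (\<Sum>l<Suc n. ent a i l * v $ l)"
      using that vc(1) unfolding unemb_def mult_mat_vec_def scalar_prod_def
      by (auto simp: lessThan_atLeast0 intro!: sum.cong)
    then show ?thesis using vc that by simp
  qed
  define S where "S = (\<Sum>i<Suc n. (cmod (v $ i))\<^sup>2)"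
  obtain i where "i < Suc n" "v $ i \<noteq> 0"
    using vc(1,2) by (metis carrier_vecD eq_vecI index_zero_vec(1,2))
  then have S: "S > 0" unfolding S_def by (intro sum_pos2[of _ i]) auto
  \<comment> \<open>The phase that turns the last entry into minus its modulus; for a zero entry,
    where \<open>sgn\<close> would give 0, it is set to 1.\<close>
  define g where "g = (if v $ n = 0 then 1 else - cnj (sgn (v $ n)))"
  have g: "cmod g = 1" unfolding g_def by (simp add: norm_sgn)
  define \<alpha> where "\<alpha> = g / complex_of_real (sqrt S)"
  show thesis
  proof (rule that[of "\<lambda>i. \<alpha> * v $ i" k "- cmod (v $ n) / sqrt S"])
    fix i assume "i < Suc n"
    have "(\<Sum>l<Suc n. ent a i l * (\<alpha> * v $ l)) = \<alpha> * (\<Sum>l<Suc n. ent a i l * v $ l)"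
      unfolding sum_distrib_left by (intro sum.cong) (simp_all add: mult_ac)
    with ev[OF \<open>i < Suc n\<close>] show "(\<Sum>l<Suc n. ent a i l * (\<alpha> * v $ l)) = k * (\<alpha> * v $ i)" by simp
  next
    have a2: "cnj \<alpha> * \<alpha> = complex_of_real (1 / S)"
      unfolding \<alpha>_def using S g complex_norm_square[of g]
      by (simp add: mult.commute power2_eq_square[symmetric] of_real_power[symmetric] del: of_real_power)
    have "(\<Sum>i<Suc n. cnj (\<alpha> * v $ i) * (\<alpha> * v $ i)) = cnj \<alpha> * \<alpha> * (\<Sum>i<Suc n. complex_of_real ((cmod (v $ i))\<^sup>2))"
      unfolding sum_distrib_left complex_norm_square by (intro sum.cong) (simp_all add: mult_ac)
    also have "(\<Sum>i<Suc n. complex_of_real ((cmod (v $ i))\<^sup>2)) = complex_of_real S"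
      unfolding S_def of_real_sum ..
    finally show "(\<Sum>i<Suc n. cnj (\<alpha> * v $ i) * (\<alpha> * v $ i)) = 1"
      unfolding a2 using S by (simp only: of_real_mult[symmetric]) simp
  next
    have "g * v $ n = - complex_of_real (cmod (v $ n))"
    proof (cases "v $ n = 0")
      case False
      have "cnj (sgn (v $ n)) * v $ n = complex_of_real (cmod (v $ n))"
        using False complex_norm_square[of "v $ n"]
        by (simp add: sgn_eq power2_eq_square field_simps)
      then show ?thesis using False by (simp add: g_def)
    qed simp
    then show "\<alpha> * v $ n = complex_of_real (- cmod (v $ n) / sqrt S)"
      unfolding \<alpha>_def by simp
  next
    show "- cmod (v $ n) / sqrt S \<le> 0" using S by (simp add: divide_nonneg_nonneg)
  qed
qed

text \<open>A Householder reflection \<open>H\<close> moves a unit eigenvector to the last basis vector, which splits off a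
  \<open>1 \<times> 1\<close> block; it is well defined because the eigenvector is scaled to have a last entry \<open>c \<le> 0\<close>.\<close>
theorem hermitian_diagonalization:
  assumes "bounded_by n a" "star a = a"
  shows "\<exists>U (d :: nat \<Rightarrow> real). unitary n U \<and> a = U * diag n (\<lambda>i. of_real (d i)) * star U"
  using assms
proof (induction n arbitrary: a)
  case 0
  have "a = 0" "idm 0 = 0"
    using 0 by (auto intro!: fsmat_eqI simp: bounded_by_def ent_simps ent_idm)
  then have "unitary 0 0" "a = 0 * diag 0 (\<lambda>i. of_real (0 :: real)) * star 0"
    by (simp_all add: unitary_def bounded_by_def ent_simps)
  then show ?case by (intro exI[of _ 0] exI[of _ "\<lambda>_. 0"] conjI)
next
  case (Suc n)
  let ?I = "idm (Suc n)"
  obtain k f c where f: "\<And>i. i < Suc n \<Longrightarrow> (\<Sum>l<Suc n. ent a i l * f l) = k * f i"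
    "(\<Sum>i<Suc n. cnj (f i) * f i) = 1" "f n = complex_of_real c" and c: "c \<le> 0"
    by (rule exists_normalized_eigenvector[OF Suc.prems(1)]) (rule that)
  \<comment> \<open>The eigenvector is the last column of \<open>V\<close>, and \<open>e\<close> is
    the matrix unit at the last diagonal position, so that vectors and their scalar products become
    products in the ring.\<close>
  define V where "V = emb (Suc n) (Matrix.mat (Suc n) (Suc n) (\<lambda>(i, j). if j = n then f i else 0))"
  have eV: "ent V i j = (if i < Suc n \<and> j = n then f i else 0)" for i j
    unfolding V_def by (auto simp: ent_emb)
  have bV [simp]: "bounded_by (Suc n) V" unfolding V_def by simp
  define e where "e = diag (Suc n) (\<lambda>i. if i = n then 1 else 0)"
  have ee: "ent e i j = (if i = n \<and> j = n then 1 else 0)" for i j unfolding e_def by (auto simp: ent_diag)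
  have be [simp]: "bounded_by (Suc n) e" unfolding e_def by simp
  have se [simp]: "star e = e" by (rule fsmat_eqI) (simp add: ee ent_simps)
  have e_e [simp]: "e * e = e" unfolding e_def by (rule fsmat_eqI) (simp add: ent_diag_left ent_diag)
  have xe: "ent (x * e) i j = (if j = n then ent x i n else 0)" for x i j
    unfolding e_def by (simp add: ent_diag_right)
  have ex: "ent (e * x) i j = (if i = n then ent x n j else 0)" for x i j
    unfolding e_def by (simp add: ent_diag_left)
  have aV: "a * V = scl k V"
  proof (rule fsmat_eqI)
    fix i j
    show "ent (a * V) i j = ent (scl k V) i j"
      using f(1)[of i] Suc.prems(1) unfolding ent_times_right[OF bV]
      by (cases "i < Suc n \<and> j = n") (auto simp: eV ent_simps bounded_by_def not_less)
  qed
  have VV: "star V * V = e"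
    by (rule fsmat_eqI) (use f(2) in \<open>auto simp: ent_times_right[OF bV] eV ee ent_simps\<close>)
  have Ve: "V * e = V" by (rule fsmat_eqI) (auto simp: xe eV)
  have eVe: "e * V = scl (of_real c) e" by (rule fsmat_eqI) (auto simp: ex eV ee ent_simps f(3))
  have sVe: "star V * e = scl (of_real c) e"
    using arg_cong[OF eVe, of star] by (simp add: star_mult star_scl)
  \<comment> \<open>The column of \<open>w\<close> is the last basis vector minus the eigenvector,
    of squared length \<open>2 (1 - c)\<close>, and \<open>r\<close> is 2 divided by that length:
    \<open>H\<close> is the reflection exchanging \<open>e\<close> and \<open>V\<close>.\<close>
  define w where "w = e - V"
  define r where "r = complex_of_real (1 / (1 - c))"
  have r: "r * (1 - of_real c) = 1" "r * (2 * (1 - of_real c)) = 2" "cnj r = r"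
  proof -
    have "complex_of_real (1 - c) \<noteq> 0" using c by (simp only: of_real_eq_0_iff)
    moreover have "1 - complex_of_real c = of_real (1 - c)" by simp
    ultimately show "r * (1 - of_real c) = 1" "r * (2 * (1 - of_real c)) = 2" "cnj r = r"
      unfolding r_def by (simp_all del: of_real_diff)
  qed
  have bw: "bounded_by (Suc n) w" unfolding w_def by (intro bounded_intros be bV)
  have we: "w * e = w" unfolding w_def by (simp add: left_diff_distrib Ve)
  have ww: "star w * w = scl (2 * (1 - of_real c)) e"
  proof -
    have "star w * w = e - scl (of_real c) e - scl (of_real c) e + e"
      unfolding w_def by (simp add: star_diff left_diff_distrib right_diff_distrib VV eVe sVe)
    also have "\<dots> = scl (2 * (1 - of_real c)) e"
      by (rule fsmat_eqI) (simp add: ent_simps algebra_simps)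
    finally show ?thesis .
  qed
  have swe: "star w * e = scl (1 - of_real c) e"
    unfolding w_def by (rule fsmat_eqI) (simp add: star_diff left_diff_distrib sVe ent_simps)
  define H where "H = ?I - scl r (w * star w)"
  have bH: "bounded_by (Suc n) H" unfolding H_def by (intro bounded_intros bw)
  have sH: "star H = H" unfolding H_def by (simp add: star_diff star_scl star_mult r)
  have "w * star w * (w * star w) = w * (star w * w) * star w" by (simp add: mult.assoc)
  also have "\<dots> = scl (2 * (1 - of_real c)) (w * star w)" unfolding ww by (simp add: we)
  finally have w4: "w * star w * (w * star w) = scl (2 * (1 - of_real c)) (w * star w)" .
  have bww: "bounded_by (Suc n) (w * star w)" by (intro bounded_intros bw)
  have HH: "H * H = ?I"
  proof -
    have "H * H = (?I - scl r (w * star w)) - scl r (w * star w - scl r (scl (2 * (1 - of_real c)) (w * star w)))"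
      unfolding H_def left_diff_distrib right_diff_distrib scl_mult_left scl_mult_right w4
      by (simp only: idm_left[OF bounded_idm] idm_left[OF bww] idm_right[OF bww]
          scl_mult_left scl_mult_right scl.scale_right_diff_distrib w4)
    also have "\<dots> = ?I - scl r (scl 2 (w * star w) - scl (r * (2 * (1 - of_real c))) (w * star w))"
      by (rule fsmat_eqI) (simp add: ent_simps algebra_simps)
    also have "\<dots> = ?I" unfolding r(2) by simp
    finally show ?thesis .
  qed
  have He: "H * e = V"
    unfolding H_def by (simp add: left_diff_distrib idm_left mult.assoc swe we r(1)) (simp add: w_def)
  define b where "b = H * a * H"
  have bb: "bounded_by (Suc n) b" unfolding b_def by (intro bounded_intros bH Suc.prems)
  have sb: "star b = b" unfolding b_def by (simp add: star_mult sH Suc.prems mult.assoc)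
  have b_e: "b * e = scl k e"
  proof -
    have "b * e = H * (a * V)" unfolding b_def by (simp add: mult.assoc He)
    also have "\<dots> = scl k (H * (H * e))" unfolding aV He by simp
    also have "H * (H * e) = e" using HH by (simp add: mult.assoc[symmetric] idm_left)
    finally show ?thesis .
  qed
  have e_b: "e * b = scl (cnj k) e"
    using arg_cong[OF b_e, of star] by (simp add: star_mult star_scl sb)
  have "e \<noteq> 0" using ee[of n n] by (auto simp: ent_simps)
  then have "k = cnj k"
    using arg_cong[OF b_e, of "\<lambda>x. e * x"] e_b by (auto simp: mult.assoc[symmetric])
  then obtain kr where k: "k = complex_of_real kr" by (metis Reals_cnj_iff Reals_cases)
  \<comment> \<open>Off the diagonal the last row and column of \<open>b\<close> vanish. Removing
    \<open>k e\<close> clears the last diagonal entry too, so \<open>b'\<close> is bounded by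
    \<open>n\<close> and the induction hypothesis applies.\<close>
  define b' where "b' = b - scl k e"
  have "b' * e = 0" "e * b' = 0"
    unfolding b'_def by (simp_all add: left_diff_distrib right_diff_distrib b_e e_b k)
  then have z: "ent (b' * e) i n = 0" "ent (e * b') n i = 0" for i by (simp_all add: ent_simps)
  have bb': "bounded_by (Suc n) b'" unfolding b'_def by (intro bounded_intros bb be)
  have b'n: "bounded_by n b'"
    unfolding bounded_by_def
  proof (intro allI impI)
    fix i j assume "n \<le> i \<or> n \<le> j"
    then consider "i = n" | "j = n" | "Suc n \<le> i \<or> Suc n \<le> j" by linarith
    then show "ent b' i j = 0"
      using z[of i] z[of j] bb' unfolding bounded_by_def xe ex by cases auto
  qed
  have "star b' = b'" unfolding b'_def by (simp add: star_diff star_scl sb k)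
  from Suc.IH[OF b'n this] obtain U d where U: "unitary n U"
    and b': "b' = U * diag n (\<lambda>i. of_real (d i)) * star U" by blast
  have bU: "bounded_by n U" and UU: "star U * U = idm n" "U * star U = idm n"
    using U unfolding unitary_def by auto
  have z1: "x * e = 0" "e * x = 0" if "bounded_by n x" for x
    using that unfolding bounded_by_def by (auto intro!: fsmat_eqI simp: xe ex ent_simps)
  have bsU: "bounded_by n (star U)" by (intro bounded_intros bU)
  have Ie: "idm n + e = ?I" by (rule fsmat_eqI) (auto simp: ent_simps ent_idm ee)
  let ?D = "diag n (\<lambda>i. of_real (d i))"
  define d' where "d' = (\<lambda>i. if i = n then kr else d i)"
  have D: "diag (Suc n) (\<lambda>i. of_real (d' i)) = ?D + scl k e"
    by (rule fsmat_eqI) (auto simp: ent_simps ent_diag ee d'_def k)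
  \<comment> \<open>\<open>U\<close> is extended by 1 in the last diagonal place.\<close>
  let ?W = "U + e"
  have W: "star ?W * ?W = ?I" "?W * star ?W = ?I"
    using z1[OF bU] z1[OF bsU] UU Ie by (simp_all add: star_add algebra_simps)
  have DU: "z1' = 0" if "z1' = U * ?D * e" for z1'
    using that z1(1)[of ?D] by (simp add: mult.assoc)
  have WD: "?W * (?D + scl k e) * star ?W = b"
  proof -
    have "?W * (?D + scl k e) * star ?W = U * ?D * star U + scl k e"
      using z1[OF bU] z1[OF bsU] z1[of ?D] z1[of "?D * star U"] bsU bounded_mult[of n ?D "star U"]
      by (simp add: star_add distrib_left distrib_right mult.assoc)
    then show ?thesis unfolding b'[symmetric] b'_def by simp
  qed
  have bW: "bounded_by (Suc n) ?W" by (intro bounded_intros bounded_by_mono[OF bU] be) simp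
  have "unitary (Suc n) (H * ?W)"
  proof -
    have "star ?W * (H * (H * ?W)) = star ?W * ((H * H) * ?W)" by (simp add: mult.assoc)
    also have "\<dots> = ?I" unfolding HH using bW W by (simp add: idm_left)
    finally have 1: "star (H * ?W) * (H * ?W) = ?I" by (simp add: star_mult sH mult.assoc)
    have "H * (?W * star ?W) * H = ?I" unfolding W using bH HH by (simp add: idm_right)
    then have 2: "(H * ?W) * star (H * ?W) = ?I" by (simp add: star_mult sH mult.assoc)
    show ?thesis unfolding unitary_def using 1 2 bounded_mult[OF bH bW] by blast
  qed
  moreover have "a = H * ?W * diag (Suc n) (\<lambda>i. of_real (d' i)) * star (H * ?W)"
  proof -
    have "H * ?W * diag (Suc n) (\<lambda>i. of_real (d' i)) * star (H * ?W) = H * b * H"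
      unfolding D star_mult sH WD[symmetric] by (simp only: mult.assoc)
    also have "\<dots> = (H * H) * a * (H * H)" unfolding b_def by (simp only: mult.assoc)
    also have "\<dots> = a" unfolding HH using Suc.prems(1) by (simp add: idm_left idm_right)
    finally show ?thesis ..
  qed
  ultimately show ?case by blast
qed

section \<open>Functional calculus\<close>

definition ucalc :: "nat \<Rightarrow> fsmat \<Rightarrow> (nat \<Rightarrow> complex) \<Rightarrow> fsmat" where
  "ucalc n U g = U * diag n g * star U"

lemma ucalc_mult:
  assumes "unitary n U"
  shows "ucalc n U f * ucalc n U g = ucalc n U (\<lambda>i. f i * g i)"
proof -
  have "ucalc n U f * ucalc n U g = U * (diag n f * ((star U * U) * diag n g)) * star U"
    unfolding ucalc_def by (simp only: mult.assoc)
  also have "\<dots> = ucalc n U (\<lambda>i. f i * g i)"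
    using assms unfolding unitary_def ucalc_def by (simp add: idm_left diag_mult)
  finally show ?thesis .
qed

lemma ucalc_one: "unitary n U \<Longrightarrow> ucalc n U (\<lambda>_. 1) = idm n"
  unfolding ucalc_def unitary_def by (simp add: idm_eq_diag[symmetric] idm_right)

lemma star_ucalc: "star (ucalc n U g) = ucalc n U (\<lambda>i. cnj (g i))"
  unfolding ucalc_def by (simp add: star_mult star_diag mult.assoc)

lemma ucalc_diff: "ucalc n U (\<lambda>i. f i - g i) = ucalc n U f - ucalc n U g"
proof -
  have "diag n (\<lambda>i. f i - g i) = diag n f - diag n g"
    by (rule fsmat_eqI) (simp add: ent_simps ent_diag)
  then show ?thesis unfolding ucalc_def by (simp add: left_diff_distrib right_diff_distrib)
qed

lemma ucalc_scl: "ucalc n U (\<lambda>i. c * f i) = scl c (ucalc n U f)"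
proof -
  have "diag n (\<lambda>i. c * f i) = scl c (diag n f)"
    by (rule fsmat_eqI) (simp add: ent_simps ent_diag)
  then show ?thesis unfolding ucalc_def by simp
qed

lemma ucalc_sum: "ucalc n U (\<lambda>i. \<Sum>x\<in>S. f x i) = (\<Sum>x\<in>S. ucalc n U (f x))"
proof -
  have "diag n (\<lambda>i. \<Sum>x\<in>S. f x i) = (\<Sum>x\<in>S. diag n (f x))"
  proof (rule fsmat_eqI)
    fix i j
    show "ent (diag n (\<lambda>i. \<Sum>x\<in>S. f x i)) i j = ent (\<Sum>x\<in>S. diag n (f x)) i j"
      unfolding ent_sum ent_diag by (cases "i = j \<and> i < n") (simp, simp only: if_False sum.neutral_const)
  qed
  then show ?thesis unfolding ucalc_def by (simp add: sum_distrib_left sum_distrib_right)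
qed

lemma ucalc_cong: "(\<And>i. i < n \<Longrightarrow> f i = g i) \<Longrightarrow> ucalc n U f = ucalc n U g"
proof -
  assume *: "\<And>i. i < n \<Longrightarrow> f i = g i"
  have "diag n f = diag n g" by (rule fsmat_eqI) (simp add: ent_diag *)
  then show ?thesis unfolding ucalc_def by simp
qed

text \<open>\<open>W = star U' * U\<close> intertwines the two diagonal matrices, so its entry at
  \<open>(i, j)\<close> vanishes unless \<open>d' i = d j\<close>. Hence it also intertwines their
  images under every \<open>f\<close>.\<close>

lemma ucalc_unique:
  assumes U: "unitary n U" and U': "unitary n U'"
    and eq: "ucalc n U (\<lambda>i. of_real (d i)) = ucalc n U' (\<lambda>i. of_real (d' i))"
  shows "ucalc n U (\<lambda>i. f (d i)) = ucalc n U' (\<lambda>i. f (d' i))"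
proof -
  define W where "W = star U' * U"
  have u: "star U * U = idm n" "U * star U = idm n" "star U' * U' = idm n" "U' * star U' = idm n"
    "bounded_by n U" "bounded_by n U'" using U U' unfolding unitary_def by auto
  have bW: "bounded_by n W" unfolding W_def by (intro bounded_intros u)
  have WU: "W * star U = star U'" "U' * W = U"
  proof -
    show "W * star U = star U'" unfolding W_def mult.assoc u by (intro idm_right bounded_intros u)
    show "U' * W = U" unfolding W_def mult.assoc[symmetric] u by (intro idm_left u)
  qed
  have "diag n (\<lambda>i. of_real (d' i)) * W = star U' * ucalc n U' (\<lambda>i. of_real (d' i)) * U"
    unfolding ucalc_def W_def mult.assoc[symmetric] u idm_left[OF bounded_diag] ..
  also have "\<dots> = star U' * ucalc n U (\<lambda>i. of_real (d i)) * U" unfolding eq ..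
  also have "\<dots> = W * diag n (\<lambda>i. of_real (d i)) * (star U * U)"
    unfolding ucalc_def W_def by (simp only: mult.assoc)
  also have "\<dots> = W * diag n (\<lambda>i. of_real (d i))"
    unfolding u by (intro idm_right bounded_intros bW)
  finally have *: "ent (diag n (\<lambda>i. of_real (d' i)) * W) i j = ent (W * diag n (\<lambda>i. of_real (d i))) i j" for i j
    by simp
  have **: "diag n (\<lambda>i. f (d' i)) * W = W * diag n (\<lambda>i. f (d i))"
  proof (rule fsmat_eqI)
    fix i j
    show "ent (diag n (\<lambda>i. f (d' i)) * W) i j = ent (W * diag n (\<lambda>i. f (d i))) i j"
    proof (cases "i < n \<and> j < n")
      case True
      then have "of_real (d' i) * ent W i j = ent W i j * of_real (d j)"
        using *[of i j] by (simp add: ent_diag_left ent_diag_right)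
      then have "ent W i j = 0 \<or> d' i = d j" by (simp add: mult.commute)
      then show ?thesis using True by (auto simp: ent_diag_left ent_diag_right)
    qed (use bW in \<open>auto simp: ent_diag_left ent_diag_right bounded_by_def not_less\<close>)
  qed
  have "ucalc n U (\<lambda>i. f (d i)) = U' * (W * diag n (\<lambda>i. f (d i))) * star U"
    unfolding ucalc_def by (simp only: WU mult.assoc[symmetric])
  also have "\<dots> = U' * diag n (\<lambda>i. f (d' i)) * (W * star U)"
    unfolding **[symmetric] by (simp only: mult.assoc)
  finally show ?thesis unfolding WU ucalc_def .
qed

text \<open>\<open>hfun\<close> selects some diagonalization; by \<open>ucalc_unique\<close> any
  diagonalization at hand computes its value.\<close>

lemma hfun_eq_ucalc:
  assumes A: "A \<in> carrier_mat n n" and U: "unitary n U" and eq: "emb n A = ucalc n U (\<lambda>i. of_real (d i))"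
  shows "hfun n f A \<in> carrier_mat n n" "emb n (hfun n f A) = ucalc n U (\<lambda>i. f (d i))"
proof -
  let ?P = "\<lambda>B. \<exists>V (d :: nat \<Rightarrow> real). V \<in> carrier_mat n n \<and> adj V * V = 1\<^sub>m n \<and> V * adj V = 1\<^sub>m n \<and>
      A = V * dmat n (\<lambda>i. complex_of_real (d i)) * adj V \<and> B = V * dmat n (\<lambda>i. f (d i)) * adj V"
  have emb_calc: "emb n (V * dmat n g * adj V) = ucalc n (emb n V) g" if "V \<in> carrier_mat n n" for V g
    using that unfolding ucalc_def diag_def
    by (simp add: emb_mult[OF mult_carrier_mat[OF that dmat_carrier] adj_carrier[OF that]]
        emb_mult[OF that dmat_carrier] emb_adj)
  have unit: "unitary n (emb n V)" if "V \<in> carrier_mat n n" "adj V * V = 1\<^sub>m n" "V * adj V = 1\<^sub>m n" for V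
    unfolding unitary_def idm_def
    by (simp only: emb_adj[OF that(1), symmetric] emb_mult[OF adj_carrier[OF that(1)] that(1), symmetric]
        emb_mult[OF that(1) adj_carrier[OF that(1)], symmetric] that bounded_emb)
  define V where "V = unemb n U"
  have V: "V \<in> carrier_mat n n" "emb n V = U" using U unfolding V_def unitary_def by (simp_all add: emb_unemb)
  have c: "adj V * V \<in> carrier_mat n n" "V * adj V \<in> carrier_mat n n"
      "V * dmat n (\<lambda>i. complex_of_real (d i)) * adj V \<in> carrier_mat n n"
    using V(1) by (auto intro!: mult_carrier_mat adj_carrier)
  have "?P (V * dmat n (\<lambda>i. f (d i)) * adj V)"
  proof (rule exI[of _ V], rule exI[of _ d], intro conjI)
    show "adj V * V = 1\<^sub>m n" "V * adj V = 1\<^sub>m n"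
      using U unfolding unitary_def
      by (simp_all add: emb_eq_iff[OF c(1) one_carrier_mat, symmetric] emb_eq_iff[OF c(2) one_carrier_mat, symmetric]
          emb_mult emb_adj V idm_def)
    show "A = V * dmat n (\<lambda>i. complex_of_real (d i)) * adj V"
      unfolding emb_eq_iff[OF A c(3), symmetric] emb_calc[OF V(1)] V(2) eq ..
  qed (rule V(1), rule refl)
  then have "?P (hfun n f A)" unfolding hfun_def by (rule someI[of ?P])
  then obtain V' and d' :: "nat \<Rightarrow> real" where V': "V' \<in> carrier_mat n n" "adj V' * V' = 1\<^sub>m n" "V' * adj V' = 1\<^sub>m n"
    "A = V' * dmat n (\<lambda>i. complex_of_real (d' i)) * adj V'" "hfun n f A = V' * dmat n (\<lambda>i. f (d' i)) * adj V'"
    by blast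
  show "hfun n f A \<in> carrier_mat n n"
    unfolding V'(5) using V'(1) by (auto intro!: mult_carrier_mat adj_carrier)
  have "ucalc n U (\<lambda>i. of_real (d i)) = ucalc n (emb n V') (\<lambda>i. of_real (d' i))"
    using eq V'(4) emb_calc[OF V'(1)] by simp
  from ucalc_unique[OF U unit[OF V'(1-3)] this, of f]
  show "emb n (hfun n f A) = ucalc n U (\<lambda>i. f (d i))"
    unfolding V'(5) emb_calc[OF V'(1)] by simp
qed

section \<open>Star-algebras and their spectral projections\<close>

locale star_algebra =
  fixes n :: nat and M :: "fsmat set"
  assumes bounded: "x \<in> M \<Longrightarrow> bounded_by n x"
    and one_closed: "idm n \<in> M"
    and add_closed: "x \<in> M \<Longrightarrow> y \<in> M \<Longrightarrow> x + y \<in> M"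
    and mult_closed: "x \<in> M \<Longrightarrow> y \<in> M \<Longrightarrow> x * y \<in> M"
    and scl_closed: "x \<in> M \<Longrightarrow> scl c x \<in> M"
    and star_closed: "x \<in> M \<Longrightarrow> star x \<in> M"
begin

lemma zero_closed: "0 \<in> M"
  using scl_closed[OF one_closed, of 0] by simp

lemma diff_closed: "x \<in> M \<Longrightarrow> y \<in> M \<Longrightarrow> x - y \<in> M"
  using add_closed[of x "scl (- 1) y"] scl_closed[of y "- 1"] by simp

lemma sum_closed: "(\<And>i. i \<in> S \<Longrightarrow> f i \<in> M) \<Longrightarrow> sum f S \<in> M"
  by (induction S rule: infinite_finite_induct) (auto intro: zero_closed add_closed)

lemmas closed = one_closed add_closed mult_closed scl_closed star_closed zero_closed diff_closed sum_closed

lemma one_left: "x \<in> M \<Longrightarrow> idm n * x = x" and one_right: "x \<in> M \<Longrightarrow> x * idm n = x"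
  using bounded by (simp_all add: idm_left idm_right)

end

lemma star_subalg_imp_star_algebra:
  assumes "star_subalg n M"
  shows "star_algebra n (emb n ` M)"
proof
  have c: "A \<in> carrier_mat n n" if "A \<in> M" for A using assms that unfolding star_subalg_def by auto
  show "idm n \<in> emb n ` M" using assms unfolding star_subalg_def idm_def by auto
  fix x assume x: "x \<in> emb n ` M"
  show "bounded_by n x" using x by auto
  from x obtain A where A: "A \<in> M" "x = emb n A" by auto
  show "star x \<in> emb n ` M"
    using assms A emb_adj[OF c[OF A(1)]] unfolding star_subalg_def by (metis imageI)
  show "scl k x \<in> emb n ` M" for k
    using assms A emb_smult[OF c[OF A(1)]] unfolding star_subalg_def by (metis imageI)
  fix y assume "y \<in> emb n ` M"
  then obtain B where B: "B \<in> M" "y = emb n B" by auto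
  show "x + y \<in> emb n ` M"
    using assms A B emb_add[OF c[OF A(1)] c[OF B(1)]] unfolding star_subalg_def by (metis imageI)
  show "x * y \<in> emb n ` M"
    using assms A B emb_mult[OF c[OF A(1)] c[OF B(1)]] unfolding star_subalg_def by (metis imageI)
qed

text \<open>\<open>S\<close> is the spectrum of \<open>a\<close> and \<open>P \<lambda>\<close> the spectral projection at \<open>\<lambda>\<close>.\<close>
locale spectral_resolution = star_algebra +
  fixes a :: fsmat and S :: "real set" and P :: "real \<Rightarrow> fsmat"
  assumes fin: "finite S"
    and proj_closed: "r \<in> S \<Longrightarrow> P r \<in> M"
    and proj_star: "r \<in> S \<Longrightarrow> star (P r) = P r"
    and proj_nonzero: "r \<in> S \<Longrightarrow> P r \<noteq> 0"
    and proj_mult: "r \<in> S \<Longrightarrow> s \<in> S \<Longrightarrow> P r * P s = (if r = s then P r else 0)"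
    and sum_proj: "sum P S = idm n"
    and decomp: "a = (\<Sum>r\<in>S. scl (of_real r) (P r))"
begin

definition fcalc :: "(real \<Rightarrow> complex) \<Rightarrow> fsmat" where
  "fcalc f = (\<Sum>r\<in>S. scl (f r) (P r))"

lemma fcalc_closed: "fcalc f \<in> M"
  unfolding fcalc_def by (intro closed proj_closed)

lemma fcalc_cong: "(\<And>r. r \<in> S \<Longrightarrow> f r = g r) \<Longrightarrow> fcalc f = fcalc g"
  unfolding fcalc_def by (rule sum.cong) auto

lemma proj_fcalc: "r \<in> S \<Longrightarrow> P r * fcalc f = scl (f r) (P r)"
  unfolding fcalc_def using fin
  by (simp add: sum_distrib_left proj_mult if_distrib[of "scl _"] sum.delta cong: if_cong)

lemma fcalc_proj: "r \<in> S \<Longrightarrow> fcalc f * P r = scl (f r) (P r)"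
  unfolding fcalc_def using fin
  by (simp add: sum_distrib_right proj_mult if_distrib[of "scl _"] sum.delta' cong: if_cong)

lemma fcalc_mult: "fcalc f * fcalc g = fcalc (\<lambda>r. f r * g r)"
proof -
  have "fcalc f * fcalc g = (\<Sum>r\<in>S. scl (f r) (P r * fcalc g))"
    unfolding fcalc_def[of f] by (simp add: sum_distrib_right)
  also have "\<dots> = fcalc (\<lambda>r. f r * g r)"
    unfolding fcalc_def[of "\<lambda>r. f r * g r"] by (intro sum.cong refl) (simp add: proj_fcalc)
  finally show ?thesis .
qed

lemma star_fcalc: "star (fcalc f) = fcalc (\<lambda>r. cnj (f r))"
  unfolding fcalc_def star_sum star_scl by (intro sum.cong refl) (simp add: proj_star)

lemma fcalc_one: "fcalc (\<lambda>_. 1) = idm n"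
  unfolding fcalc_def using sum_proj by simp

lemma fcalc_id: "fcalc of_real = a"
  unfolding fcalc_def decomp ..

end

text \<open>Each spectral projection is a Lagrange interpolation polynomial in \<open>A\<close> and
  therefore lies in the algebra. Applied to the subalgebra, this keeps powers and logarithms of the
  reduced states inside it.\<close>

lemma (in star_algebra) exists_spectral_resolution:
  assumes A: "A \<in> carrier_mat n n" "emb n A \<in> M" "star (emb n A) = emb n A"
  obtains S P where "spectral_resolution n M (emb n A) S P"
    "\<And>f. hfun n f A \<in> carrier_mat n n"
    "\<And>f. emb n (hfun n f A) = spectral_resolution.fcalc S P f"
proof -
  obtain U and d :: "nat \<Rightarrow> real" where U: "unitary n U"
    and d: "emb n A = ucalc n U (\<lambda>i. of_real (d i))"
    using hermitian_diagonalization[OF bounded_emb A(3)] unfolding ucalc_def by blast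
  define S where "S = d ` {..<n}"
  define P where "P = (\<lambda>r. ucalc n U (\<lambda>i. if d i = r then 1 else 0))"
  have fin: "finite S" unfolding S_def by simp
  have calc: "ucalc n U (\<lambda>i. f (d i)) = (\<Sum>r\<in>S. scl (f r) (P r))" for f
  proof -
    have "ucalc n U (\<lambda>i. f (d i)) = ucalc n U (\<lambda>i. \<Sum>r\<in>S. f r * (if d i = r then 1 else 0))"
    proof (rule ucalc_cong)
      fix i assume "i < n"
      then have "d i \<in> S" unfolding S_def by auto
      then show "f (d i) = (\<Sum>r\<in>S. f r * (if d i = r then 1 else 0))"
        using fin by (simp add: if_distrib[of "(*) _"] sum.delta cong: if_cong)
    qed
    then show ?thesis unfolding P_def ucalc_sum ucalc_scl .
  qed
  have poly: "ucalc n U (\<lambda>i. \<Prod>s\<in>T. of_real (d i) - of_real s) \<in> M" if "finite T" for T :: "real set"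
    using that
  proof induction
    case empty
    then show ?case using one_closed U by (simp add: ucalc_one)
  next
    case (insert s T)
    have "ucalc n U (\<lambda>i. of_real (d i) - of_real s * 1) = emb n A - scl (of_real s) (idm n)"
      unfolding ucalc_diff ucalc_scl ucalc_one[OF U] d ..
    then have "ucalc n U (\<lambda>i. of_real (d i) - of_real s) \<in> M"
      using closed A(2) by simp
    from mult_closed[OF this insert.IH] show ?case
      unfolding ucalc_mult[OF U] using insert.hyps by simp
  qed
  have mem: "P r \<in> M" if "r \<in> S" for r
  proof -
    let ?T = "S - {r}"
    let ?c = "\<Prod>s\<in>?T. complex_of_real r - of_real s"
    have c: "?c \<noteq> 0" using fin by simp
    have "P r = ucalc n U (\<lambda>i. (1 / ?c) * (\<Prod>s\<in>?T. of_real (d i) - of_real s))"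
      unfolding P_def
    proof (rule ucalc_cong)
      fix i assume "i < n"
      then have "d i \<in> S" unfolding S_def by auto
      show "(if d i = r then 1 else 0) = (1 / ?c) * (\<Prod>s\<in>?T. complex_of_real (d i) - of_real s)"
      proof (cases "d i = r")
        case False
        then have "(\<Prod>s\<in>?T. complex_of_real (d i) - of_real s) = 0"
          using fin \<open>d i \<in> S\<close> by (intro prod_zero) auto
        then show ?thesis using False by simp
      qed (use c in simp)
    qed
    then show ?thesis using poly[of ?T] fin unfolding ucalc_scl by (simp add: scl_closed)
  qed
  have mult: "P r * P s = (if r = s then P r else 0)" for r s
  proof -
    have "P r * P s = ucalc n U (\<lambda>i. if r = s then (if d i = r then 1 else 0) else 0)"
      unfolding P_def ucalc_mult[OF U] by (rule ucalc_cong) auto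
    moreover have "ucalc n U (\<lambda>_. 0) = 0"
      using ucalc_scl[of n U 0 "\<lambda>_. 0"] by simp
    ultimately show ?thesis unfolding P_def by simp
  qed
  have nz: "P r \<noteq> 0" if r: "r \<in> S" for r
  proof
    assume P0: "P r = 0"
    obtain i where i: "i < n" "d i = r" using r unfolding S_def by auto
    have u: "star U * U = idm n" using U unfolding unitary_def by simp
    have "star U * P r * U = (star U * U) * diag n (\<lambda>i. if d i = r then 1 else 0) * (star U * U)"
      unfolding P_def ucalc_def by (simp only: mult.assoc)
    also have "\<dots> = diag n (\<lambda>i. if d i = r then 1 else 0)"
      unfolding u by (simp add: idm_left idm_right bounded_intros)
    finally have "diag n (\<lambda>i. if d i = r then 1 else 0) = 0" unfolding P0 by simp
    then have "ent (diag n (\<lambda>i. if d i = r then 1 else 0)) i i = 0" by (simp add: ent_simps)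
    then show False using i by (simp add: ent_diag)
  qed
  have one: "sum P S = idm n"
    using calc[of "\<lambda>_. 1"] ucalc_one[OF U] by simp
  have dec: "emb n A = (\<Sum>r\<in>S. scl (of_real r) (P r))"
    using calc[of of_real] d by simp
  have star: "star (P r) = P r" for r
    unfolding P_def star_ucalc by (rule ucalc_cong) simp
  interpret R: spectral_resolution n M "emb n A" S P
    by unfold_locales (use fin mem mult nz one dec star in auto)
  show thesis
    by (rule that[of S P]) (use R.spectral_resolution_axioms hfun_eq_ucalc[OF A(1) U d] calc in \<open>auto simp: R.fcalc_def\<close>)
qed

section \<open>Traces and conditional expectations\<close>

locale traced = star_algebra +
  fixes tr :: "fsmat \<Rightarrow> complex"
  assumes tr_add: "x \<in> M \<Longrightarrow> y \<in> M \<Longrightarrow> tr (x + y) = tr x + tr y"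
    and tr_comm: "x \<in> M \<Longrightarrow> y \<in> M \<Longrightarrow> tr (x * y) = tr (y * x)"
    and tr_scl: "x \<in> M \<Longrightarrow> tr (scl c x) = c * tr x"
    and tr_real: "x \<in> M \<Longrightarrow> Im (tr (star x * x)) = 0"
    and tr_nonneg: "x \<in> M \<Longrightarrow> Re (tr (star x * x)) \<ge> 0"
    and tr_faithful: "x \<in> M \<Longrightarrow> x \<noteq> 0 \<Longrightarrow> Re (tr (star x * x)) > 0"
begin

lemma tr_zero [simp]: "tr 0 = 0"
  using tr_scl[OF zero_closed, of 0] by simp

lemma tr_diff: "x \<in> M \<Longrightarrow> y \<in> M \<Longrightarrow> tr (x - y) = tr x - tr y"
  using tr_add[of "x - y" y] diff_closed by simp

lemma tr_sum: "(\<And>i. i \<in> S \<Longrightarrow> f i \<in> M) \<Longrightarrow> tr (sum f S) = (\<Sum>i\<in>S. tr (f i))"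
  by (induction S rule: infinite_finite_induct) (simp_all add: tr_add sum_closed)

text \<open>Polarisation: positivity of the trace on the squares of \<open>1 + x\<close> and \<open>1 + \<i> x\<close>.\<close>
lemma tr_star: "x \<in> M \<Longrightarrow> tr (star x) = cnj (tr x)"
proof -
  assume x: "x \<in> M"
  have *: "Im (tr (scl c x) + tr (star (scl c x))) = 0" for c
  proof -
    let ?y = "scl c x"
    have y: "?y \<in> M" "star ?y \<in> M" using x closed by auto
    have "star (idm n + ?y) * (idm n + ?y) = star (idm n) * idm n + (?y + star ?y) + star ?y * ?y"
      using one_left[OF x] one_right[OF star_closed[OF x]] one_left[OF star_closed[OF x]] one_right[OF x]
      by (simp add: star_add star_scl distrib_left distrib_right scl.scale_right_distrib)
    then have "tr (star (idm n + ?y) * (idm n + ?y)) = tr (star (idm n) * idm n) + (tr ?y + tr (star ?y)) + tr (star ?y * ?y)"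
      using x closed by (simp add: tr_add)
    then show ?thesis
      using tr_real[of "idm n + ?y"] tr_real[of "idm n"] tr_real[of ?y] y closed by simp
  qed
  have "Im (tr x) + Im (tr (star x)) = 0" using *[of 1] by simp
  moreover have "Re (tr x) - Re (tr (star x)) = 0"
    using *[of \<i>] x tr_scl[OF star_closed[OF x], of "- \<i>"]
    by (simp add: star_scl tr_scl del: scl.scale_minus_left)
  ultimately show ?thesis by (simp add: complex_eq_iff)
qed

definition ip :: "fsmat \<Rightarrow> fsmat \<Rightarrow> complex" where "ip x y = tr (star x * y)"

definition nrm :: "fsmat \<Rightarrow> real" where "nrm x = sqrt (Re (ip x x))"

lemma ip_add_right: "u \<in> M \<Longrightarrow> x \<in> M \<Longrightarrow> y \<in> M \<Longrightarrow> ip u (x + y) = ip u x + ip u y"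
  unfolding ip_def by (simp add: distrib_left tr_add closed)

lemma ip_diff_right: "u \<in> M \<Longrightarrow> x \<in> M \<Longrightarrow> y \<in> M \<Longrightarrow> ip u (x - y) = ip u x - ip u y"
  unfolding ip_def by (simp add: right_diff_distrib tr_diff closed)

lemma ip_scl_right: "u \<in> M \<Longrightarrow> x \<in> M \<Longrightarrow> ip u (scl c x) = c * ip u x"
  unfolding ip_def by (simp add: tr_scl closed)

lemma ip_sum_right: "u \<in> M \<Longrightarrow> (\<And>i. i \<in> S \<Longrightarrow> f i \<in> M) \<Longrightarrow> ip u (sum f S) = (\<Sum>i\<in>S. ip u (f i))"
  unfolding ip_def by (simp add: sum_distrib_left tr_sum closed)

lemma ip_zero_right [simp]: "ip u 0 = 0" and ip_zero_left [simp]: "ip 0 u = 0"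
  unfolding ip_def by simp_all

lemma ip_commute: "x \<in> M \<Longrightarrow> y \<in> M \<Longrightarrow> cnj (ip x y) = ip y x"
  unfolding ip_def by (simp add: tr_star[symmetric] closed star_mult)

lemma ip_add_left: "u \<in> M \<Longrightarrow> x \<in> M \<Longrightarrow> y \<in> M \<Longrightarrow> ip (x + y) u = ip x u + ip y u"
  unfolding ip_def by (simp add: star_add distrib_right tr_add closed)

lemma ip_diff_left: "u \<in> M \<Longrightarrow> x \<in> M \<Longrightarrow> y \<in> M \<Longrightarrow> ip (x - y) u = ip x u - ip y u"
  unfolding ip_def by (simp add: star_diff left_diff_distrib tr_diff closed)

lemma ip_scl_left: "u \<in> M \<Longrightarrow> x \<in> M \<Longrightarrow> ip (scl c x) u = cnj c * ip x u"
  unfolding ip_def by (simp add: star_scl tr_scl closed)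

lemma ip_sum_left: "u \<in> M \<Longrightarrow> (\<And>i. i \<in> S \<Longrightarrow> f i \<in> M) \<Longrightarrow> ip (sum f S) u = (\<Sum>i\<in>S. ip (f i) u)"
  unfolding ip_def by (simp add: star_sum sum_distrib_right tr_sum closed)

lemmas ip_simps = ip_add_right ip_diff_right ip_scl_right ip_sum_right ip_add_left ip_diff_left ip_scl_left ip_sum_left

lemma ip_self: "x \<in> M \<Longrightarrow> ip x x = of_real ((nrm x)\<^sup>2)"
  unfolding nrm_def ip_def using tr_real[of x] tr_nonneg[of x] by (simp add: complex_eq_iff)

lemma nrm_nonneg: "x \<in> M \<Longrightarrow> nrm x \<ge> 0"
  unfolding nrm_def ip_def using tr_nonneg[of x] by simp

lemma nrm_pos: "x \<in> M \<Longrightarrow> x \<noteq> 0 \<Longrightarrow> nrm x > 0"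
  unfolding nrm_def ip_def using tr_faithful[of x] by simp

lemma nrm_eqI: "ip x x = of_real r \<Longrightarrow> nrm x = sqrt r"
  unfolding nrm_def by simp

lemma Cauchy_Schwarz: "x \<in> M \<Longrightarrow> y \<in> M \<Longrightarrow> cmod (ip x y) \<le> nrm x * nrm y"
proof (cases "y = 0")
  case False
  assume x: "x \<in> M" and y: "y \<in> M"
  let ?N = "(nrm y)\<^sup>2" and ?c = "ip y x"
  have N: "?N > 0" using nrm_pos[OF y False] by simp
  let ?z = "x - scl (?c / of_real ?N) y"
  have c: "ip x y = cnj ?c" using ip_commute[OF y x] by simp
  have "ip ?z ?z = ip x x - (?c / of_real ?N) * cnj ?c - cnj (?c / of_real ?N) * ?c + cnj (?c / of_real ?N) * ((?c / of_real ?N) * ip y y)"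
    using x y closed by (simp add: ip_simps c algebra_simps)
  also have "\<dots> = of_real ((nrm x)\<^sup>2) - ?c * cnj ?c / of_real ?N"
    unfolding ip_self[OF x] ip_self[OF y] using N by (simp add: field_simps)
  also have "\<dots> = of_real ((nrm x)\<^sup>2 - (cmod ?c)\<^sup>2 / ?N)"
    by (simp add: complex_norm_square del: of_real_power)
  finally have "Re (ip ?z ?z) = (nrm x)\<^sup>2 - (cmod ?c)\<^sup>2 / ?N" by simp
  moreover have "Re (ip ?z ?z) \<ge> 0" unfolding ip_def using x y closed by (intro tr_nonneg) auto
  ultimately have "(cmod ?c)\<^sup>2 / ?N \<le> (nrm x)\<^sup>2" by linarith
  then have "(cmod ?c)\<^sup>2 \<le> (nrm x * nrm y)\<^sup>2"
    using N by (simp only: pos_divide_le_eq power_mult_distrib)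
  then have "cmod ?c \<le> nrm x * nrm y" by (rule power2_le_imp_le) (simp add: nrm_nonneg x y)
  then show ?thesis unfolding c by simp
qed (simp add: nrm_def)

lemma nrm_triangle: "x \<in> M \<Longrightarrow> y \<in> M \<Longrightarrow> nrm (x + y) \<le> nrm x + nrm y"
proof -
  assume x: "x \<in> M" and y: "y \<in> M"
  have "(nrm (x + y))\<^sup>2 = Re (ip (x + y) (x + y))"
    using ip_self[of "x + y"] x y closed by simp
  also have "\<dots> = (nrm x)\<^sup>2 + (nrm y)\<^sup>2 + Re (ip x y) + Re (ip y x)"
    using x y closed by (simp add: ip_simps ip_self[OF x] ip_self[OF y])
  also have "\<dots> \<le> (nrm x)\<^sup>2 + (nrm y)\<^sup>2 + nrm x * nrm y + nrm y * nrm x"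
    using Cauchy_Schwarz[OF x y] Cauchy_Schwarz[OF y x] complex_Re_le_cmod[of "ip x y"] complex_Re_le_cmod[of "ip y x"]
    by linarith
  also have "\<dots> = (nrm x + nrm y)\<^sup>2" by (simp add: power2_eq_square algebra_simps)
  finally show ?thesis by (rule power2_le_imp_le) (simp add: nrm_nonneg x y)
qed

lemma nrm_minus_commute: "nrm (x - y) = nrm (y - x)"
proof -
  have "star (x - y) * (x - y) = star (y - x) * (y - x)"
    by (simp add: star_diff algebra_simps)
  then show ?thesis unfolding nrm_def ip_def by simp
qed

lemma nrm_uminus: "nrm (- x) = nrm x"
  using nrm_minus_commute[of 0 x] by simp

lemma nrm_triangle_diff: "x \<in> M \<Longrightarrow> y \<in> M \<Longrightarrow> nrm (x - y) \<le> nrm x + nrm y"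
  using nrm_triangle[of x "- y"] diff_closed[OF zero_closed, of y] nrm_uminus[of y] by simp

text \<open>By faithfulness the single test element \<open>star (x - y)\<close> suffices.\<close>

lemma faithful_eqI:
  assumes "x \<in> M" "y \<in> M" "\<And>a. a \<in> {star (x - y)} \<Longrightarrow> tr (a * x) = tr (a * y)"
  shows "x = y"
proof (rule ccontr)
  assume "x \<noteq> y"
  have xy: "x - y \<in> M" "star (x - y) \<in> M" using assms closed by auto
  have "tr (star (x - y) * (x - y)) = 0"
    using assms(3)[of "star (x - y)"] assms xy closed by (simp add: right_diff_distrib tr_diff)
  then show False using tr_faithful[OF xy(1)] \<open>x \<noteq> y\<close> by simp
qed

lemma ip_span_zero:
  assumes B: "B \<subseteq> M" and z: "z \<in> M" "\<And>b. b \<in> B \<Longrightarrow> ip b z = 0" and u: "u \<in> scl.span B"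
  shows "u \<in> M \<and> ip u z = 0"
  using u
proof (induction rule: scl.span_induct_alt)
  case base
  then show ?case by (simp add: zero_closed)
next
  case (step c x y)
  then show ?case using B z by (auto simp: closed ip_simps)
qed

text \<open>Gram--Schmidt by induction: \<open>x\<close> and the new vector \<open>b\<close> are
  both projected to the span of \<open>B\<close>, and \<open>x\<close> is corrected along the
  remainder \<open>b - b0\<close>.\<close>

lemma exists_projection_span:
  assumes "finite B" "B \<subseteq> M" "x \<in> M"
  shows "\<exists>y \<in> scl.span B. y \<in> M \<and> (\<forall>b\<in>B. ip b (x - y) = 0)"
  using assms
proof (induction B arbitrary: x rule: finite_induct)
  case empty
  then show ?case by (intro bexI[of _ 0]) (auto simp: zero_closed scl.span_zero)
next
  case (insert b B)
  then have b: "b \<in> M" and B: "B \<subseteq> M" by auto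
  obtain b0 where b0: "b0 \<in> scl.span B" "b0 \<in> M" "\<forall>a\<in>B. ip a (b - b0) = 0"
    using insert.IH[OF B b] by blast
  obtain y where y: "y \<in> scl.span B" "y \<in> M" "\<forall>a\<in>B. ip a (x - y) = 0"
    using insert.IH[OF B insert.prems(2)] by blast
  let ?b = "b - b0"
  have bM: "?b \<in> M" using b b0 closed by auto
  \<comment> \<open>If the remainder is 0, the quotient is 0 by convention and orthogonality to the
    remainder is trivial.\<close>
  let ?c = "ip ?b x / ip ?b ?b"
  let ?y = "y + scl ?c ?b"
  have sub: "scl.span B \<subseteq> scl.span (insert b B)" by (rule scl.span_mono) auto
  have "?b \<in> scl.span (insert b B)"
    using b0(1) sub by (intro scl.span_diff) (auto intro: scl.span_base)
  then have span: "?y \<in> scl.span (insert b B)"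
    using y(1) sub by (intro scl.span_add scl.span_scale) auto
  have yM: "?y \<in> M" using y bM closed by auto
  have xy: "x - y \<in> M" using insert.prems y closed by auto
  have e: "x - ?y = (x - y) - scl ?c ?b" by simp
  have 1: "ip a (x - ?y) = 0" if "a \<in> B" for a
    unfolding e using that y b0 B bM xy by (simp add: ip_simps closed subset_iff)
  have yb: "ip ?b y = 0"
    using ip_span_zero[OF B bM _ y(1)] b0(3) ip_commute[OF y(2) bM] by auto
  have 2: "ip ?b (x - ?y) = 0"
  proof (cases "?b = 0")
    case False
    have "ip ?b ?b \<noteq> 0" using nrm_pos[OF bM False] ip_self[OF bM] by simp
    then show ?thesis using bM xy y insert.prems
      unfolding e by (simp add: ip_diff_right ip_scl_right closed yb)
  qed simp
  have xyM: "x - ?y \<in> M" using insert.prems yM closed by auto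
  have 3: "ip b0 (x - ?y) = 0"
    using ip_span_zero[OF B xyM 1 b0(1)] by simp
  have "ip b (x - ?y) = ip ?b (x - ?y) + ip b0 (x - ?y)"
    using ip_add_left[OF xyM bM b0(2)] by simp
  then have "ip b (x - ?y) = 0" using 2 3 by simp
  then show ?case using span yM 1 by (intro bexI[of _ ?y]) auto
qed

end

section \<open>The trace-preserving conditional expectation\<close>

lemma finite_spanning_set:
  assumes N: "\<And>x. x \<in> N \<Longrightarrow> bounded_by n x"
  obtains B where "finite B" "B \<subseteq> N" "N \<subseteq> scl.span B"
proof -
  define E where "E = (\<lambda>(i, j). emb n (Matrix.mat n n (\<lambda>(k, l). if k = i \<and> l = j then 1 else 0)))"
  have entE: "ent (E (i, j)) k l = (if k < n \<and> l < n \<and> k = i \<and> l = j then 1 else 0)" for i j k l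
    unfolding E_def by (simp add: ent_emb)
  let ?R = "{..<n} \<times> {..<n}"
  have "x \<in> scl.span (E ` ?R)" if "x \<in> N" for x
  proof -
    have "x = (\<Sum>r\<in>?R. scl (ent x (fst r) (snd r)) (E r))"
    proof (rule fsmat_eqI)
      fix k l
      show "ent x k l = ent (\<Sum>r\<in>?R. scl (ent x (fst r) (snd r)) (E r)) k l"
      proof (cases "k < n \<and> l < n")
        case True
        have "(\<Sum>r\<in>?R. ent x (fst r) (snd r) * ent (E r) k l) = (\<Sum>r\<in>{(k, l)}. ent x (fst r) (snd r) * ent (E r) k l)"
          by (rule sum.mono_neutral_right) (use True entE in \<open>auto split: if_splits\<close>)
        then show ?thesis using True by (simp add: ent_sum ent_simps entE)
      next
        case False
        have "ent (E r) k l = 0" for r using False entE by (cases r) auto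
        then show ?thesis using False N[OF that] unfolding bounded_by_def
          by (auto simp: ent_sum ent_simps not_less)
      qed
    qed
    also have "\<dots> \<in> scl.span (E ` ?R)"
      by (intro scl.span_sum scl.span_scale scl.span_base) auto
    finally show ?thesis .
  qed
  then have NE: "N \<subseteq> scl.span (E ` ?R)" by blast
  obtain B where B: "B \<subseteq> N" "scl.independent B" "N \<subseteq> scl.span B"
    using scl.maximal_independent_subset[of N] by blast
  have "finite B"
    using scl.independent_span_bound[of "E ` ?R" B] B NE by (meson finite_SigmaI finite_imageI finite_lessThan subset_trans)
  then show thesis using B that by blast
qed

locale traced_pair = traced n M tr + N: star_algebra n N for n M N tr +
  assumes sub: "N \<subseteq> M"
begin

sublocale N: traced n N tr
  by unfold_locales (use sub in \<open>auto intro: tr_add tr_comm tr_scl tr_real tr_nonneg tr_faithful\<close>)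

text \<open>The witness is the orthogonal projection of \<open>x\<close> to \<open>N\<close> for the
  inner product of the trace. Orthogonality to \<open>star a\<close> is the trace identity for
  \<open>a\<close>.\<close>

lemma exists_cexp: "x \<in> M \<Longrightarrow> \<exists>y\<in>N. \<forall>a\<in>N. tr (a * y) = tr (a * x)"
proof -
  assume x: "x \<in> M"
  obtain B where B: "finite B" "B \<subseteq> N" "N \<subseteq> scl.span B"
    using finite_spanning_set[of N n] N.bounded by blast
  have BM: "B \<subseteq> M" using B sub by auto
  obtain y where y: "y \<in> scl.span B" "y \<in> M" "\<forall>b\<in>B. ip b (x - y) = 0"
    using exists_projection_span[OF B(1) BM x] by blast
  have "scl.span B \<subseteq> N"
    by (rule scl.span_minimal[OF B(2)])
       (auto simp: scl.subspace_def intro: N.closed)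
  then have yN: "y \<in> N" using y by auto
  have "tr (a * y) = tr (a * x)" if a: "a \<in> N" for a
  proof -
    have "star a \<in> scl.span B" using B(3) N.closed a by auto
    then have "ip (star a) (x - y) = 0"
      using ip_span_zero[OF BM, of "x - y"] y x closed by auto
    then show ?thesis
      using x y(2) a sub closed by (simp add: ip_def right_diff_distrib tr_diff subset_iff)
  qed
  then show ?thesis using yN by blast
qed

definition cexp :: "fsmat \<Rightarrow> fsmat" where
  "cexp x = (SOME y. y \<in> N \<and> (\<forall>a\<in>N. tr (a * y) = tr (a * x)))"

lemma cexp: "x \<in> M \<Longrightarrow> cexp x \<in> N" "x \<in> M \<Longrightarrow> a \<in> N \<Longrightarrow> tr (a * cexp x) = tr (a * x)"
  using someI_ex[of "\<lambda>y. y \<in> N \<and> (\<forall>a\<in>N. tr (a * y) = tr (a * x))"] exists_cexp[of x]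
  unfolding cexp_def by blast+

lemma cexp_unique: "x \<in> M \<Longrightarrow> y \<in> N \<Longrightarrow> (\<And>a. a \<in> N \<Longrightarrow> tr (a * y) = tr (a * x)) \<Longrightarrow> cexp x = y"
  using N.faithful_eqI[of "cexp x" y] cexp[of x] N.closed by auto

lemma cexp_N: "x \<in> N \<Longrightarrow> cexp x = x"
  using cexp_unique[of x x] sub by auto

lemma cexp_add: "x \<in> M \<Longrightarrow> y \<in> M \<Longrightarrow> cexp (x + y) = cexp x + cexp y"
  using cexp[of x] cexp[of y] sub
  by (intro cexp_unique) (auto simp: closed N.closed distrib_left tr_add subset_iff)

lemma cexp_scl: "x \<in> M \<Longrightarrow> cexp (scl c x) = scl c (cexp x)"
  using cexp[of x] sub by (intro cexp_unique) (auto simp: closed N.closed tr_scl subset_iff)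

text \<open>The trace identity characterises \<open>cexp\<close>, and cyclicity moves
  \<open>b\<close> to the front, where \<open>b * c * a\<close> is again a test element of
  \<open>N\<close>.\<close>

lemma cexp_bimodule: "x \<in> M \<Longrightarrow> a \<in> N \<Longrightarrow> b \<in> N \<Longrightarrow> cexp (a * x * b) = a * cexp x * b"
proof -
  assume x: "x \<in> M" and ab: "a \<in> N" "b \<in> N"
  have M: "a \<in> M" "b \<in> M" "cexp x \<in> M" using ab cexp[OF x] sub by auto
  show ?thesis
  proof (rule cexp_unique)
    fix c assume c: "c \<in> N"
    then have cM: "c \<in> M" using sub by auto
    have "tr (c * (a * cexp x * b)) = tr ((c * a * cexp x) * b)" by (simp add: mult.assoc)
    also have "\<dots> = tr (b * (c * a * cexp x))" using M cM by (intro tr_comm closed)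
    also have "\<dots> = tr ((b * c * a) * cexp x)" by (simp add: mult.assoc)
    also have "\<dots> = tr ((b * c * a) * x)" using x ab c by (intro cexp N.closed)
    also have "\<dots> = tr (b * (c * a * x))" by (simp add: mult.assoc)
    also have "\<dots> = tr ((c * a * x) * b)" using M cM x by (intro tr_comm closed)
    finally show "tr (c * (a * cexp x * b)) = tr (c * (a * x * b))" by (simp add: mult.assoc)
  qed (use x ab M cexp[OF x] in \<open>auto intro: closed N.closed\<close>)
qed

lemma tr_cexp: "x \<in> M \<Longrightarrow> tr (cexp x) = tr x"
  using cexp(2)[of x "idm n"] cexp(1)[of x] N.one_closed N.one_left one_left by auto

lemma cexp_star: "x \<in> M \<Longrightarrow> cexp (star x) = star (cexp x)"
proof (rule cexp_unique)
  assume x: "x \<in> M"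
  show "star x \<in> M" "star (cexp x) \<in> N" using x cexp N.closed closed by auto
  fix a assume a: "a \<in> N"
  then have aM: "a \<in> M" "star a \<in> N" "cexp x \<in> M" using sub N.closed cexp[OF x] by auto
  have "tr (a * star (cexp x)) = cnj (tr (cexp x * star a))"
    using aM closed by (simp add: tr_star[symmetric] star_mult)
  also have "\<dots> = cnj (tr (star a * cexp x))" using aM closed by (simp add: tr_comm[of "cexp x"])
  also have "\<dots> = cnj (tr (x * star a))" using aM x cexp(2)[OF x aM(2)] closed by (simp add: tr_comm[of x])
  also have "\<dots> = tr (a * star x)"
    using aM x closed by (simp add: tr_star[symmetric] star_mult)
  finally show "tr (a * star (cexp x)) = tr (a * star x)" .
qed

end

section \<open>Relative modular operators\<close>

lemma sum_orthogonal:
  fixes f g :: "'i \<Rightarrow> complex"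
  assumes "finite I" and B: "\<And>i i'. i \<in> I \<Longrightarrow> i' \<in> I \<Longrightarrow> B i i' = (if i = i' then of_real (c i) else 0)"
  shows "(\<Sum>i\<in>I. \<Sum>i'\<in>I. cnj (f i) * (g i' * B i i')) = (\<Sum>i\<in>I. cnj (f i) * g i * of_real (c i))"
proof (intro sum.cong refl)
  fix i assume i: "i \<in> I"
  have "(\<Sum>i'\<in>I. cnj (f i) * (g i' * B i i')) = (\<Sum>i'\<in>I. if i' = i then cnj (f i) * g i * of_real (c i) else 0)"
    by (intro sum.cong refl) (use i B in auto)
  then show "(\<Sum>i'\<in>I. cnj (f i) * (g i' * B i i')) = cnj (f i) * g i * of_real (c i)"
    using i assms(1) by simp
qed

text \<open>\<open>x\<close> and \<open>y\<close> are the components of one unit vector \<open>h\<close> along the eigenspaces of the relative modular operator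
  \<open>T v = r\<^sup>2 v k\<^sup>2\<close> of the big algebra and of its compression to the small algebra.\<close>
locale modular_pair = traced n M tr for n M tr +
  fixes r k :: fsmat and I :: "'i set" and J :: "'j set" and x :: "'i \<Rightarrow> fsmat" and y :: "'j \<Rightarrow> fsmat"
    and l p :: "'i \<Rightarrow> real" and m q :: "'j \<Rightarrow> real"
  assumes rk: "r \<in> M" "k \<in> M" "star r = r" "star k = k"
    and fin: "finite I" "finite J"
    and x_closed: "i \<in> I \<Longrightarrow> x i \<in> M" and y_closed: "j \<in> J \<Longrightarrow> y j \<in> M"
    and l_pos: "i \<in> I \<Longrightarrow> l i > 0" and m_pos: "j \<in> J \<Longrightarrow> m j > 0"
    and x_orth: "i \<in> I \<Longrightarrow> i' \<in> I \<Longrightarrow> ip (x i) (x i') = (if i = i' then of_real (p i) else 0)"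
    and y_orth: "j \<in> J \<Longrightarrow> j' \<in> J \<Longrightarrow> ip (y j) (y j') = (if j = j' then of_real (q j) else 0)"
    and sums: "sum x I = sum y J"
    and x_eigen: "i \<in> I \<Longrightarrow> r * r * x i * (k * k) = scl (of_real (l i)) (x i)"
    and y_compress: "j \<in> J \<Longrightarrow> j' \<in> J \<Longrightarrow>
      ip (y j) (r * r * y j' * (k * k)) = (if j = j' then of_real (m j * q j) else 0)"
    and norm_one: "sum p I = 1"
begin

definition T :: "fsmat \<Rightarrow> fsmat" where "T v = r * r * v * (k * k)"

definition F :: "('i \<Rightarrow> complex) \<Rightarrow> fsmat" where "F f = (\<Sum>i\<in>I. scl (f i) (x i))"

definition G :: "('j \<Rightarrow> complex) \<Rightarrow> fsmat" where "G g = (\<Sum>j\<in>J. scl (g j) (y j))"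

lemma F_closed: "F f \<in> M" and G_closed: "G g \<in> M"
  unfolding F_def G_def by (intro closed x_closed y_closed; assumption)+

lemma T_closed: "v \<in> M \<Longrightarrow> T v \<in> M"
  unfolding T_def by (intro closed rk)

text \<open>One factor \<open>k\<close> moves around the trace, which exhibits \<open>T\<close> as
  the square of the map sending \<open>v\<close> to \<open>r * v * k\<close>. Symmetry and
  positivity of \<open>T\<close> follow.\<close>

lemma ip_T: "u \<in> M \<Longrightarrow> v \<in> M \<Longrightarrow> ip u (T v) = ip (r * u * k) (r * v * k)"
proof -
  assume "u \<in> M" "v \<in> M"
  then have "tr ((star u * r * r * v * k) * k) = tr (k * (star u * r * r * v * k))"
    by (intro tr_comm closed rk)
  then show ?thesis unfolding ip_def T_def by (simp add: star_mult rk mult.assoc)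
qed

lemma T_symmetric: "u \<in> M \<Longrightarrow> v \<in> M \<Longrightarrow> ip u (T v) = ip (T u) v"
  using ip_commute[OF _ T_closed, of v u] ip_commute[of "r * v * k" "r * u * k"]
  by (simp add: ip_T closed rk)

lemma T_nonneg: "v \<in> M \<Longrightarrow> Re (ip v (T v)) \<ge> 0"
  unfolding ip_T unfolding ip_def by (intro tr_nonneg closed rk)

lemma T_diff: "T (u - v) = T u - T v" and T_scl: "T (scl c v) = scl c (T v)"
  unfolding T_def by (simp_all add: algebra_simps)

lemma T_sum: "T (sum f S) = (\<Sum>i\<in>S. T (f i))"
  unfolding T_def by (simp add: sum_distrib_left sum_distrib_right)

lemma T_F: "T (F f) = F (\<lambda>i. of_real (l i) * f i)"
proof -
  have "T (F f) = (\<Sum>i\<in>I. scl (f i) (T (x i)))" unfolding F_def by (simp add: T_sum T_scl)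
  also have "\<dots> = F (\<lambda>i. of_real (l i) * f i)"
    unfolding F_def by (intro sum.cong refl) (simp add: T_def x_eigen mult.commute)
  finally show ?thesis .
qed

lemma F_add: "F f + F f' = F (\<lambda>i. f i + f' i)" and F_scl: "scl c (F f) = F (\<lambda>i. c * f i)"
  unfolding F_def by (simp_all add: sum.distrib scl.scale_left_distrib scl.scale_sum_right)

lemma G_add: "G g + G g' = G (\<lambda>i. g i + g' i)" and G_scl: "scl c (G g) = G (\<lambda>i. c * g i)"
  unfolding G_def by (simp_all add: sum.distrib scl.scale_left_distrib scl.scale_sum_right)

lemma F_G_one: "F (\<lambda>_. 1) = G (\<lambda>_. 1)"
  unfolding F_def G_def using sums by simp

lemma ip_F_F: "ip (F f) (F f') = (\<Sum>i\<in>I. cnj (f i) * f' i * of_real (p i))"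
proof -
  have "ip (F f) (F f') = (\<Sum>i\<in>I. \<Sum>i'\<in>I. cnj (f i) * (f' i' * ip (x i) (x i')))"
    unfolding F_def[of f]
    by (subst ip_sum_left[OF F_closed]) (auto simp: F_def ip_simps x_closed closed sum_distrib_left intro!: sum.cong)
  also have "\<dots> = (\<Sum>i\<in>I. cnj (f i) * f' i * of_real (p i))"
    by (rule sum_orthogonal) (use fin x_orth in auto)
  finally show ?thesis .
qed

lemma ip_G_G: "ip (G g) (G g') = (\<Sum>j\<in>J. cnj (g j) * g' j * of_real (q j))"
proof -
  have "ip (G g) (G g') = (\<Sum>j\<in>J. \<Sum>j'\<in>J. cnj (g j) * (g' j' * ip (y j) (y j')))"
    unfolding G_def[of g]
    by (subst ip_sum_left[OF G_closed]) (auto simp: G_def ip_simps y_closed closed sum_distrib_left intro!: sum.cong)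
  also have "\<dots> = (\<Sum>j\<in>J. cnj (g j) * g' j * of_real (q j))"
    by (rule sum_orthogonal) (use fin y_orth in auto)
  finally show ?thesis .
qed

lemma ip_G_T_G: "ip (G g) (T (G g')) = (\<Sum>j\<in>J. cnj (g j) * g' j * of_real (m j * q j))"
proof -
  have TG: "T (G g') = (\<Sum>j\<in>J. scl (g' j) (T (y j)))" unfolding G_def by (simp add: T_sum T_scl)
  have "ip (G g) (T (G g')) = (\<Sum>j\<in>J. \<Sum>j'\<in>J. cnj (g j) * (g' j' * ip (y j) (T (y j'))))"
    unfolding G_def[of g]
    by (subst ip_sum_left[OF T_closed[OF G_closed]])
       (auto simp: TG ip_simps y_closed closed T_closed sum_distrib_left intro!: sum.cong)
  also have "\<dots> = (\<Sum>j\<in>J. cnj (g j) * g' j * of_real (m j * q j))"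
    by (rule sum_orthogonal) (use fin y_compress in \<open>auto simp: T_def\<close>)
  finally show ?thesis .
qed

lemma p_nonneg: "i \<in> I \<Longrightarrow> p i \<ge> 0"
  using x_orth[of i i] tr_nonneg[OF x_closed, of i] unfolding ip_def by simp

lemma q_nonneg: "j \<in> J \<Longrightarrow> q j \<ge> 0"
  using y_orth[of j j] tr_nonneg[OF y_closed, of j] unfolding ip_def by simp

lemma sum_p_q: "sum p I = sum q J"
proof -
  have "complex_of_real (sum p I) = of_real (sum q J)"
    using ip_F_F[of "\<lambda>_. 1" "\<lambda>_. 1"] ip_G_G[of "\<lambda>_. 1" "\<lambda>_. 1"] unfolding F_G_one by simp
  then show ?thesis by (simp only: of_real_eq_iff)
qed

lemma mean_p_q: "(\<Sum>i\<in>I. p i * l i) = (\<Sum>j\<in>J. q j * m j)"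
proof -
  have "complex_of_real (\<Sum>i\<in>I. p i * l i) = of_real (\<Sum>j\<in>J. q j * m j)"
    using ip_F_F[of "\<lambda>_. 1" "\<lambda>i. of_real (l i) * 1"] ip_G_T_G[of "\<lambda>_. 1" "\<lambda>_. 1"]
    unfolding T_F[symmetric] F_G_one by (simp add: mult.commute)
  then show ?thesis by (simp only: of_real_eq_iff)
qed

lemma nrm_F: "nrm (F f) = sqrt (\<Sum>i\<in>I. (cmod (f i))\<^sup>2 * p i)"
proof (rule nrm_eqI)
  show "ip (F f) (F f) = of_real (\<Sum>i\<in>I. (cmod (f i))\<^sup>2 * p i)"
    unfolding ip_F_F of_real_sum of_real_mult complex_norm_square by (simp add: mult.commute)
qed

lemma nrm_G: "nrm (G g) = sqrt (\<Sum>j\<in>J. (cmod (g j))\<^sup>2 * q j)"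
proof (rule nrm_eqI)
  show "ip (G g) (G g) = of_real (\<Sum>j\<in>J. (cmod (g j))\<^sup>2 * q j)"
    unfolding ip_G_G of_real_sum of_real_mult complex_norm_square by (simp add: mult.commute)
qed

lemma nrm_F_le:
  "(\<And>i. i \<in> I \<Longrightarrow> 0 \<le> f i \<and> f i \<le> g i) \<Longrightarrow> nrm (F (\<lambda>i. of_real (f i))) \<le> sqrt (\<Sum>i\<in>I. (g i)\<^sup>2 * p i)"
  unfolding nrm_F by (auto intro!: sum_mono mult_right_mono power_mono simp: p_nonneg)

lemma nrm_G_le:
  "(\<And>j. j \<in> J \<Longrightarrow> 0 \<le> f j \<and> f j \<le> g j) \<Longrightarrow> nrm (G (\<lambda>j. of_real (f j))) \<le> sqrt (\<Sum>j\<in>J. (g j)\<^sup>2 * q j)"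
  unfolding nrm_G by (auto intro!: sum_mono mult_right_mono power_mono simp: q_nonneg)

text \<open>The vector \<open>G m\<close> is the compression of \<open>T\<close> applied to
  \<open>h\<close>, so its squared norm is its inner product with \<open>T h\<close>;
  Cauchy--Schwarz and cancellation finish. The second moment of the big algebra thereby bounds both
  parts of the tail.\<close>

lemma second_moment_le: "(\<Sum>j\<in>J. q j * (m j)\<^sup>2) \<le> (\<Sum>i\<in>I. p i * (l i)\<^sup>2)"
proof -
  let ?a = "\<Sum>j\<in>J. q j * (m j)\<^sup>2" and ?b = "\<Sum>i\<in>I. p i * (l i)\<^sup>2"
  have a: "?a \<ge> 0" using q_nonneg by (intro sum_nonneg) auto
  have "ip (G (\<lambda>j. of_real (m j))) (F (\<lambda>i. of_real (l i) * 1)) = of_real ?a"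
    unfolding T_F[symmetric] F_G_one ip_G_T_G
    by (simp add: power2_eq_square mult_ac)
  then have "?a \<le> nrm (G (\<lambda>j. of_real (m j))) * nrm (F (\<lambda>i. of_real (l i) * 1))"
    using Cauchy_Schwarz[OF G_closed F_closed, of "\<lambda>j. of_real (m j)" "\<lambda>i. of_real (l i) * 1"] a
    by (metis abs_of_nonneg norm_of_real)
  also have "\<dots> = sqrt ?a * sqrt ?b" unfolding nrm_F nrm_G by (simp add: mult.commute)
  finally have *: "sqrt ?a * sqrt ?a \<le> sqrt ?a * sqrt ?b"
    using a by (simp only: real_sqrt_mult_self abs_of_nonneg)
  show ?thesis
  proof (cases "?a = 0")
    case True
    then show ?thesis using p_nonneg by (simp add: sum_nonneg)
  next
    case False
    then have "sqrt ?a > 0" using a by simp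
    then have "sqrt ?a \<le> sqrt ?b" using * by (simp only: mult_le_cancel_left_pos)
    then show ?thesis by simp
  qed
qed

text \<open>This is the difference of resolvents \<open>w_s\<close>; the isometry \<open>V\<close>
  is already contained in the vectors \<open>y\<close>.\<close>

definition w :: "real \<Rightarrow> fsmat" where
  "w s = F (\<lambda>i. of_real (1 / (s + l i))) - G (\<lambda>j. of_real (1 / (s + m j)))"

lemma w_closed: "w s \<in> M"
  unfolding w_def by (intro closed F_closed G_closed)

text \<open>Let \<open>?L = s + T\<close>, so that \<open>?L ?\<xi> = h\<close>, while by
  \<open>y_compress\<close> \<open>?\<eta>\<close> solves the compressed equation. In the expansion
  of \<open>ip (w s) (?L (w s))\<close> both cross terms and the last term thus have the same value,
  and the difference of resolvents remains. The contribution of \<open>T\<close> is nonnegative and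
  is dropped.\<close>

lemma w_bound:
  assumes s: "s > 0"
  shows "s * (nrm (w s))\<^sup>2 \<le> (\<Sum>i\<in>I. p i / (s + l i)) - (\<Sum>j\<in>J. q j / (s + m j))"
proof -
  let ?\<xi> = "F (\<lambda>i. of_real (1 / (s + l i)))" and ?\<eta> = "G (\<lambda>j. of_real (1 / (s + m j)))"
  let ?h = "F (\<lambda>_. 1)" and ?L = "\<lambda>v. scl (of_real s) v + T v"
  have lp: "s + l i \<noteq> 0" if "i \<in> I" for i using l_pos[OF that] s by simp
  have mp: "s + m j \<noteq> 0" if "j \<in> J" for j using m_pos[OF that] s by simp
  note cl = F_closed G_closed T_closed closed
  have L\<xi>: "?L ?\<xi> = ?h"
    unfolding T_F F_scl F_add
    unfolding F_def
  proof (intro sum.cong refl)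
    fix i assume "i \<in> I"
    then have "of_real s * of_real (1 / (s + l i)) + of_real (l i) * of_real (1 / (s + l i)) = (1 :: complex)"
      using lp by (simp only: distrib_right[symmetric] of_real_add[symmetric] of_real_mult[symmetric]) simp
    then show "scl (of_real s * of_real (1 / (s + l i)) + of_real (l i) * of_real (1 / (s + l i))) (x i) = scl 1 (x i)"
      by (simp only:)
  qed
  have P: "ip ?\<xi> ?h = of_real (\<Sum>i\<in>I. p i / (s + l i))"
    unfolding ip_F_F by simp
  have Q1: "ip ?\<eta> ?h = of_real (\<Sum>j\<in>J. q j / (s + m j))" "ip ?h ?\<eta> = of_real (\<Sum>j\<in>J. q j / (s + m j))"
    unfolding F_G_one ip_G_G by simp_all
  have Q2: "ip ?\<xi> (?L ?\<eta>) = ip (?L ?\<xi>) ?\<eta>"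
    by (simp add: ip_simps cl T_symmetric)
  have Q3: "ip ?\<eta> (?L ?\<eta>) = of_real (\<Sum>j\<in>J. q j / (s + m j))"
  proof -
    have "ip ?\<eta> (?L ?\<eta>) = of_real s * ip ?\<eta> ?\<eta> + ip ?\<eta> (T ?\<eta>)" by (simp add: ip_simps cl)
    also have "\<dots> = (\<Sum>j\<in>J. of_real (s * (1 / (s + m j) * (1 / (s + m j)) * q j)) + of_real (1 / (s + m j) * (1 / (s + m j)) * (m j * q j)))"
      unfolding ip_G_G ip_G_T_G sum_distrib_left sum.distrib by simp
    also have "\<dots> = (\<Sum>j\<in>J. of_real (q j / (s + m j)))"
    proof (intro sum.cong refl)
      fix j assume "j \<in> J"
      then have "s * (1 / (s + m j) * (1 / (s + m j)) * q j) + 1 / (s + m j) * (1 / (s + m j)) * (m j * q j) = q j / (s + m j)"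
        using mp by (simp add: divide_simps) (simp add: algebra_simps)
      then show "complex_of_real (s * (1 / (s + m j) * (1 / (s + m j)) * q j)) + of_real (1 / (s + m j) * (1 / (s + m j)) * (m j * q j))
         = of_real (q j / (s + m j))"
        by (simp only: of_real_add[symmetric])
    qed
    finally show ?thesis by simp
  qed
  have "ip (w s) (?L (w s)) = ip (?\<xi> - ?\<eta>) (?L ?\<xi> - ?L ?\<eta>)"
    unfolding w_def by (simp add: T_diff scl.scale_right_diff_distrib algebra_simps)
  also have "\<dots> = ip ?\<xi> (?L ?\<xi>) - ip ?\<eta> (?L ?\<xi>) - (ip ?\<xi> (?L ?\<eta>) - ip ?\<eta> (?L ?\<eta>))"
    by (simp add: ip_diff_left ip_diff_right cl)
  also have "\<dots> = of_real ((\<Sum>i\<in>I. p i / (s + l i)) - (\<Sum>j\<in>J. q j / (s + m j)))"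
    unfolding Q2 L\<xi> P Q1 Q3 by simp
  finally have 1: "Re (ip (w s) (?L (w s))) = (\<Sum>i\<in>I. p i / (s + l i)) - (\<Sum>j\<in>J. q j / (s + m j))" by simp
  have "ip (w s) (?L (w s)) = of_real s * of_real ((nrm (w s))\<^sup>2) + ip (w s) (T (w s))"
    using w_closed[of s] by (simp add: ip_add_right ip_scl_right cl ip_self)
  then have "Re (ip (w s) (?L (w s))) = s * (nrm (w s))\<^sup>2 + Re (ip (w s) (T (w s)))" by simp
  then show ?thesis using 1 T_nonneg[OF w_closed, of s] by simp
qed

sublocale resolvent_weights I J l p m q
proof
  fix s :: real assume s: "s > 0"
  have "0 \<le> s * (nrm (w s))\<^sup>2" using s by simp
  also note w_bound[OF s]
  finally have "s * (\<Sum>j\<in>J. q j / (s + m j)) \<le> s * (\<Sum>i\<in>I. p i / (s + l i))" using s by simp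
  then show "(\<Sum>j\<in>J. q j * s / (s + m j)) \<le> (\<Sum>i\<in>I. p i * s / (s + l i))"
    unfolding sum_distrib_left by (simp add: mult.commute)
qed (use fin l_pos m_pos sum_p_q mean_p_q in auto)

text \<open>Pairing with the difference \<open>?u\<close> itself reduces the vector estimate to the
  scalar \<open>resolvent_bound\<close> with \<open>B = nrm ?u\<close>. The left side is then the
  square of \<open>nrm ?u\<close>, and one factor cancels.\<close>

theorem nrm_power_difference:
  fixes t \<delta> :: real
  defines "z \<equiv> Complex (1/2) t"
  assumes \<delta>: "0 < \<delta>" "\<delta> \<le> 1"
  shows "nrm (F (\<lambda>i. of_real (l i) powr z) - G (\<lambda>j. of_real (m j) powr z))
    \<le> cosh (pi * t) / pi * (4 * sqrt \<delta> * (1 + sqrt (\<Sum>i\<in>I. p i * (l i)\<^sup>2)) + sqrt (2 * ln (1 / \<delta>) * D))"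
proof -
  let ?u = "F (\<lambda>i. of_real (l i) powr z) - G (\<lambda>j. of_real (m j) powr z)"
  let ?R = "sqrt (\<Sum>i\<in>I. p i * (l i)\<^sup>2)"
  have u: "?u \<in> M" by (intro closed F_closed G_closed)
  define c where "c = (\<lambda>i. ip ?u (x i))"
  define d where "d = (\<lambda>j. ip ?u (y j))"
  have ipF: "ip ?u (F f) = (\<Sum>i\<in>I. c i * f i)" for f
    unfolding F_def[of f] c_def using u by (simp add: ip_sum_right ip_scl_right x_closed closed mult.commute)
  have ipG: "ip ?u (G g) = (\<Sum>j\<in>J. d j * g j)" for g
    unfolding G_def[of g] d_def using u by (simp add: ip_sum_right ip_scl_right y_closed closed mult.commute)
  have cd: "sum c I = sum d J"
    using ipF[of "\<lambda>_. 1"] ipG[of "\<lambda>_. 1"] unfolding F_G_one by simp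
  define W where "W = (\<lambda>s. (\<Sum>i\<in>I. c i * of_real (s / (s + l i))) - (\<Sum>j\<in>J. d j * of_real (s / (s + m j))))"
  have sw: "scl (of_real s) (w s) = F (\<lambda>i. of_real (s / (s + l i))) - G (\<lambda>j. of_real (s / (s + m j)))" for s
    unfolding w_def scl.scale_right_diff_distrib F_scl G_scl by simp
  have W: "W s = ip ?u (scl (of_real s) (w s))" for s
    unfolding sw W_def using u by (simp only: ip_diff_right F_closed G_closed ipF ipG)
  have nsw: "nrm (scl (of_real s) (w s)) = s * nrm (w s)" if "s > 0" for s
  proof -
    have "ip (scl (of_real s) (w s)) (scl (of_real s) (w s)) = of_real ((s * nrm (w s))\<^sup>2)"
      using w_closed[of s] by (simp add: ip_simps closed ip_self[OF w_closed] power2_eq_square)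
    from nrm_eqI[OF this] show ?thesis using that nrm_nonneg[OF w_closed, of s] by simp
  qed
  have CS: "norm (W s) \<le> nrm ?u * (s * nrm (w s))" if "s > 0" for s
    unfolding W nsw[OF that, symmetric] by (intro Cauchy_Schwarz u closed w_closed)
  have B: "nrm ?u \<ge> 0" using u by (rule nrm_nonneg)
  have "norm ((\<Sum>i\<in>I. c i * of_real (l i) powr z) - (\<Sum>j\<in>J. d j * of_real (m j) powr z))
    \<le> cosh (pi * t) / pi * (nrm ?u * (4 * sqrt \<delta> * (1 + ?R) + sqrt (2 * ln (1 / \<delta>) * D)))"
  proof (rule resolvent_bound[where t = t, folded z_def, OF cd B])
    show "?R \<ge> 0" using p_nonneg by (auto intro!: sum_nonneg)
    fix s :: real assume s: "s > 0"
    have lp: "s + l i > 0" if "i \<in> I" for i using l_pos[OF that] s by simp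
    have mp: "s + m j > 0" if "j \<in> J" for j using m_pos[OF that] s by simp
    have "s * nrm (w s) = nrm (F (\<lambda>i. of_real (s / (s + l i))) - G (\<lambda>j. of_real (s / (s + m j))))"
      unfolding nsw[OF s, symmetric] unfolding sw ..
    also have "\<dots> \<le> nrm (F (\<lambda>i. of_real (s / (s + l i)))) + nrm (G (\<lambda>j. of_real (s / (s + m j))))"
      by (intro nrm_triangle_diff F_closed G_closed)
    also have "\<dots> \<le> 1 + 1"
    proof (rule add_mono)
      have r: "0 \<le> s / (s + l i)" "s / (s + l i) \<le> 1" if "i \<in> I" for i
        using s lp[OF that] l_pos[OF that] by simp_all
      show "nrm (F (\<lambda>i. of_real (s / (s + l i)))) \<le> 1"
        using nrm_F_le[of "\<lambda>i. s / (s + l i)" "\<lambda>_. 1", OF conjI[OF r]] norm_one by simp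
      have r': "0 \<le> s / (s + m j)" "s / (s + m j) \<le> 1" if "j \<in> J" for j
        using s mp[OF that] m_pos[OF that] by simp_all
      show "nrm (G (\<lambda>j. of_real (s / (s + m j)))) \<le> 1"
        using nrm_G_le[of "\<lambda>j. s / (s + m j)" "\<lambda>_. 1", OF conjI[OF r']] norm_one sum_p_q by simp
    qed
    finally have 2: "s * nrm (w s) \<le> 2" by simp
    have eq: "a - c = d - b" if "a + b = c + d" for a b c d :: fsmat
      using that by (simp add: algebra_simps)
    \<comment> \<open>Both families sum to \<open>h\<close>, so \<open>s w_s\<close> is also a
      difference with coefficients \<open>m / (s + m)\<close> and \<open>l / (s + l)\<close>. These
      are at most \<open>m / s\<close> and \<open>l / s\<close>, which yields the decay for large
      \<open>s\<close>.\<close>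
    have "s * nrm (w s) = nrm (G (\<lambda>j. of_real (m j / (s + m j))) - F (\<lambda>i. of_real (l i / (s + l i))))"
    proof -
      have "F (\<lambda>i. of_real (s / (s + l i))) + F (\<lambda>i. of_real (l i / (s + l i))) = F (\<lambda>_. 1)"
        unfolding F_add unfolding F_def
        by (intro sum.cong refl) (use lp in \<open>simp add: add_divide_distrib[symmetric] of_real_add[symmetric] less_imp_neq[THEN not_sym] del: of_real_add of_real_divide\<close>)
      moreover have "G (\<lambda>j. of_real (s / (s + m j))) + G (\<lambda>j. of_real (m j / (s + m j))) = G (\<lambda>_. 1)"
        unfolding G_add unfolding G_def
        by (intro sum.cong refl) (use mp in \<open>simp add: add_divide_distrib[symmetric] of_real_add[symmetric] less_imp_neq[THEN not_sym] del: of_real_add of_real_divide\<close>)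
      ultimately have "F (\<lambda>i. of_real (s / (s + l i))) - G (\<lambda>j. of_real (s / (s + m j)))
         = G (\<lambda>j. of_real (m j / (s + m j))) - F (\<lambda>i. of_real (l i / (s + l i)))"
        using F_G_one eq by simp
      then show ?thesis
        unfolding nsw[OF s, symmetric] unfolding sw by simp
    qed
    also have "\<dots> \<le> nrm (G (\<lambda>j. of_real (m j / (s + m j)))) + nrm (F (\<lambda>i. of_real (l i / (s + l i))))"
      by (intro nrm_triangle_diff F_closed G_closed)
    also have "nrm (F (\<lambda>i. of_real (l i / (s + l i)))) \<le> sqrt (\<Sum>i\<in>I. (l i / s)\<^sup>2 * p i)"
      using s l_pos by (intro nrm_F_le) (auto intro!: divide_left_mono mult_pos_pos add_pos_pos simp: less_imp_le)
    also have "\<dots> = ?R / s"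
      using s by (simp add: power_divide real_sqrt_divide mult.commute flip: sum_divide_distrib)
    also have "nrm (G (\<lambda>j. of_real (m j / (s + m j)))) \<le> sqrt (\<Sum>j\<in>J. (m j / s)\<^sup>2 * q j)"
      using s m_pos by (intro nrm_G_le) (auto intro!: divide_left_mono mult_pos_pos add_pos_pos simp: less_imp_le)
    also have "\<dots> = sqrt (\<Sum>j\<in>J. q j * (m j)\<^sup>2) / s"
      using s by (simp add: power_divide real_sqrt_divide mult.commute flip: sum_divide_distrib)
    also have "\<dots> \<le> ?R / s"
      using s second_moment_le by (intro divide_right_mono) auto
    finally have 3: "s * nrm (w s) \<le> 2 * ?R / s" by simp
    have 4: "s * nrm (w s) \<le> sqrt (gap s)"
    proof (rule real_le_rsqrt)
      have "(s * nrm (w s))\<^sup>2 = s * (s * (nrm (w s))\<^sup>2)" by (simp add: power2_eq_square)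
      also have "\<dots> \<le> s * ((\<Sum>i\<in>I. p i / (s + l i)) - (\<Sum>j\<in>J. q j / (s + m j)))"
        using s by (intro mult_left_mono w_bound) auto
      also have "\<dots> = gap s" unfolding gap_def by (simp add: right_diff_distrib sum_distrib_left mult.commute)
      finally show "(s * nrm (w s))\<^sup>2 \<le> gap s" .
    qed
    show "norm ((\<Sum>i\<in>I. c i * of_real (s / (s + l i))) - (\<Sum>j\<in>J. d j * of_real (s / (s + m j)))) \<le> 2 * nrm ?u"
      using CS[OF s] mult_left_mono[OF 2 B] unfolding W_def by simp
    show "norm ((\<Sum>i\<in>I. c i * of_real (s / (s + l i))) - (\<Sum>j\<in>J. d j * of_real (s / (s + m j)))) \<le> 2 * nrm ?u * ?R / s"
      using CS[OF s] mult_left_mono[OF 3 B] unfolding W_def by (simp add: mult_ac)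
    show "norm ((\<Sum>i\<in>I. c i * of_real (s / (s + l i))) - (\<Sum>j\<in>J. d j * of_real (s / (s + m j)))) \<le> nrm ?u * sqrt (gap s)"
      using CS[OF s] mult_left_mono[OF 4 B] unfolding W_def by simp
  qed (use \<delta> in auto)
  moreover have "(\<Sum>i\<in>I. c i * of_real (l i) powr z) - (\<Sum>j\<in>J. d j * of_real (m j) powr z) = of_real ((nrm ?u)\<^sup>2)"
    unfolding ip_self[OF u, symmetric] ip_diff_right[OF u F_closed G_closed] ipF ipG ..
  ultimately have *: "nrm ?u * nrm ?u \<le> nrm ?u * (cosh (pi * t) / pi * (4 * sqrt \<delta> * (1 + ?R) + sqrt (2 * ln (1 / \<delta>) * D)))"
    by (simp add: power2_eq_square norm_mult mult_ac)
  show ?thesis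
  proof (cases "nrm ?u = 0")
    case True
    have "?R \<ge> 0" using p_nonneg by (auto intro!: sum_nonneg)
    then show ?thesis unfolding True using \<delta> D_nonneg by (auto intro!: mult_nonneg_nonneg add_nonneg_nonneg)
  next
    case False
    then have "nrm ?u > 0" using B by simp
    then show ?thesis using * by (simp only: mult_le_cancel_left_pos)
  qed
qed

end

section \<open>Recovery maps\<close>

text \<open>Written exactly as the function inside \<open>mpow\<close>; the addition law,
  conjugation and \<open>pw 0 r = 1\<close> hold for every real \<open>r\<close>, without
  positivity.\<close>

definition pw :: "complex \<Rightarrow> real \<Rightarrow> complex" where
  "pw z r = exp (z * of_real (ln r))"

lemma pw_mult: "pw z r * pw w r = pw (z + w) r"
  unfolding pw_def by (simp add: exp_add distrib_right)

lemma cnj_pw: "cnj (pw z r) = pw (cnj z) r"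
  unfolding pw_def by (simp add: exp_cnj)

lemma pw_zero [simp]: "pw 0 r = 1"
  unfolding pw_def by simp

lemma pw_of_real: "r > 0 \<Longrightarrow> pw (of_real c) r = of_real (r powr c)"
  unfolding pw_def powr_def by (simp add: exp_of_real[symmetric])

lemma pw_one [simp]: "r > 0 \<Longrightarrow> pw 1 r = of_real r"
  using pw_of_real[of r 1] by simp

lemma powr_eq_pw: "r > 0 \<Longrightarrow> of_real r powr z = pw z r"
  unfolding pw_def by (simp add: powr_def Ln_of_real)

lemma pw_divide: "a > 0 \<Longrightarrow> b > 0 \<Longrightarrow> pw z (a / b) = pw z a * pw (- z) b"
  unfolding pw_def by (simp add: ln_div right_diff_distrib exp_add[symmetric])

lemma (in traced) nrm_mult_unitary:
  "x \<in> M \<Longrightarrow> u \<in> M \<Longrightarrow> u * star u = idm n \<Longrightarrow> nrm (x * u) = nrm x"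
proof -
  assume x: "x \<in> M" "u \<in> M" "u * star u = idm n"
  have "ip (x * u) (x * u) = tr (star u * (star x * x * u))" unfolding ip_def by (simp add: star_mult mult.assoc)
  also have "\<dots> = tr (star x * x * (u * star u))"
    using tr_comm[of "star u" "star x * x * u"] x by (simp add: closed mult.assoc)
  also have "\<dots> = ip x x" unfolding ip_def x(3) using x one_right closed by simp
  finally show ?thesis unfolding nrm_def by simp
qed

text \<open>From \<open>2 (X\<^sup>* X - Y\<^sup>* Y) = (X - Y)\<^sup>* (X + Y) + (X + Y)\<^sup>* (X - Y)\<close>.\<close>
lemma (in traced) tr_square_difference:
  assumes X: "X \<in> M" "Y \<in> M" and u: "u \<in> M" "u * star u = idm n" and n: "nrm X = 1" "nrm Y = 1"
  shows "cmod (tr ((star X * X - star Y * Y) * u)) \<le> 2 * nrm (X - Y)"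
proof -
  have cl: "X - Y \<in> M" "X + Y \<in> M" using X closed by auto
  have s: "nrm (X + Y) \<le> 2" using nrm_triangle[OF X] n by simp
  have "ip (X - Y) ((X + Y) * u) + ip (X + Y) ((X - Y) * u)
      = tr (star (X - Y) * ((X + Y) * u) + star (X + Y) * ((X - Y) * u))"
    unfolding ip_def using X u by (intro tr_add[symmetric] closed)
  also have "star (X - Y) * ((X + Y) * u) + star (X + Y) * ((X - Y) * u)
      = (star X * X - star Y * Y) * u + (star X * X - star Y * Y) * u"
    by (simp add: star_diff star_add algebra_simps)
  also have "tr \<dots> = 2 * tr ((star X * X - star Y * Y) * u)"
    using X u by (subst tr_add) (auto intro!: closed)
  finally have "2 * cmod (tr ((star X * X - star Y * Y) * u)) = cmod (ip (X - Y) ((X + Y) * u) + ip (X + Y) ((X - Y) * u))"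
    by (simp add: norm_mult)
  also have "\<dots> \<le> cmod (ip (X - Y) ((X + Y) * u)) + cmod (ip (X + Y) ((X - Y) * u))"
    by (rule norm_triangle_ineq)
  also have "\<dots> \<le> nrm (X - Y) * nrm (X + Y) + nrm (X + Y) * nrm (X - Y)"
    using Cauchy_Schwarz[of "X - Y" "(X + Y) * u"] Cauchy_Schwarz[of "X + Y" "(X - Y) * u"] cl u
    by (intro add_mono) (simp_all add: nrm_mult_unitary closed)
  also have "\<dots> \<le> nrm (X - Y) * 2 + 2 * nrm (X - Y)"
    using s nrm_nonneg[OF cl(1)] by (intro add_mono mult_left_mono mult_right_mono) auto
  finally show ?thesis by simp
qed

section \<open>Joint weights of two spectral resolutions\<close>

locale two_resolutions = traced n M tr
    + R: spectral_resolution n M a S1 P + S: spectral_resolution n M b S2 Q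
  for n M tr a S1 P b S2 Q
begin

text \<open>The value is the trace of \<open>P r * Q s\<close>, written as a squared norm to be
  visibly nonnegative. Multiplied by the eigenvalues of the first and of the second state, these
  weights form the pair of Nussbaum--Szkola distributions, which turn traces of noncommuting
  products into sums over pairs of eigenvalues.\<close>

definition wt :: "real \<times> real \<Rightarrow> real" where
  "wt i = (nrm (P (fst i) * Q (snd i)))\<^sup>2"

lemma wt_nonneg: "wt i \<ge> 0"
  unfolding wt_def by simp

lemma tr_proj_mult: "r \<in> S1 \<Longrightarrow> s \<in> S2 \<Longrightarrow> tr (P r * Q s) = of_real (wt (r, s))"
proof -
  assume rs: "r \<in> S1" "s \<in> S2"
  have PQ: "P r \<in> M" "Q s \<in> M" using rs R.proj_closed S.proj_closed by auto
  have "of_real (wt (r, s)) = tr (Q s * (P r * (P r * Q s)))"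
    using ip_self[of "P r * Q s"] PQ rs
    by (simp add: wt_def ip_def star_mult closed R.proj_star S.proj_star mult.assoc)
  also have "\<dots> = tr (Q s * ((P r * P r) * Q s))" by (simp add: mult.assoc)
  also have "\<dots> = tr (Q s * (P r * Q s))" using R.proj_mult[OF rs(1) rs(1)] by simp
  also have "\<dots> = tr (P r * Q s * Q s)" using PQ by (intro tr_comm closed)
  also have "\<dots> = tr (P r * (Q s * Q s))" by (simp add: mult.assoc)
  also have "\<dots> = tr (P r * Q s)" using S.proj_mult[OF rs(2) rs(2)] by simp
  finally show ?thesis by simp
qed

lemma tr_sandwich:
  assumes m: "r \<in> S1" "r' \<in> S1" "s \<in> S2" "s' \<in> S2"
  shows "tr (Q s * (P r * P r') * Q s') = (if r = r' \<and> s = s' then of_real (wt (r, s)) else 0)"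
    and "tr (P r' * (Q s' * Q s) * P r) = (if r = r' \<and> s = s' then of_real (wt (r, s)) else 0)"
proof -
  note cl = R.proj_closed S.proj_closed m closed
  have *: "tr ((P r * P r') * (Q s' * Q s)) = (if r = r' \<and> s = s' then of_real (wt (r, s)) else 0)"
    using m by (simp add: R.proj_mult S.proj_mult tr_proj_mult)
  have "tr (Q s * (P r * P r' * Q s')) = tr ((P r * P r' * Q s') * Q s)" by (intro tr_comm cl)
  then show "tr (Q s * (P r * P r') * Q s') = (if r = r' \<and> s = s' then of_real (wt (r, s)) else 0)"
    using * by (simp only: mult.assoc)
  have "tr (P r' * ((Q s' * Q s) * P r)) = tr ((Q s' * Q s) * P r * P r')"
    "tr ((Q s' * Q s) * (P r * P r')) = tr ((P r * P r') * (Q s' * Q s))" by (intro tr_comm cl)+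
  then show "tr (P r' * (Q s' * Q s) * P r) = (if r = r' \<and> s = s' then of_real (wt (r, s)) else 0)"
    using * by (simp only: mult.assoc)
qed

lemma fcalc_mult_expand: "R.fcalc f * S.fcalc g = (\<Sum>(r, s)\<in>S1 \<times> S2. scl (f r * g s) (P r * Q s))"
  unfolding R.fcalc_def S.fcalc_def sum_product
  by (simp add: sum.cartesian_product mult.commute)

lemma tr_fcalc_mult: "tr (R.fcalc f * S.fcalc g) = (\<Sum>i\<in>S1 \<times> S2. f (fst i) * g (snd i) * of_real (wt i))"
proof -
  have "tr (R.fcalc f * S.fcalc g) = (\<Sum>i\<in>S1 \<times> S2. tr (case i of (r, s) \<Rightarrow> scl (f r * g s) (P r * Q s)))"
    unfolding fcalc_mult_expand by (intro tr_sum) (auto intro!: closed R.proj_closed S.proj_closed)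
  also have "\<dots> = (\<Sum>i\<in>S1 \<times> S2. f (fst i) * g (snd i) * of_real (wt i))"
    by (intro sum.cong refl) (auto simp: tr_scl closed R.proj_closed S.proj_closed tr_proj_mult)
  finally show ?thesis .
qed

text \<open>The summand is arranged as \<open>p * l * ln l\<close> with
  \<open>p = s * wt (r, s)\<close> and \<open>l = r / s\<close>, the shape in which \<open>D\<close>
  is defined.\<close>

lemma tr_rel_ent:
  assumes pos: "\<And>r. r \<in> S1 \<Longrightarrow> r > 0" "\<And>r. r \<in> S2 \<Longrightarrow> r > 0"
  shows "Re (tr (a * R.fcalc (\<lambda>r. of_real (ln r)) - a * S.fcalc (\<lambda>r. of_real (ln r))))
    = (\<Sum>i\<in>S1 \<times> S2. snd i * wt i * (fst i / snd i) * ln (fst i / snd i))"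
proof -
  have "a * R.fcalc (\<lambda>r. of_real (ln r)) = R.fcalc (\<lambda>r. of_real r * of_real (ln r)) * S.fcalc (\<lambda>_. 1)"
    using one_right[OF R.fcalc_closed] R.fcalc_mult[of of_real] by (simp add: S.fcalc_one R.fcalc_id)
  moreover have "a * S.fcalc (\<lambda>r. of_real (ln r)) = R.fcalc of_real * S.fcalc (\<lambda>r. of_real (ln r))"
    by (simp add: R.fcalc_id)
  ultimately have "tr (a * R.fcalc (\<lambda>r. of_real (ln r)) - a * S.fcalc (\<lambda>r. of_real (ln r)))
      = (\<Sum>i\<in>S1 \<times> S2. of_real (fst i * (ln (fst i) - ln (snd i)) * wt i))"
    using R.fcalc_closed S.fcalc_closed
    by (simp add: tr_diff closed tr_fcalc_mult sum_subtractf[symmetric] algebra_simps)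
  also have "\<dots> = of_real (\<Sum>i\<in>S1 \<times> S2. snd i * wt i * (fst i / snd i) * ln (fst i / snd i))"
    unfolding of_real_sum
  proof (intro sum.cong refl, elim SigmaE, hypsubst)
    fix r s assume "r \<in> S1" "s \<in> S2"
    then have "r > 0" "s > 0" using pos by auto
    then show "complex_of_real (fst (r, s) * (ln (fst (r, s)) - ln (snd (r, s))) * wt (r, s))
        = of_real (snd (r, s) * wt (r, s) * (fst (r, s) / snd (r, s)) * ln (fst (r, s) / snd (r, s)))"
      by (simp add: ln_div)
  qed
  finally show ?thesis by simp
qed

end

section \<open>Spectral data of the states and their reductions\<close>

locale recovery = traced_pair n M N tr
    + MM: two_resolutions n M tr \<rho> S1 P \<sigma> S2 Q
    + NN: two_resolutions n N tr "cexp \<rho>" S3 P' "cexp \<sigma>" S4 Q'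
  for n M N tr \<rho> S1 P \<sigma> S2 Q S3 P' S4 Q' +
  assumes pos: "r \<in> S1 \<Longrightarrow> r > 0" "r \<in> S2 \<Longrightarrow> r > 0" "r \<in> S3 \<Longrightarrow> r > 0" "r \<in> S4 \<Longrightarrow> r > 0"
    and states: "tr \<rho> = 1" "tr \<sigma> = 1"
begin

abbreviation "\<rho>N \<equiv> cexp \<rho>"
abbreviation "\<sigma>N \<equiv> cexp \<sigma>"
abbreviation "rpow z \<equiv> MM.R.fcalc (pw z)"
abbreviation "spow z \<equiv> MM.S.fcalc (pw z)"
abbreviation "rNpow z \<equiv> NN.R.fcalc (pw z)"
abbreviation "sNpow z \<equiv> NN.S.fcalc (pw z)"

lemma pow_mult:
  "rpow z * rpow w = rpow (z + w)" "spow z * spow w = spow (z + w)"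
  "rNpow z * rNpow w = rNpow (z + w)" "sNpow z * sNpow w = sNpow (z + w)"
  by (simp_all add: MM.R.fcalc_mult MM.S.fcalc_mult NN.R.fcalc_mult NN.S.fcalc_mult pw_mult)

lemma pow_star:
  "star (rpow z) = rpow (cnj z)" "star (spow z) = spow (cnj z)"
  "star (rNpow z) = rNpow (cnj z)" "star (sNpow z) = sNpow (cnj z)"
  by (simp_all add: MM.R.star_fcalc MM.S.star_fcalc NN.R.star_fcalc NN.S.star_fcalc cnj_pw)

lemma pow_zero: "rpow 0 = idm n" "spow 0 = idm n" "rNpow 0 = idm n" "sNpow 0 = idm n"
proof -
  have "pw 0 = (\<lambda>_. 1)" by (simp add: fun_eq_iff)
  then show "rpow 0 = idm n" "spow 0 = idm n" "rNpow 0 = idm n" "sNpow 0 = idm n"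
    by (simp_all add: MM.R.fcalc_one MM.S.fcalc_one NN.R.fcalc_one NN.S.fcalc_one)
qed

lemma pow_one: "rpow 1 = \<rho>" "spow 1 = \<sigma>" "rNpow 1 = \<rho>N" "sNpow 1 = \<sigma>N"
  using MM.R.fcalc_cong[of "pw 1" of_real] MM.S.fcalc_cong[of "pw 1" of_real]
    NN.R.fcalc_cong[of "pw 1" of_real] NN.S.fcalc_cong[of "pw 1" of_real] pos
  by (simp_all add: MM.R.fcalc_id MM.S.fcalc_id NN.R.fcalc_id NN.S.fcalc_id)

lemma pow_closed: "rpow z \<in> M" "spow z \<in> M" "rNpow z \<in> N" "sNpow z \<in> N" "rNpow z \<in> M" "sNpow z \<in> M"
  using MM.R.fcalc_closed MM.S.fcalc_closed NN.R.fcalc_closed NN.S.fcalc_closed sub by auto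

lemma state_closed: "\<rho> \<in> M" "\<sigma> \<in> M"
  using pow_closed(1)[of 1] pow_closed(2)[of 1] by (simp_all add: pow_one)

lemma proj_closed: "r \<in> S1 \<Longrightarrow> P r \<in> M" "r \<in> S2 \<Longrightarrow> Q r \<in> M" "r \<in> S3 \<Longrightarrow> P' r \<in> M" "r \<in> S4 \<Longrightarrow> Q' r \<in> M"
  "r \<in> S3 \<Longrightarrow> P' r \<in> N" "r \<in> S4 \<Longrightarrow> Q' r \<in> N"
  using MM.R.proj_closed MM.S.proj_closed NN.R.proj_closed NN.S.proj_closed sub by auto

lemma tr_mult_state: "a \<in> N \<Longrightarrow> tr (a * \<rho>) = tr (a * \<rho>N)" "a \<in> N \<Longrightarrow> tr (a * \<sigma>) = tr (a * \<sigma>N)"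
  using cexp(2) state_closed by auto

text \<open>\<open>xv (r, s)\<close> is the component \<open>P r * \<sigma>^(1/2) * Q s\<close> of
  \<open>\<sigma>^(1/2)\<close>. \<open>yv (r, s)\<close> is the image under \<open>V\<close> of the
  corresponding component of \<open>\<sigma>N^(1/2)\<close>: its factor \<open>sqrt s\<close>
  cancels against \<open>\<sigma>N^(-1/2)\<close> next to \<open>Q' s\<close>.\<close>

abbreviation "xv \<equiv> \<lambda>(r, s). scl (of_real (sqrt s)) (P r * Q s)"
abbreviation "yv \<equiv> \<lambda>(r, s). P' r * Q' s * spow (1/2)"
abbreviation "lv \<equiv> \<lambda>(r, s). r / s :: real"
abbreviation "pv \<equiv> \<lambda>i. snd i * MM.wt i"
abbreviation "qv \<equiv> \<lambda>i. snd i * NN.wt i"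

lemma sqrt_eq_pw: "r > 0 \<Longrightarrow> of_real (sqrt r) = pw (1/2) r"
  using pw_of_real[of r "1/2"] by (simp add: powr_half_sqrt)

lemma sum_states: "(\<Sum>i\<in>S1 \<times> S2. snd i * MM.wt i) = 1" "(\<Sum>i\<in>S1 \<times> S2. fst i * MM.wt i) = 1"
proof -
  have "tr (rpow 0 * spow 1) = 1" "tr (rpow 1 * spow 0) = 1"
    using state_closed states by (simp_all add: pow_zero pow_one one_left one_right)
  then have "complex_of_real (\<Sum>i\<in>S1 \<times> S2. snd i * MM.wt i) = of_real 1"
    "complex_of_real (\<Sum>i\<in>S1 \<times> S2. fst i * MM.wt i) = of_real 1"
    unfolding MM.tr_fcalc_mult using pos by (simp_all add: mem_Times_iff)
  then show "(\<Sum>i\<in>S1 \<times> S2. snd i * MM.wt i) = 1" "(\<Sum>i\<in>S1 \<times> S2. fst i * MM.wt i) = 1"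
    by (simp_all only: of_real_eq_iff)
qed

lemma xv_orth:
  assumes "i \<in> S1 \<times> S2" "j \<in> S1 \<times> S2"
  shows "ip (xv i) (xv j) = (if i = j then of_real (pv i) else 0)"
proof -
  obtain r s r' s' where ij: "i = (r, s)" "j = (r', s')" by (cases i, cases j)
  have m: "r \<in> S1" "s \<in> S2" "r' \<in> S1" "s' \<in> S2" using assms ij by auto
  note cl = proj_closed(1,2) m closed
  have "ip (P r * Q s) (P r' * Q s') = (if r = r' \<and> s = s' then of_real (MM.wt (r, s)) else 0)"
    unfolding ip_def MM.tr_sandwich(1)[OF m(1,3,2,4), symmetric]
    using m by (simp add: star_mult MM.R.proj_star MM.S.proj_star mult.assoc)
  moreover have "complex_of_real (sqrt s) * of_real (sqrt s) = of_real s"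
    using pos(2)[OF m(2)] by (simp only: of_real_mult[symmetric] real_sqrt_mult_self abs_of_pos)
  ultimately show ?thesis
    unfolding ij by (auto simp: ip_scl_left ip_scl_right cl mult.assoc[symmetric])
qed

text \<open>This is the isometry property of \<open>V\<close>: after a cyclic shift \<sigma> stands
  beside an element of \<open>N\<close> and may be replaced by its reduction.\<close>

lemma yv_orth:
  assumes "i \<in> S3 \<times> S4" "j \<in> S3 \<times> S4"
  shows "ip (yv i) (yv j) = (if i = j then of_real (qv i) else 0)"
proof -
  obtain r s r' s' where ij: "i = (r, s)" "j = (r', s')" by (cases i, cases j)
  have m: "r \<in> S3" "s \<in> S4" "r' \<in> S3" "s' \<in> S4" using assms ij by auto
  note cl = proj_closed(3,4) m closed pow_closed(2)
  have "ip (yv i) (yv j) = tr (spow (1/2) * (Q' s * (P' r * P' r') * Q' s' * spow (1/2)))"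
    unfolding ip_def ij using m by (simp add: star_mult NN.R.proj_star NN.S.proj_star pow_star mult.assoc)
  also have "\<dots> = tr (Q' s * (P' r * P' r') * Q' s' * spow (1/2) * spow (1/2))" by (intro tr_comm cl)
  also have "\<dots> = tr (Q' s * (P' r * P' r') * Q' s' * \<sigma>)"
    by (simp add: mult.assoc pow_mult pow_one)
  also have "\<dots> = tr (Q' s * (P' r * P' r') * Q' s' * \<sigma>N)"
    by (intro tr_mult_state N.closed proj_closed m)
  also have "\<dots> = tr (Q' s * (P' r * P' r') * (Q' s' * NN.S.fcalc of_real))"
    by (simp add: mult.assoc NN.S.fcalc_id)
  also have "\<dots> = of_real s' * tr (Q' s * (P' r * P' r') * Q' s')"
    using m by (simp add: NN.S.proj_fcalc tr_scl cl mult.assoc)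
  also have "tr (Q' s * (P' r * P' r') * Q' s') = (if r = r' \<and> s = s' then of_real (NN.wt (r, s)) else 0)"
    by (rule NN.tr_sandwich(1)[OF m(1,3,2,4)])
  finally show ?thesis unfolding ij by simp
qed

text \<open>This is the compression of \<Delta> by \<open>V\<close>. The powers of \<sigma> cancel
  around the trace, which leaves \<rho> beside an element of \<open>N\<close>, where it may be
  replaced by \<open>\<rho>N\<close>.\<close>

lemma yv_compress:
  assumes "i \<in> S3 \<times> S4" "j \<in> S3 \<times> S4"
  shows "ip (yv i) (rpow (1/2) * rpow (1/2) * yv j * (spow (-1/2) * spow (-1/2)))
    = (if i = j then of_real (lv i * qv i) else 0)"
proof -
  obtain r s r' s' where ij: "i = (r, s)" "j = (r', s')" by (cases i, cases j)
  have m: "r \<in> S3" "s \<in> S4" "r' \<in> S3" "s' \<in> S4" using assms ij by auto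
  note cl = proj_closed(3,4) m closed pow_closed(1,2) state_closed
  have e: "rpow (1/2) * rpow (1/2) * yv j * (spow (-1/2) * spow (-1/2)) = \<rho> * (P' r' * Q' s') * spow (-1/2)"
    unfolding ij pow_mult by (simp add: pow_one pow_mult mult.assoc)
  have "ip (yv i) (\<rho> * (P' r' * Q' s') * spow (-1/2)) = tr (spow (1/2) * (Q' s * P' r * \<rho> * (P' r' * Q' s') * spow (-1/2)))"
    unfolding ip_def ij using m by (simp add: star_mult NN.R.proj_star NN.S.proj_star pow_star mult.assoc)
  also have "\<dots> = tr (Q' s * P' r * \<rho> * (P' r' * Q' s') * spow (-1/2) * spow (1/2))" by (intro tr_comm cl)
  also have "\<dots> = tr (Q' s * P' r * \<rho> * (P' r' * Q' s'))"
    using one_right[of "Q' s * P' r * \<rho> * (P' r' * Q' s')"] by (simp add: mult.assoc pow_mult pow_zero cl)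
  also have "\<dots> = tr (P' r' * Q' s' * (Q' s * P' r * \<rho>))" by (intro tr_comm cl)
  also have "\<dots> = tr (P' r' * (Q' s' * Q' s) * P' r * \<rho>)" by (simp add: mult.assoc)
  also have "\<dots> = tr (P' r' * (Q' s' * Q' s) * P' r * \<rho>N)"
    by (intro tr_mult_state N.closed proj_closed m)
  also have "\<dots> = tr (P' r' * (Q' s' * Q' s) * (P' r * NN.R.fcalc of_real))"
    by (simp add: mult.assoc NN.R.fcalc_id)
  also have "\<dots> = of_real r * tr (P' r' * (Q' s' * Q' s) * P' r)"
    using m by (simp add: NN.R.proj_fcalc tr_scl cl mult.assoc)
  also have "tr (P' r' * (Q' s' * Q' s) * P' r) = (if r = r' \<and> s = s' then of_real (NN.wt (r, s)) else 0)"
    by (rule NN.tr_sandwich(2)[OF m(1,3,2,4)])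
  finally show ?thesis unfolding e using ij pos(4)[OF m(2)] by auto
qed

lemma sum_xv: "sum xv (S1 \<times> S2) = spow (1/2)"
proof -
  have "sum xv (S1 \<times> S2) = rpow 0 * spow (1/2)"
    unfolding MM.fcalc_mult_expand by (intro sum.cong refl) (auto simp: sqrt_eq_pw pos)
  then show ?thesis by (simp add: pow_zero one_left pow_closed)
qed

lemma sum_yv: "sum yv (S3 \<times> S4) = spow (1/2)"
proof -
  have "sum yv (S3 \<times> S4) = rNpow 0 * sNpow 0 * spow (1/2)"
    unfolding NN.fcalc_mult_expand sum_distrib_right by (intro sum.cong refl) auto
  then show ?thesis by (simp add: pow_zero one_left pow_closed closed)
qed

sublocale core: modular_pair n M tr "rpow (1/2)" "spow (-1/2)" "S1 \<times> S2" "S3 \<times> S4" xv yv lv pv lv qv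
proof
  show "finite (S1 \<times> S2)" "finite (S3 \<times> S4)"
    using MM.R.fin MM.S.fin NN.R.fin NN.S.fin by auto
  show "sum xv (S1 \<times> S2) = sum yv (S3 \<times> S4)" unfolding sum_xv sum_yv ..
  show "sum pv (S1 \<times> S2) = 1" by (rule sum_states)
  show "rpow (1/2) * rpow (1/2) * xv i * (spow (-1/2) * spow (-1/2)) = scl (of_real (lv i)) (xv i)"
    if "i \<in> S1 \<times> S2" for i
  proof -
    obtain r s where i: "i = (r, s)" by (cases i)
    then have m: "r \<in> S1" "s \<in> S2" using that by auto
    have s: "s > 0" using pos m by auto
    have inv: "pw (-1) s = of_real (1 / s)"
      using pw_of_real[of s "-1"] s by (simp add: powr_minus_divide)
    have "rpow (1/2) * rpow (1/2) * (P r * Q s) * (spow (-1/2) * spow (-1/2)) = (rpow 1 * P r) * (Q s * spow (-1))"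
      unfolding pow_mult by (simp add: mult.assoc)
    also have "\<dots> = scl (of_real (r / s)) (P r * Q s)"
      using m pos(1)[OF m(1)] inv by (simp add: MM.R.fcalc_proj MM.S.proj_fcalc)
    finally show ?thesis unfolding i by (simp add: mult.commute)
  qed
qed (use xv_orth yv_orth yv_compress pos in \<open>auto simp: pow_star pow_closed closed proj_closed\<close>)

end

section \<open>Bounds for the rotated maps\<close>

context recovery begin

definition rel_ent_diff :: real where
  "rel_ent_diff = Re (tr (\<rho> * MM.R.fcalc (\<lambda>r. of_real (ln r)) - \<rho> * MM.S.fcalc (\<lambda>r. of_real (ln r))))
    - Re (tr (\<rho>N * NN.R.fcalc (\<lambda>r. of_real (ln r)) - \<rho>N * NN.S.fcalc (\<lambda>r. of_real (ln r))))"

text \<open>The quantity \<open>Q\<close> of the theorem, a letter that denotes projections here;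
  \<open>chi_eq\<close> identifies it with the second moment controlling the tail.\<close>

definition chi :: real where
  "chi = Re (tr (\<rho> * \<rho> * MM.S.fcalc (\<lambda>r. of_real (inverse r))))"

lemma rel_ent_diff_eq: "rel_ent_diff = core.D"
  using MM.tr_rel_ent NN.tr_rel_ent pos
  unfolding rel_ent_diff_def core.D_def by (simp add: case_prod_unfold)

lemma chi_eq: "chi = (\<Sum>i\<in>S1 \<times> S2. pv i * (lv i)\<^sup>2)"
proof -
  have "\<rho> * \<rho> * MM.S.fcalc (\<lambda>r. of_real (inverse r)) = MM.R.fcalc (\<lambda>r. of_real r * of_real r) * MM.S.fcalc (\<lambda>r. of_real (inverse r))"
    using MM.R.fcalc_mult[of of_real of_real] by (simp add: MM.R.fcalc_id)
  then have "tr (\<rho> * \<rho> * MM.S.fcalc (\<lambda>r. of_real (inverse r)))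
      = (\<Sum>i\<in>S1 \<times> S2. of_real (fst i) * of_real (fst i) * of_real (inverse (snd i)) * of_real (MM.wt i))"
    by (simp only: MM.tr_fcalc_mult)
  also have "\<dots> = of_real (\<Sum>i\<in>S1 \<times> S2. pv i * (lv i)\<^sup>2)"
    unfolding of_real_sum
    by (intro sum.cong refl) (use pos in \<open>auto simp: field_simps power2_eq_square\<close>)
  finally show ?thesis unfolding chi_def by simp
qed

abbreviation "zt \<equiv> Complex (1/2)"

definition Rt :: "real \<Rightarrow> fsmat" where
  "Rt t = spow (cnj (zt t)) * sNpow (- cnj (zt t)) * \<rho>N * sNpow (- zt t) * spow (zt t)"

lemma Rt_closed: "Rt t \<in> M"
  unfolding Rt_def using cexp(1)[OF state_closed(1)] sub by (intro closed pow_closed) auto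

text \<open>The vectors \<open>?F = \<rho>^z \<sigma>^(1/2 - z)\<close> and \<open>?G\<close> become
  \<open>X\<close> and \<open>Y\<close> on right multiplication by the unitary
  \<open>v = \<sigma>^(i t)\<close>, which preserves norms. The squared moduli of \<open>X\<close>
  and \<open>Y\<close> are \<rho> and \<open>Rt t\<close>, both of trace 1, so
  \<open>tr_square_difference\<close> applies.\<close>

theorem Rt_bound:
  assumes u: "u \<in> M" "u * star u = idm n" and \<delta>: "0 < \<delta>" "\<delta> \<le> 1"
  shows "cmod (tr ((\<rho> - Rt t) * u))
    \<le> 2 * (cosh (pi * t) / pi * (4 * sqrt \<delta> * (1 + sqrt chi) + sqrt (2 * ln (1 / \<delta>) * rel_ent_diff)))"
proof -
  define z where "z = zt t"
  have z: "cnj z = 1 - z" unfolding z_def by (simp add: complex_eq_iff)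
  define v where "v = spow (z - 1/2)"
  have v: "v \<in> M" "v * star v = idm n"
    unfolding v_def by (simp_all add: pow_closed pow_star pow_mult pow_zero z)
  define X where "X = rpow z"
  define Y where "Y = rNpow z * sNpow (- z) * spow z"
  have XY: "X \<in> M" "Y \<in> M" unfolding X_def Y_def by (intro closed pow_closed)+
  let ?F = "core.F (\<lambda>i. of_real (lv i) powr z)" and ?G = "core.G (\<lambda>i. of_real (lv i) powr z)"
  have "?F = rpow z * spow (- z + 1/2)"
    unfolding core.F_def MM.fcalc_mult_expand
    by (intro sum.cong refl)
       (use pos in \<open>auto simp: powr_eq_pw[OF divide_pos_pos] pw_divide sqrt_eq_pw pw_mult mult.assoc simp del: of_real_divide\<close>)
  then have F: "?F * v = X" unfolding v_def X_def
    using one_right[OF pow_closed(1)] by (simp add: mult.assoc pow_mult pow_zero)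
  have "?G = rNpow z * sNpow (- z) * spow (1/2)"
    unfolding core.G_def NN.fcalc_mult_expand sum_distrib_right
    by (intro sum.cong refl)
       (use pos in \<open>auto simp: powr_eq_pw[OF divide_pos_pos] pw_divide simp del: of_real_divide\<close>)
  then have G: "?G * v = Y" unfolding v_def Y_def
    by (simp add: mult.assoc pow_mult)
  have "X - Y = (?F - ?G) * v" by (simp add: left_diff_distrib F G)
  then have nXY: "nrm (X - Y) = nrm (?F - ?G)"
    using nrm_mult_unitary[OF diff_closed[OF core.F_closed core.G_closed] v] by simp
  have XX: "star X * X = \<rho>"
    unfolding X_def pow_star pow_mult z by (simp add: pow_one)
  have YY: "star Y * Y = Rt t"
  proof -
    have "star Y * Y = spow (cnj z) * sNpow (- cnj z) * (rNpow (cnj z) * rNpow z) * sNpow (- z) * spow z"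
      unfolding Y_def by (simp add: star_mult pow_star mult.assoc)
    also have "rNpow (cnj z) * rNpow z = \<rho>N" unfolding pow_mult z by (simp add: pow_one)
    finally show ?thesis unfolding Rt_def z_def .
  qed
  have "tr \<rho> = of_real 1" using states by simp
  then have nX: "nrm X = 1" using nrm_eqI[of X 1] unfolding ip_def XX by simp
  \<comment> \<open>The recovery map preserves the trace: the outer powers combine to \<sigma>,
    whose reduction cancels the powers of \<open>\<sigma>N\<close>.\<close>
  have "tr (Rt t) = 1"
  proof -
    have cN: "\<rho>N \<in> N" "\<rho>N \<in> M" using cexp(1)[OF state_closed(1)] sub by auto
    let ?a = "sNpow (- cnj z) * \<rho>N * sNpow (- z)"
    have a: "?a \<in> N" by (intro N.closed pow_closed cN)
    then have aM: "?a \<in> M" using sub by auto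
    have "tr (Rt t) = tr (spow (cnj z) * (?a * spow z))"
      unfolding Rt_def z_def by (simp add: mult.assoc)
    also have "\<dots> = tr (?a * spow z * spow (cnj z))" by (intro tr_comm closed aM pow_closed)
    also have "\<dots> = tr (?a * \<sigma>)" by (simp add: mult.assoc pow_mult z pow_one)
    also have "\<dots> = tr (?a * \<sigma>N)" using a by (rule tr_mult_state)
    also have "\<dots> = tr (sNpow (- cnj z) * (\<rho>N * (sNpow (- z) * sNpow 1)))" by (simp add: pow_one mult.assoc)
    also have "\<dots> = tr (\<rho>N * (sNpow (- z) * sNpow 1) * sNpow (- cnj z))" by (intro tr_comm closed pow_closed cN)
    also have "\<dots> = tr (\<rho>N * idm n)" by (simp add: mult.assoc pow_mult z pow_zero)
    also have "\<dots> = 1" using tr_cexp[OF state_closed(1)] states one_right[OF cN(2)] by simp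
    finally show ?thesis .
  qed
  then have nY: "nrm Y = 1" using nrm_eqI[of Y 1] unfolding ip_def YY by simp
  have "cmod (tr ((\<rho> - Rt t) * u)) \<le> 2 * nrm (?F - ?G)"
    using tr_square_difference[OF XY u nX nY] unfolding XX YY nXY .
  also have "nrm (?F - ?G) \<le> cosh (pi * t) / pi * (4 * sqrt \<delta> * (1 + sqrt chi) + sqrt (2 * ln (1 / \<delta>) * rel_ent_diff))"
    using core.nrm_power_difference[OF \<delta>, of t] unfolding z_def rel_ent_diff_eq chi_eq .
  finally show ?thesis by simp
qed

section \<open>The universal map as an average\<close>

definition beta :: "real \<Rightarrow> real" where "beta t = (pi/2) / (cosh (pi * t) + 1)"

abbreviation "idx \<equiv> (S2 \<times> S4) \<times> (S4 \<times> S2)"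

text \<open>\<open>Rt t\<close> is a combination of finitely many fixed matrices
  \<open>term_mat\<close> in which the scalars \<open>coef\<close> alone depend on \<open>t\<close>,
  so that averaging takes place in the scalars.\<close>

definition coef :: "(real \<times> real) \<times> (real \<times> real) \<Rightarrow> real \<Rightarrow> complex" where
  "coef = (\<lambda>((s, c), (c', s')) t. pw (cnj (zt t)) s * pw (- cnj (zt t)) c * pw (- zt t) c' * pw (zt t) s')"

definition term_mat :: "(real \<times> real) \<times> (real \<times> real) \<Rightarrow> fsmat" where
  "term_mat = (\<lambda>((s, c), (c', s')). Q s * Q' c * \<rho>N * Q' c' * Q s')"

lemma Rt_expand: "Rt t = (\<Sum>a\<in>idx. scl (coef a t) (term_mat a))"
proof -
  let ?z = "zt t"
  have "spow (cnj ?z) * sNpow (- cnj ?z) = (\<Sum>x\<in>S2 \<times> S4. scl (pw (cnj ?z) (fst x) * pw (- cnj ?z) (snd x)) (Q (fst x) * Q' (snd x)))"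
    unfolding MM.S.fcalc_def NN.S.fcalc_def sum_product sum.cartesian_product
    by (intro sum.cong refl) (auto simp: mult.commute)
  moreover have "sNpow (- ?z) * spow ?z = (\<Sum>x\<in>S4 \<times> S2. scl (pw (- ?z) (fst x) * pw ?z (snd x)) (Q' (fst x) * Q (snd x)))"
    unfolding MM.S.fcalc_def NN.S.fcalc_def sum_product sum.cartesian_product
    by (intro sum.cong refl) (auto simp: mult.commute)
  moreover have "Rt t = (spow (cnj ?z) * sNpow (- cnj ?z)) * (\<rho>N * (sNpow (- ?z) * spow ?z))"
    unfolding Rt_def by (simp only: mult.assoc)
  ultimately have "Rt t = (\<Sum>x\<in>S2 \<times> S4. scl (pw (cnj ?z) (fst x) * pw (- cnj ?z) (snd x)) (Q (fst x) * Q' (snd x)))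
      * (\<Sum>x\<in>S4 \<times> S2. \<rho>N * scl (pw (- ?z) (fst x) * pw ?z (snd x)) (Q' (fst x) * Q (snd x)))"
    by (simp only: sum_distrib_left)
  also have "\<dots> = (\<Sum>a\<in>idx. scl (coef a t) (term_mat a))"
    unfolding sum_product sum.cartesian_product coef_def term_mat_def
    by (intro sum.cong refl) (auto simp: mult.assoc mult.commute[of "pw _ _ * pw _ _" "pw _ _ * pw _ _"])
  finally show ?thesis .
qed

lemma term_mat_closed: "a \<in> idx \<Longrightarrow> term_mat a \<in> M"
  using cexp(1)[OF state_closed(1)] sub
  unfolding term_mat_def by (auto intro!: closed proj_closed)

text \<open>The variable \<open>t\<close> enters the exponents as an imaginary part, hence the
  modulus of \<open>coef a t\<close> is constant and a multiple of the density is a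
  majorant.\<close>

lemma coef_integrable: "integrable lborel (\<lambda>t. beta t *\<^sub>R coef a (t / 2))"
proof -
  obtain s c c' s' where a: "a = ((s, c), (c', s'))" by (metis prod.exhaust)
  define B where "B = cmod (coef a 0)"
  have B0: "B \<ge> 0" unfolding B_def by simp
  have n: "cmod (coef a t) = B" for t
    unfolding B_def coef_def a by (simp add: norm_mult pw_def)
  have "continuous_on UNIV (\<lambda>t. beta t *\<^sub>R coef a (t / 2))"
  proof -
    have "cosh (pi * t) + 1 \<noteq> 0" for t :: real using cosh_real_pos[of "pi * t"] by linarith
    then show ?thesis unfolding beta_def coef_def a pw_def split Complex_eq by (intro continuous_intros) auto
  qed
  then have meas: "(\<lambda>t. beta t *\<^sub>R coef a (t / 2)) \<in> borel_measurable lborel"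
    using borel_measurable_continuous_onI by simp
  have "integrable lborel (\<lambda>t. beta t * B)"
    using beta_density_integral(1) unfolding beta_def by (rule integrable_mult_left)
  from this meas show ?thesis
    by (rule Bochner_Integration.integrable_bound) (simp add: n abs_mult B0)
qed

definition avg :: "(real \<times> real) \<times> (real \<times> real) \<Rightarrow> complex" where
  "avg a = (LINT t|lborel. beta t *\<^sub>R coef a (t / 2))"

definition RU :: fsmat where
  "RU = (\<Sum>a\<in>idx. scl (avg a) (term_mat a))"

lemma RU_closed: "RU \<in> M"
  unfolding RU_def by (intro closed term_mat_closed)

text \<open>The link to \<open>Runiv\<close>, which is defined by entrywise integrals.\<close>

lemma ent_RU: "ent RU i j = (LINT t|lborel. beta t *\<^sub>R ent (Rt (t / 2)) i j)"
proof -
  have "(LINT t|lborel. beta t *\<^sub>R ent (Rt (t / 2)) i j)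
      = (LINT t|lborel. (\<Sum>a\<in>idx. (beta t *\<^sub>R coef a (t / 2)) * ent (term_mat a) i j))"
    unfolding Rt_expand ent_sum ent_simps by (simp add: scaleR_sum_right)
  also have "\<dots> = (\<Sum>a\<in>idx. avg a * ent (term_mat a) i j)"
    unfolding avg_def by (subst Bochner_Integration.integral_sum)
       (auto intro!: integrable_mult_left coef_integrable simp: integral_mult_left_zero simp del: mult_scaleR_left)
  finally show ?thesis unfolding RU_def ent_sum ent_simps by simp
qed

lemma tr_RU:
  assumes u: "u \<in> M"
  shows "integrable lborel (\<lambda>t. beta t *\<^sub>R tr ((\<rho> - Rt (t / 2)) * u))"
    and "tr ((\<rho> - RU) * u) = (LINT t|lborel. beta t *\<^sub>R tr ((\<rho> - Rt (t / 2)) * u))"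
proof -
  have e: "beta t *\<^sub>R tr ((\<rho> - Rt (t / 2)) * u)
      = beta t *\<^sub>R tr (\<rho> * u) - (\<Sum>a\<in>idx. (beta t *\<^sub>R coef a (t / 2)) * tr (term_mat a * u))" for t
  proof -
    have "tr (Rt (t / 2) * u) = (\<Sum>a\<in>idx. coef a (t / 2) * tr (term_mat a * u))"
      unfolding Rt_expand sum_distrib_right
      by (subst tr_sum) (use u term_mat_closed in \<open>auto simp: tr_scl closed intro!: closed\<close>)
    moreover have "tr ((\<rho> - Rt (t / 2)) * u) = tr (\<rho> * u) - tr (Rt (t / 2) * u)"
      using u Rt_closed state_closed by (simp add: left_diff_distrib tr_diff closed)
    ultimately show ?thesis by (simp add: scaleR_diff_right scaleR_sum_right)
  qed
  have b: "integrable lborel (\<lambda>t. beta t *\<^sub>R tr (\<rho> * u))"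
    using beta_density_integral(1) unfolding beta_def by (rule integrable_scaleR_left)
  have i: "integrable lborel (\<lambda>t. (beta t *\<^sub>R coef a (t / 2)) * tr (term_mat a * u))" for a
    by (intro integrable_mult_left coef_integrable)
  show "integrable lborel (\<lambda>t. beta t *\<^sub>R tr ((\<rho> - Rt (t / 2)) * u))"
    unfolding e by (intro Bochner_Integration.integrable_diff Bochner_Integration.integrable_sum b i)
  have "(LINT t|lborel. beta t *\<^sub>R tr ((\<rho> - Rt (t / 2)) * u))
      = (LINT t|lborel. beta t *\<^sub>R tr (\<rho> * u)) - (\<Sum>a\<in>idx. (LINT t|lborel. (beta t *\<^sub>R coef a (t / 2)) * tr (term_mat a * u)))"
    unfolding e by (subst Bochner_Integration.integral_diff, intro b, intro Bochner_Integration.integrable_sum i,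
        subst Bochner_Integration.integral_sum, intro i, rule refl)
  also have "(LINT t|lborel. beta t *\<^sub>R tr (\<rho> * u)) = tr (\<rho> * u)"
    using beta_density_integral unfolding beta_def by simp
  also have "(\<Sum>a\<in>idx. (LINT t|lborel. (beta t *\<^sub>R coef a (t / 2)) * tr (term_mat a * u))) = tr (RU * u)"
    unfolding RU_def avg_def sum_distrib_right integral_mult_left_zero
    by (subst tr_sum) (use u term_mat_closed in \<open>auto simp: tr_scl closed intro!: closed\<close>)
  finally show "tr ((\<rho> - RU) * u) = (LINT t|lborel. beta t *\<^sub>R tr ((\<rho> - Rt (t / 2)) * u))"
    using u RU_closed state_closed by (simp add: left_diff_distrib tr_diff closed)
qed

text \<open>One unitary \<open>u\<close> serves all \<open>t\<close>, so scalars are averaged and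
  the trace norm enters only afterwards. The weight \<open>beta t * cosh (pi * (t / 2))\<close> has
  integral \<open>pi / 2\<close>, which cancels the \<open>2 / pi\<close> of
  \<open>Rt_bound\<close>.\<close>

theorem RU_bound:
  assumes u: "u \<in> M" "u * star u = idm n" and \<delta>: "0 < \<delta>" "\<delta> \<le> 1"
  shows "cmod (tr ((\<rho> - RU) * u)) \<le> 4 * sqrt \<delta> * (1 + sqrt chi) + sqrt (2 * ln (1 / \<delta>) * rel_ent_diff)"
proof -
  define B where "B = 4 * sqrt \<delta> * (1 + sqrt chi) + sqrt (2 * ln (1 / \<delta>) * rel_ent_diff)"
  have pos: "beta t \<ge> 0" for t
    unfolding beta_def using cosh_real_pos[of "pi * t"] by simp
  note bi = beta_density_cosh_integral[folded beta_def]
  have "cmod (tr ((\<rho> - RU) * u)) \<le> (LINT t|lborel. (beta t * cosh (pi * (t / 2))) * (2 * B / pi))"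
    unfolding tr_RU(2)[OF u(1)]
  proof (rule order_trans[OF integral_norm_bound integral_mono])
    show "integrable lborel (\<lambda>t. (beta t * cosh (pi * (t / 2))) * (2 * B / pi))"
      using bi(1) by (rule integrable_mult_left)
    fix t :: real
    have "norm (beta t *\<^sub>R tr ((\<rho> - Rt (t / 2)) * u)) = beta t * cmod (tr ((\<rho> - Rt (t / 2)) * u))"
      using pos by simp
    also have "\<dots> \<le> beta t * (2 * (cosh (pi * (t / 2)) / pi * B))"
      unfolding B_def by (intro mult_left_mono Rt_bound u \<delta> pos)
    finally show "norm (beta t *\<^sub>R tr ((\<rho> - Rt (t / 2)) * u)) \<le> (beta t * cosh (pi * (t / 2))) * (2 * B / pi)"
      by (simp add: mult_ac)
  qed (rule integrable_norm[OF tr_RU(1)[OF u(1)]])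
  also have "\<dots> = B"
    unfolding integral_mult_left_zero bi(2) by simp
  finally show ?thesis unfolding B_def .
qed

end

section \<open>Transfer to matrices\<close>

definition qf :: "nat \<Rightarrow> fsmat \<Rightarrow> (nat \<Rightarrow> complex) \<Rightarrow> complex" where
  "qf n a f = (\<Sum>i<n. cnj (f i) * (\<Sum>j<n. ent a i j * f j))"

lemma scalar_prod_eq_qf:
  assumes "A \<in> carrier_mat n n" "v \<in> carrier_vec n"
  shows "scalar_prod (conjugate v) (A *\<^sub>v v) = qf n (emb n A) (\<lambda>i. v $ i)"
  using assms unfolding qf_def scalar_prod_def mult_mat_vec_def
  by (auto simp: lessThan_atLeast0 ent_emb intro!: sum.cong)

lemma qf_column:
  assumes "bounded_by n x"
  shows "qf n a (\<lambda>i. ent x i k) = ent (star x * (a * x)) k k"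
  unfolding ent_times_left[OF bounded_star[OF assms]] ent_times_right[OF assms] qf_def by (simp add: ent_simps)

lemma qf_square:
  assumes "bounded_by n b"
  shows "qf n (star b * b) f = of_real (\<Sum>k<n. (cmod (\<Sum>j<n. ent b k j * f j))\<^sup>2)"
proof -
  have "qf n (star b * b) f = (\<Sum>i<n. \<Sum>k<n. \<Sum>j<n. cnj (f i) * (cnj (ent b k i) * ent b k j * f j))"
    unfolding qf_def ent_times_right[OF assms] ent_simps sum_distrib_left sum_distrib_right
    by (intro sum.cong refl sum.swap)
  also have "\<dots> = (\<Sum>k<n. \<Sum>i<n. \<Sum>j<n. cnj (f i) * (cnj (ent b k i) * ent b k j * f j))"
    by (rule sum.swap)
  also have "\<dots> = (\<Sum>k<n. cnj (\<Sum>i<n. ent b k i * f i) * (\<Sum>j<n. ent b k j * f j))"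
    unfolding cnj_sum sum_product by (intro sum.cong refl) (simp add: mult_ac)
  also have "\<dots> = of_real (\<Sum>k<n. (cmod (\<Sum>j<n. ent b k j * f j))\<^sup>2)"
    unfolding of_real_sum complex_norm_square by (intro sum.cong refl) (simp add: mult.commute)
  finally show ?thesis .
qed

lemma psd_imp_star: "psd n A \<Longrightarrow> A \<in> carrier_mat n n \<and> star (emb n A) = emb n A"
  unfolding psd_def by (metis emb_adj)

text \<open>A nonzero column of the spectral projection is an eigenvector for \<open>r\<close>,
  where the quadratic form is \<open>r\<close> times a squared length.\<close>

lemma psd_imp_spectrum_nonneg:
  assumes A: "psd n A" and R: "spectral_resolution n M (emb n A) S P" and r: "r \<in> S"
  shows "r \<ge> 0"
proof -
  interpret spectral_resolution n M "emb n A" S P by (rule R)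
  have Ac: "A \<in> carrier_mat n n" using A unfolding psd_def by simp
  have b: "bounded_by n (P r)" using proj_closed[OF r] bounded by simp
  have "\<exists>i k. ent (P r) i k \<noteq> 0"
  proof (rule ccontr)
    assume "\<not> ?thesis"
    then have "P r = 0" by (intro fsmat_eqI) (simp add: ent_simps)
    then show False using proj_nonzero[OF r] by simp
  qed
  then obtain i k where ik: "ent (P r) i k \<noteq> 0" by blast
  then have i: "i < n" using b unfolding bounded_by_def by (meson not_le)
  define v where "v = Matrix.vec n (\<lambda>i. ent (P r) i k)"
  have v: "v \<in> carrier_vec n" unfolding v_def by simp
  have e: "qf n a (\<lambda>i. v $ i) = qf n a (\<lambda>i. ent (P r) i k)" for a
    unfolding qf_def v_def by (intro sum.cong refl arg_cong2[of _ _ _ _ "(*)"]) auto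
  have "emb n A * P r = scl (of_real r) (P r)"
    using fcalc_proj[OF r, of of_real] by (simp add: fcalc_id)
  then have "qf n (emb n A) (\<lambda>i. v $ i) = of_real r * ent (star (P r) * P r) k k"
    unfolding e qf_column[OF b] by (simp add: ent_simps)
  also have "ent (star (P r) * P r) k k = of_real (\<Sum>i<n. (cmod (ent (P r) i k))\<^sup>2)"
    unfolding ent_times_right[OF b] of_real_sum complex_norm_square
    by (intro sum.cong refl) (simp add: ent_simps mult.commute)
  finally have q: "qf n (emb n A) (\<lambda>i. v $ i) = of_real (r * (\<Sum>i<n. (cmod (ent (P r) i k))\<^sup>2))" by simp
  have "(\<Sum>i<n. (cmod (ent (P r) i k))\<^sup>2) > 0"
    using i ik by (intro sum_pos2[of _ i]) auto
  moreover have "r * (\<Sum>i<n. (cmod (ent (P r) i k))\<^sup>2) \<ge> 0"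
    using A v q unfolding psd_def scalar_prod_eq_qf[OF Ac v, symmetric] by (metis Re_complex_of_real)
  ultimately show ?thesis by (simp add: zero_le_mult_iff)
qed

lemma (in spectral_resolution) fcalc_sqrt_square:
  assumes "\<And>r. r \<in> S \<Longrightarrow> r \<ge> 0"
  shows "fcalc (\<lambda>r. of_real (sqrt r)) * fcalc (\<lambda>r. of_real (sqrt r)) = a"
proof -
  have "fcalc (\<lambda>r. of_real (sqrt r) * of_real (sqrt r)) = fcalc of_real"
    by (rule fcalc_cong) (use assms in \<open>simp add: of_real_mult[symmetric] del: of_real_mult\<close>)
  then show ?thesis unfolding fcalc_mult fcalc_id .
qed

text \<open>The square root \<open>b\<close> gives \<open>A = star b * b\<close>, whose quadratic
  form is a sum of squares.\<close>

lemma spectrum_nonneg_imp_psd: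
  assumes Ac: "A \<in> carrier_mat n n" and R: "spectral_resolution n M (emb n A) S P"
    and S: "\<And>r. r \<in> S \<Longrightarrow> r \<ge> 0"
  shows "psd n A"
proof -
  interpret spectral_resolution n M "emb n A" S P by (rule R)
  define b where "b = fcalc (\<lambda>r. of_real (sqrt r))"
  have sb: "star b = b" unfolding b_def star_fcalc by simp
  have bb: "star b * b = emb n A" unfolding sb unfolding b_def by (rule fcalc_sqrt_square[OF S])
  have "star (emb n A) = emb n A" unfolding bb[symmetric] by (simp add: star_mult)
  then have "adj A = A" using Ac by (metis adj_carrier emb_adj emb_eq_iff)
  moreover have "bounded_by n b" unfolding b_def using fcalc_closed bounded by simp
  from qf_square[OF this] have "Im (qf n (emb n A) f) = 0 \<and> Re (qf n (emb n A) f) \<ge> 0" for f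
    unfolding bb by (simp add: sum_nonneg)
  ultimately show ?thesis unfolding psd_def using Ac scalar_prod_eq_qf[OF Ac] by auto
qed

lemma invertible_imp_spectrum_nonzero:
  assumes Ac: "A \<in> carrier_mat n n" and inv: "invertible_mat A"
    and R: "spectral_resolution n M (emb n A) S P"
  shows "0 \<notin> S"
proof
  assume 0: "0 \<in> S"
  interpret spectral_resolution n M "emb n A" S P by (rule R)
  obtain B where B: "inverts_mat A B" "inverts_mat B A" using inv unfolding invertible_mat_def by auto
  have eqs: "A * B = 1\<^sub>m (dim_row A)" "B * A = 1\<^sub>m (dim_row B)" using B unfolding inverts_mat_def by auto
  have "dim_col B = n" using arg_cong[OF eqs(1), of dim_col] Ac by simp
  moreover have "dim_row B = n" using arg_cong[OF eqs(2), of dim_col] Ac by simp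
  ultimately have Bc: "B \<in> carrier_mat n n" by auto
  have "emb n B * emb n A = idm n"
    using eqs(2) Bc unfolding idm_def by (simp add: emb_mult[OF Bc Ac, symmetric])
  moreover have "emb n A * P 0 = 0"
    using fcalc_proj[OF 0, of of_real] by (simp add: fcalc_id)
  ultimately have "idm n * P 0 = 0" by (metis mult.assoc mult_zero_right)
  then show False using one_left[OF proj_closed[OF 0]] proj_nonzero[OF 0] by simp
qed

text \<open>For a spectral projection \<open>P' r\<close> of the reduction,
  \<open>r * tr (P' r) = tr (P' r * x)\<close> is the squared norm of \<open>b * P' r\<close>, with
  \<open>b\<close> the square root of \<open>x\<close>. If 0 is not in the spectrum of
  \<open>x\<close>, then \<open>b\<close> is invertible and this norm is positive: reductions of
  faithful states are faithful.\<close>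

lemma (in traced_pair) cexp_spectrum:
  assumes R: "spectral_resolution n M x S P" and S: "\<And>r. r \<in> S \<Longrightarrow> r \<ge> 0"
    and R': "spectral_resolution n N (cexp x) S' P'" and r: "r \<in> S'"
  shows "r \<ge> 0" and "0 \<notin> S \<Longrightarrow> r > 0"
proof -
  interpret R: spectral_resolution n M x S P by (rule R)
  interpret R': spectral_resolution n N "cexp x" S' P' by (rule R')
  define b where "b = R.fcalc (\<lambda>r. of_real (sqrt r))"
  have b: "b \<in> M" "star b = b" "b * b = x"
    unfolding b_def R.star_fcalc using R.fcalc_closed R.fcalc_sqrt_square[OF S] by simp_all
  have xM: "x \<in> M" using R.fcalc_closed[of of_real] by (simp add: R.fcalc_id)
  have PN: "P' r \<in> N" by (rule R'.proj_closed[OF r])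
  then have PM: "P' r \<in> M" using sub by auto
  have PP: "star (P' r) = P' r" "P' r * P' r = P' r"
    using R'.proj_star[OF r] R'.proj_mult[OF r r] by simp_all
  have "of_real r * tr (P' r) = tr (P' r * cexp x)"
    using R'.proj_fcalc[OF r, of of_real] by (simp add: R'.fcalc_id tr_scl[OF PM])
  also have "\<dots> = tr (P' r * x)" using cexp(2)[OF xM PN] .
  also have "\<dots> = tr ((P' r * P' r) * (b * b))" unfolding PP b(3) ..
  also have "\<dots> = tr (P' r * (P' r * (b * b)))" by (simp only: mult.assoc)
  also have "\<dots> = tr (P' r * (b * b) * P' r)" using PM b by (intro tr_comm closed)
  also have "\<dots> = ip (b * P' r) (b * P' r)" unfolding ip_def by (simp only: star_mult PP b(2) mult.assoc)
  also have "\<dots> = of_real ((nrm (b * P' r))\<^sup>2)" by (intro ip_self closed b PM)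
  finally have 1: "of_real r * tr (P' r) = of_real ((nrm (b * P' r))\<^sup>2)" .
  have "tr (P' r) = ip (P' r) (P' r)" unfolding ip_def PP ..
  also have "\<dots> = of_real ((nrm (P' r))\<^sup>2)" by (rule ip_self[OF PM])
  finally have "complex_of_real (r * (nrm (P' r))\<^sup>2) = of_real ((nrm (b * P' r))\<^sup>2)" using 1 by simp
  then have 2: "r * (nrm (P' r))\<^sup>2 = (nrm (b * P' r))\<^sup>2" by (simp only: of_real_eq_iff)
  have 3: "(nrm (P' r))\<^sup>2 > 0" using nrm_pos[OF PM R'.proj_nonzero[OF r]] by simp
  show "r \<ge> 0" using 2 3 by (metis zero_le_mult_iff zero_le_power2 not_le)
  show "r > 0" if 0: "0 \<notin> S"
  proof -
    have Sp: "s > 0" if "s \<in> S" for s using S[OF that] 0 that by (cases "s = 0") auto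
    have "R.fcalc (\<lambda>r. of_real (1 / sqrt r)) * b = R.fcalc (\<lambda>_. 1)"
      unfolding b_def R.fcalc_mult by (rule R.fcalc_cong) (use Sp in force)
    then have "R.fcalc (\<lambda>r. of_real (1 / sqrt r)) * (b * P' r) = P' r"
      using one_left[OF PM] by (simp add: mult.assoc[symmetric] R.fcalc_one)
    then have "b * P' r \<noteq> 0" using R'.proj_nonzero[OF r] by auto
    then have "(nrm (b * P' r))\<^sup>2 > 0" using nrm_pos[of "b * P' r"] b PM closed by simp
    then show ?thesis using 2 3 by (metis zero_less_mult_pos2)
  qed
qed

section \<open>Transport of trace, trace norm and conditional expectation\<close>

lemma faithful_trace_imp_traced:
  assumes M: "star_subalg n M" and T: "faithful_trace n M \<tau>"
  shows "traced n (emb n ` M) (\<lambda>x. \<tau> (unemb n x))"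
proof -
  interpret star_algebra n "emb n ` M" by (rule star_subalg_imp_star_algebra[OF M])
  have c: "A \<in> carrier_mat n n" if "A \<in> M" for A using M that unfolding star_subalg_def by auto
  have cl: "A + B \<in> M" "A * B \<in> M" "k \<cdot>\<^sub>m A \<in> M" "adj A \<in> M" if "A \<in> M" "B \<in> M" for A B k
    using M that unfolding star_subalg_def by auto
  have u: "unemb n (emb n A) = A" if "A \<in> M" for A using c[OF that] by (rule unemb_emb)
  show ?thesis
  proof
    fix x assume "x \<in> emb n ` M"
    then obtain A where A: "A \<in> M" "x = emb n A" by auto
    have s: "unemb n (star x * x) = adj A * A"
      using A cl[OF A(1) A(1)] c[OF A(1)] u[of "adj A * A"] by (simp add: emb_mult emb_adj)
        (metis (no_types) A(1) cl(2) cl(4) adj_carrier emb_adj emb_mult u)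
    show "Im (\<tau> (unemb n (star x * x))) = 0" "Re (\<tau> (unemb n (star x * x))) \<ge> 0"
      using T A unfolding s faithful_trace_def by auto
    show "Re (\<tau> (unemb n (star x * x))) > 0" if "x \<noteq> 0"
      using T A that unfolding s faithful_trace_def by (auto simp: emb_zero)
    show "\<tau> (unemb n (scl k x)) = k * \<tau> (unemb n x)" for k
      using T A cl[OF A(1) A(1)] u emb_smult[OF c[OF A(1)]] unfolding faithful_trace_def by metis
    fix y assume "y \<in> emb n ` M"
    then obtain B where B: "B \<in> M" "y = emb n B" by auto
    show "\<tau> (unemb n (x + y)) = \<tau> (unemb n x) + \<tau> (unemb n y)"
      using T A B cl[OF A(1) B(1)] u emb_add[OF c[OF A(1)] c[OF B(1)]] unfolding faithful_trace_def by metis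
    show "\<tau> (unemb n (x * y)) = \<tau> (unemb n (y * x))"
      using T A B cl(2) u emb_mult[OF c[OF A(1)] c[OF B(1)]] emb_mult[OF c[OF B(1)] c[OF A(1)]]
      unfolding faithful_trace_def by metis
  qed
qed

text \<open>\<open>u\<close> is the sign of \<open>X\<close>, so that \<open>X u\<close> is the
  absolute value, and \<open>w\<close> is the square root of the latter, which certifies a
  nonnegative norm. The trace norm becomes a pairing with a unitary of the algebra, as
  \<open>Rt_bound\<close> requires.\<close>

lemma norm1_eq_tr:
  assumes M: "star_algebra n M" and X: "X \<in> carrier_mat n n" "emb n X \<in> M" "star (emb n X) = emb n X"
  obtains u w where "u \<in> M" "u * star u = idm n" "norm1 n \<tau> X = Re (\<tau> (unemb n (emb n X * u)))"
    and "w \<in> M" "emb n X * u = star w * w"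
proof -
  interpret star_algebra n M by (rule M)
  \<comment> \<open>The sign of 0 is set to 1 to keep \<open>u\<close> unitary when \<open>X\<close>
    is singular.\<close>
  let ?s = "\<lambda>r::real. if r \<ge> 0 then 1 else - 1 :: complex"
  obtain U and d :: "nat \<Rightarrow> real" where U: "unitary n U" and d: "emb n X = ucalc n U (\<lambda>i. of_real (d i))"
    using hermitian_diagonalization[OF bounded_emb X(3)] unfolding ucalc_def by blast
  obtain S P where SP: "spectral_resolution n M (emb n X) S P"
    "\<And>f. emb n (hfun n f X) = spectral_resolution.fcalc S P f"
    using exists_spectral_resolution[OF X] by metis
  define u where "u = ucalc n U (\<lambda>i. ?s (d i))"
  have "u = spectral_resolution.fcalc S P ?s"
    unfolding u_def SP(2)[symmetric] hfun_eq_ucalc(2)[OF X(1) U d] ..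
  then have uM: "u \<in> M" using spectral_resolution.fcalc_closed[OF SP(1)] by simp
  define w where "w = ucalc n U (\<lambda>i. of_real (sqrt \<bar>d i\<bar>))"
  have "w = spectral_resolution.fcalc S P (\<lambda>r. of_real (sqrt \<bar>r\<bar>))"
    unfolding w_def SP(2)[symmetric] hfun_eq_ucalc(2)[OF X(1) U d] ..
  then have wM: "w \<in> M" using spectral_resolution.fcalc_closed[OF SP(1)] by simp
  have "u * star u = ucalc n U (\<lambda>i. 1)"
    unfolding u_def star_ucalc ucalc_mult[OF U] by (rule ucalc_cong) simp
  then have uu: "u * star u = idm n" using ucalc_one[OF U] by simp
  have XX: "emb n (adj X * X) = ucalc n U (\<lambda>i. of_real ((d i)\<^sup>2))"
    unfolding emb_mult[OF adj_carrier[OF X(1)] X(1)] emb_adj[OF X(1)] X(3) unfolding d ucalc_mult[OF U]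
    by (simp add: power2_eq_square)
  have c: "adj X * X \<in> carrier_mat n n" using X(1) adj_carrier by (intro mult_carrier_mat) auto
  note h = hfun_eq_ucalc[OF c U XX, of "\<lambda>s. complex_of_real (sqrt s)", folded mabs_def]
  have "emb n (mabs n X) = emb n X * u"
    unfolding h(2) unfolding d u_def ucalc_mult[OF U] by (rule ucalc_cong) auto
  then have "unemb n (emb n X * u) = mabs n X" using unemb_emb[OF h(1)] by simp
  then have "norm1 n \<tau> X = Re (\<tau> (unemb n (emb n X * u)))" unfolding norm1_def by simp
  moreover have "emb n X * u = star w * w"
    unfolding w_def star_ucalc ucalc_mult[OF U] unfolding d u_def ucalc_mult[OF U]
    by (rule ucalc_cong) (auto simp: of_real_mult[symmetric] simp del: of_real_mult)
  ultimately show thesis using uM uu wM by (intro that)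
qed

text \<open>\<open>THE\<close> calls for existence and uniqueness. Every competitor
  \<open>E'\<close> satisfies
  \<open>\<tau> (a * E' x) = \<tau> (E' (a * x)) = \<tau> (a * x)\<close> for \<open>a\<close> in
  \<open>N\<close>, the identity that determines \<open>cexp\<close>.\<close>

lemma cond_exp_eq_cexp:
  assumes M: "star_subalg n M" and N: "star_subalg n N" and NM: "N \<subseteq> M" and T: "faithful_trace n M \<tau>"
    and X: "X \<in> M"
  shows "cond_exp n M N \<tau> X = unemb n (traced_pair.cexp (emb n ` N) (\<lambda>x. \<tau> (unemb n x)) (emb n X))"
proof -
  let ?tr = "\<lambda>x. \<tau> (unemb n x)"
  interpret M: traced n "emb n ` M" ?tr by (rule faithful_trace_imp_traced[OF M T])
  interpret N: star_algebra n "emb n ` N" by (rule star_subalg_imp_star_algebra[OF N])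
  interpret traced_pair n "emb n ` M" "emb n ` N" ?tr by unfold_locales (use NM in auto)
  have c: "A \<in> carrier_mat n n" if "A \<in> M" for A using M that unfolding star_subalg_def by auto
  have cN: "A \<in> carrier_mat n n" if "A \<in> N" for A using c NM that by auto
  have cl: "A + B \<in> M" "A * B \<in> M" "k \<cdot>\<^sub>m A \<in> M" "adj A \<in> M" if "A \<in> M" "B \<in> M" for A B k
    using M that unfolding star_subalg_def by auto
  have u: "unemb n (emb n A) = A" if "A \<in> M" for A using c[OF that] by (rule unemb_emb)
  define E where "E = (\<lambda>X. if X \<in> M then unemb n (cexp (emb n X)) else 0\<^sub>m n n)"
  have embE: "emb n (E A) = cexp (emb n A)" "E A \<in> N" if "A \<in> M" for A
  proof -
    have m: "cexp (emb n A) \<in> emb n ` N" using cexp(1) that by auto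
    then obtain B where B: "B \<in> N" "cexp (emb n A) = emb n B" by auto
    then show "emb n (E A) = cexp (emb n A)" "E A \<in> N"
      using that cN[OF B(1)] by (simp_all add: E_def unemb_emb)
  qed
  have "cond_exp n M N \<tau> = E"
    unfolding cond_exp_def
  proof (rule the_equality, goal_cases)
    case 1
    show ?case
  proof (intro conjI ballI allI impI)
    fix x assume x: "x \<in> M"
    show "E x \<in> N" by (rule embE(2)[OF x])
    have cx: "x \<in> carrier_mat n n" "E x \<in> carrier_mat n n" using c[OF x] cN[OF embE(2)[OF x]] by auto
    show "E (k \<cdot>\<^sub>m x) = k \<cdot>\<^sub>m E x" for k
    proof -
      have kx: "k \<cdot>\<^sub>m x \<in> M" using cl x by auto
      have "emb n (E (k \<cdot>\<^sub>m x)) = emb n (k \<cdot>\<^sub>m E x)"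
        using cexp_scl[of "emb n x" k] x by (simp add: embE(1)[OF kx] embE(1)[OF x] emb_smult cx)
      then show ?thesis using cN[OF embE(2)[OF kx]] cx by (simp add: emb_eq_iff)
    qed
    show "\<tau> (E x) = \<tau> x"
      using tr_cexp[of "emb n x"] x u[OF x] unemb_emb[OF cx(2)] unfolding embE(1)[OF x, symmetric] by simp
    \<comment> \<open>Positivity is checked on spectra: \<open>psd\<close> is translated to a
      nonnegative spectrum and back, with \<open>cexp_spectrum\<close> in between.\<close>
    show "psd n (E x)" if p: "psd n x"
    proof -
      have sx: "star (emb n x) = emb n x" using psd_imp_star[OF p] by simp
      obtain S P where SP: "spectral_resolution n (emb n ` M) (emb n x) S P"
        using M.exists_spectral_resolution[OF cx(1) imageI[OF x] sx] by metis
      have sE: "star (emb n (E x)) = emb n (E x)"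
        unfolding embE(1)[OF x] using cexp_star[of "emb n x"] x sx by simp
      obtain S' P' where SP': "spectral_resolution n (emb n ` N) (emb n (E x)) S' P'"
        using N.exists_spectral_resolution[OF cx(2) imageI[OF embE(2)[OF x]] sE] by metis
      show ?thesis
        using spectrum_nonneg_imp_psd[OF cx(2) SP'] cexp_spectrum(1)[OF SP _ SP'[unfolded embE(1)[OF x]]]
          psd_imp_spectrum_nonneg[OF p SP] by blast
    qed
    show "E (x + y) = E x + E y" if y: "y \<in> M" for y
    proof -
      have xy: "x + y \<in> M" using cl x y by auto
      have cy: "y \<in> carrier_mat n n" "E y \<in> carrier_mat n n" using c[OF y] cN[OF embE(2)[OF y]] by auto
      have "emb n (E (x + y)) = emb n (E x + E y)"
        using cexp_add[of "emb n x" "emb n y"] x y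
        by (simp add: embE(1)[OF xy] embE(1)[OF x] embE(1)[OF y] emb_add cx cy)
      then show ?thesis using cN[OF embE(2)[OF xy]] cx cy by (simp add: emb_eq_iff)
    qed
    show "E (a * x * b) = a * E x * b" if ab: "a \<in> N" "b \<in> N" for a b
    proof -
      have abM: "a \<in> M" "b \<in> M" using ab NM by auto
      have ax: "a * x \<in> M" using cl abM x by auto
      have axb: "a * x * b \<in> M" using cl(2)[OF ax abM(2)] .
      have cab: "a \<in> carrier_mat n n" "b \<in> carrier_mat n n" using c abM by auto
      have "emb n (E (a * x * b)) = emb n (a * E x * b)"
        using cexp_bimodule[of "emb n x" "emb n a" "emb n b"] x ab
        by (simp add: embE(1)[OF axb] embE(1)[OF x] emb_mult[OF mult_carrier_mat[OF cab(1) cx(1)] cab(2)] emb_mult[OF cab(1) cx(1)]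
            emb_mult[OF mult_carrier_mat[OF cab(1) cx(2)] cab(2)] emb_mult[OF cab(1) cx(2)])
      then show ?thesis
        using cN[OF embE(2)[OF axb]] mult_carrier_mat[OF mult_carrier_mat[OF cab(1) cx(2)] cab(2)] by (simp add: emb_eq_iff)
    qed
  next
    fix x assume x: "x \<in> N"
    then show "E x = x" using cexp_N[of "emb n x"] NM unemb_emb[OF cN[OF x]] by (auto simp: E_def)
  next
    fix x assume "x \<notin> M"
    then show "E x = 0\<^sub>m n n" by (simp add: E_def)
  qed
  next
    case (2 E')
    note E' = this
    show "E' = E"
  proof
    fix x show "E' x = E x"
    proof (cases "x \<in> M")
      case x: True
      have Ex: "E' x \<in> N" using E' x by blast
      have one: "1\<^sub>m n \<in> N" using N unfolding star_subalg_def by auto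
      have "cexp (emb n x) = emb n (E' x)"
      proof (rule cexp_unique)
        fix y assume "y \<in> emb n ` N"
        then obtain a where a: "a \<in> N" "y = emb n a" by auto
        have aM: "a \<in> M" "E' x \<in> M" using a Ex NM by auto
        \<comment> \<open>The two-sided module law with right factor 1 gives the one-sided
          law.\<close>
        have "E' (a * x * 1\<^sub>m n) = a * E' x * 1\<^sub>m n" using E' x a one by blast
        moreover have "a * x * 1\<^sub>m n = a * x" "a * E' x * 1\<^sub>m n = a * E' x"
          using c[OF cl(2)[OF aM(1) x]] c[OF cl(2)[OF aM]] by auto
        ultimately have e: "E' (a * x) = a * E' x" by simp
        have "\<tau> (E' (a * x)) = \<tau> (a * x)" using E' cl(2)[OF aM(1) x] by blast
        then have "\<tau> (a * E' x) = \<tau> (a * x)" unfolding e .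
        then show "\<tau> (unemb n (y * emb n (E' x))) = \<tau> (unemb n (y * emb n x))"
          unfolding a(2) emb_mult[OF c[OF aM(1)] c[OF aM(2)], symmetric] emb_mult[OF c[OF aM(1)] c[OF x], symmetric]
          by (simp add: u cl aM x)
      qed (use x Ex in auto)
      then show ?thesis using unemb_emb[OF cN[OF Ex]] x by (simp add: E_def)
    next
      case False
      then have "E' x = 0\<^sub>m n n" using E' by blast
      then show ?thesis using False by (simp add: E_def)
    qed
  qed
  qed
  then show ?thesis using X by (simp add: E_def)
qed

section \<open>Assembling the bounds\<close>

context recovery begin

lemma star_rhoN: "star \<rho>N = \<rho>N"
  using pow_star(3)[of 1] by (simp add: pow_one)

lemma star_Rt: "star (Rt t) = Rt t"
  unfolding Rt_def by (simp add: star_mult pow_star star_rhoN mult.assoc)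

text \<open>\<open>norm1_eq_tr\<close> applies to self-adjoint differences; for the average this
  property passes through the entrywise integral.\<close>

lemma star_RU: "star RU = RU"
proof (rule fsmat_eqI)
  fix i j
  have "ent (star RU) i j = (LINT t|lborel. cnj (beta t *\<^sub>R ent (Rt (t / 2)) j i))"
    unfolding star.rep_eq ent_RU by (rule Bochner_Integration.integral_cnj[symmetric])
  also have "\<dots> = (LINT t|lborel. beta t *\<^sub>R ent (star (Rt (t / 2))) i j)"
    unfolding star.rep_eq by simp
  also have "\<dots> = ent RU i j" unfolding star_Rt ent_RU ..
  finally show "ent (star RU) i j = ent RU i j" .
qed

lemma chi_nonneg: "chi \<ge> 0" and rel_ent_diff_nonneg: "rel_ent_diff \<ge> 0"
proof -
  have "pv i * (lv i)\<^sup>2 \<ge> 0" if "i \<in> S1 \<times> S2" for i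
    using that less_imp_le[OF pos(2), of "snd i"] MM.wt_nonneg[of i] by (simp add: mem_Times_iff)
  then show "chi \<ge> 0" unfolding chi_eq by (rule sum_nonneg)
  show "rel_ent_diff \<ge> 0" unfolding rel_ent_diff_eq by (rule core.D_nonneg)
qed

text \<open>A bound on the pairing for every \<open>\<delta>\<close> is the input of
  \<open>powr_le_of_log_bound\<close>. The factor \<open>pi / (2 * cosh (pi * t))\<close> inverts
  the one in \<open>Rt_bound\<close>; \<open>RU_bound\<close> has none.\<close>

lemma entropy_bounds:
  fixes \<epsilon> x t :: real
  defines "K \<equiv> 1 / (4 * sqrt chi + 4 + 1 / sqrt (\<epsilon> * exp 1))" and "p \<equiv> 1 / (1/2 - \<epsilon>)"
  assumes e: "0 < \<epsilon>" "\<epsilon> < 1/2" and u: "u \<in> M" "u * star u = idm n"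
  shows "0 \<le> x \<Longrightarrow> x \<le> Re (tr ((\<rho> - Rt t) * u)) \<Longrightarrow>
      (K * (pi / (2 * cosh (pi * t))) * x) powr p \<le> rel_ent_diff"
    and "0 \<le> x \<Longrightarrow> x \<le> Re (tr ((\<rho> - RU) * u)) \<Longrightarrow>
      (K * x) powr p \<le> rel_ent_diff"
proof -
  have chi: "sqrt chi \<ge> 0" using chi_nonneg by simp
  let ?B = "\<lambda>\<delta>. 4 * sqrt \<delta> * (1 + sqrt chi) + sqrt (2 * ln (1 / \<delta>) * rel_ent_diff)"
  let ?c = "pi / (2 * cosh (pi * t))"
  have c: "?c > 0" using cosh_real_pos[of "pi * t"] by simp
  show "(K * ?c * x) powr p \<le> rel_ent_diff"
    if x: "0 \<le> x" "x \<le> Re (tr ((\<rho> - Rt t) * u))"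
  proof -
    have "?c * x \<le> ?B \<delta>" if \<delta>: "0 < \<delta>" "\<delta> \<le> 1" for \<delta>
    proof -
      have "x \<le> 2 * (cosh (pi * t) / pi * ?B \<delta>)"
        using x(2) complex_Re_le_cmod[of "tr ((\<rho> - Rt t) * u)"] Rt_bound[OF u \<delta>, of t] by linarith
      then have "?c * x \<le> ?c * (2 * (cosh (pi * t) / pi * ?B \<delta>))"
        using c by (intro mult_left_mono) auto
      also have "\<dots> = ?B \<delta>" by simp
      finally show ?thesis .
    qed
    from powr_le_of_log_bound[OF _ rel_ent_diff_nonneg chi e this] c x(1)
    show ?thesis unfolding K_def p_def by (simp add: mult.assoc)
  qed
  show "(K * x) powr p \<le> rel_ent_diff"
    if x: "0 \<le> x" "x \<le> Re (tr ((\<rho> - RU) * u))"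
  proof -
    have "x \<le> ?B \<delta>" if \<delta>: "0 < \<delta>" "\<delta> \<le> 1" for \<delta>
      using x(2) complex_Re_le_cmod[of "tr ((\<rho> - RU) * u)"] RU_bound[OF u \<delta>] by linarith
    from powr_le_of_log_bound[OF x(1) rel_ent_diff_nonneg chi e this] show ?thesis unfolding K_def p_def .
  qed
qed

end

theorem theorem4p13:
  fixes n :: nat and M N :: "complex mat set" and \<tau> :: "complex mat \<Rightarrow> complex"
    and \<rho> \<sigma> :: "complex mat" and \<epsilon> t :: real
  assumes "star_subalg n M" and "star_subalg n N" and "N \<subseteq> M"
    and "faithful_trace n M \<tau>"
    and "faithful_state n M \<tau> \<rho>" and "faithful_state n M \<tau> \<sigma>"
    and "0 < \<epsilon>" and "\<epsilon> < 1/2"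
  shows "let E = cond_exp n M N \<tau>;
             \<rho>N = E \<rho>; \<sigma>N = E \<sigma>;
             Q = Re (\<tau> (\<rho> * \<rho> * minv n \<sigma>));
             K = 1 / (4 * sqrt Q + 4 + 1 / sqrt (\<epsilon> * exp 1));
             \<Delta> = rel_ent n \<tau> \<rho> \<sigma> - rel_ent n \<tau> \<rho>N \<sigma>N;
             p = 1 / (1/2 - \<epsilon>)
         in \<Delta> \<ge> (K * (pi/2) * norm1 n \<tau> (\<rho> - Rrot n \<sigma> \<sigma>N 0 \<rho>N)) powr p \<and>
            \<Delta> \<ge> (K * (pi / (2 * cosh (pi * t))) * norm1 n \<tau> (\<rho> - Rrot n \<sigma> \<sigma>N t \<rho>N)) powr p \<and>
            \<Delta> \<ge> (K * norm1 n \<tau> (\<rho> - Runiv n \<sigma> \<sigma>N \<rho>N)) powr p"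
proof -
  note M = assms(1) and N = assms(2) and NM = assms(3) and T = assms(4)
  let ?tr = "\<lambda>x. \<tau> (unemb n x)" and ?M = "emb n ` M" and ?N = "emb n ` N"
  interpret M: traced n ?M ?tr by (rule faithful_trace_imp_traced[OF M T])
  interpret N: star_algebra n ?N by (rule star_subalg_imp_star_algebra[OF N])
  interpret TP: traced_pair n ?M ?N ?tr by unfold_locales (use NM in auto)
  have c: "A \<in> carrier_mat n n" if "A \<in> M" for A using M that unfolding star_subalg_def by auto
  have \<rho>: "\<rho> \<in> M" "psd n \<rho>" "\<tau> \<rho> = 1" "invertible_mat \<rho>"
    and \<sigma>: "\<sigma> \<in> M" "psd n \<sigma>" "\<tau> \<sigma> = 1" "invertible_mat \<sigma>"
    using assms(5,6) unfolding faithful_state_def is_state_def by auto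
  have c\<rho>: "\<rho> \<in> carrier_mat n n" and c\<sigma>: "\<sigma> \<in> carrier_mat n n" using \<rho> \<sigma> c by auto
  define \<rho>N where "\<rho>N = cond_exp n M N \<tau> \<rho>"
  define \<sigma>N where "\<sigma>N = cond_exp n M N \<tau> \<sigma>"
  have E: "emb n (cond_exp n M N \<tau> X) = TP.cexp (emb n X)" "cond_exp n M N \<tau> X \<in> N" if X: "X \<in> M" for X
  proof -
    have "TP.cexp (emb n X) \<in> ?N" using TP.cexp(1) X by auto
    then obtain B where B: "B \<in> N" "TP.cexp (emb n X) = emb n B" by auto
    then have "cond_exp n M N \<tau> X = B"
      using cond_exp_eq_cexp[OF M N NM T X] unemb_emb c NM by auto
    then show "emb n (cond_exp n M N \<tau> X) = TP.cexp (emb n X)" "cond_exp n M N \<tau> X \<in> N" using B by auto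
  qed
  have \<rho>N: "emb n \<rho>N = TP.cexp (emb n \<rho>)" "\<rho>N \<in> N" "\<rho>N \<in> carrier_mat n n"
    and \<sigma>N: "emb n \<sigma>N = TP.cexp (emb n \<sigma>)" "\<sigma>N \<in> N" "\<sigma>N \<in> carrier_mat n n"
    unfolding \<rho>N_def \<sigma>N_def using E \<rho>(1) \<sigma>(1) c NM by auto
  have h: "star (emb n \<rho>) = emb n \<rho>" "star (emb n \<sigma>) = emb n \<sigma>" using psd_imp_star \<rho>(2) \<sigma>(2) by auto
  have hN: "star (emb n \<rho>N) = emb n \<rho>N" "star (emb n \<sigma>N) = emb n \<sigma>N"
    unfolding \<rho>N \<sigma>N using TP.cexp_star[of "emb n \<rho>"] TP.cexp_star[of "emb n \<sigma>"] h \<rho>(1) \<sigma>(1) by auto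
  obtain S1 P1 where R1: "spectral_resolution n ?M (emb n \<rho>) S1 P1" and c1: "\<And>f. hfun n f \<rho> \<in> carrier_mat n n"
    and f1: "\<And>f. emb n (hfun n f \<rho>) = spectral_resolution.fcalc S1 P1 f"
    using M.exists_spectral_resolution[OF c\<rho> imageI[OF \<rho>(1)] h(1)] by metis
  obtain S2 P2 where R2: "spectral_resolution n ?M (emb n \<sigma>) S2 P2" and c2: "\<And>f. hfun n f \<sigma> \<in> carrier_mat n n"
    and f2: "\<And>f. emb n (hfun n f \<sigma>) = spectral_resolution.fcalc S2 P2 f"
    using M.exists_spectral_resolution[OF c\<sigma> imageI[OF \<sigma>(1)] h(2)] by metis
  obtain S3 P3 where R3: "spectral_resolution n ?N (emb n \<rho>N) S3 P3" and c3: "\<And>f. hfun n f \<rho>N \<in> carrier_mat n n"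
    and f3: "\<And>f. emb n (hfun n f \<rho>N) = spectral_resolution.fcalc S3 P3 f"
    using N.exists_spectral_resolution[OF \<rho>N(3) imageI[OF \<rho>N(2)] hN(1)] by metis
  obtain S4 P4 where R4: "spectral_resolution n ?N (emb n \<sigma>N) S4 P4" and c4: "\<And>f. hfun n f \<sigma>N \<in> carrier_mat n n"
    and f4: "\<And>f. emb n (hfun n f \<sigma>N) = spectral_resolution.fcalc S4 P4 f"
    using N.exists_spectral_resolution[OF \<sigma>N(3) imageI[OF \<sigma>N(2)] hN(2)] by metis
  note nn = psd_imp_spectrum_nonneg[OF \<rho>(2) R1] psd_imp_spectrum_nonneg[OF \<sigma>(2) R2]
  note nz = invertible_imp_spectrum_nonzero[OF c\<rho> \<rho>(4) R1] invertible_imp_spectrum_nonzero[OF c\<sigma> \<sigma>(4) R2]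
  have pos1: "r > 0" if "r \<in> S1" for r using nn(1)[OF that] nz(1) that by (cases "r = 0") auto
  have pos2: "r > 0" if "r \<in> S2" for r using nn(2)[OF that] nz(2) that by (cases "r = 0") auto
  \<comment> \<open>The reduced states are faithful too, so their logarithms and negative powers are
    genuine.\<close>
  have pos3: "r > 0" if "r \<in> S3" for r
    using TP.cexp_spectrum(2)[OF R1 nn(1) R3[unfolded \<rho>N] that nz(1)] .
  have pos4: "r > 0" if "r \<in> S4" for r
    using TP.cexp_spectrum(2)[OF R2 nn(2) R4[unfolded \<sigma>N] that nz(2)] .
  interpret R1: spectral_resolution n ?M "emb n \<rho>" S1 P1 by (rule R1)
  interpret R2: spectral_resolution n ?M "emb n \<sigma>" S2 P2 by (rule R2)
  interpret R3: spectral_resolution n ?N "TP.cexp (emb n \<rho>)" S3 P3 by (rule R3[unfolded \<rho>N])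
  interpret R4: spectral_resolution n ?N "TP.cexp (emb n \<sigma>)" S4 P4 by (rule R4[unfolded \<sigma>N])
  interpret rec: recovery n ?M ?N ?tr "emb n \<rho>" S1 P1 "emb n \<sigma>" S2 P2 S3 P3 S4 P4
    by unfold_locales (use pos1 pos2 pos3 pos4 \<rho>(3) \<sigma>(3) unemb_emb[OF c\<rho>] unemb_emb[OF c\<sigma>] in auto)
  have chi: "rec.chi = Re (\<tau> (\<rho> * \<rho> * minv n \<sigma>))"
  proof -
    have cc: "\<rho> * \<rho> \<in> carrier_mat n n" using c\<rho> by simp
    have "emb n (\<rho> * \<rho> * minv n \<sigma>) = emb n \<rho> * emb n \<rho> * R2.fcalc (\<lambda>r. of_real (inverse r))"
      unfolding minv_def emb_mult[OF cc c2] emb_mult[OF c\<rho> c\<rho>] f2 ..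
    moreover have "\<rho> * \<rho> * minv n \<sigma> \<in> carrier_mat n n" using mult_carrier_mat[OF cc c2] unfolding minv_def .
    ultimately show ?thesis unfolding rec.chi_def using unemb_emb by metis
  qed
  have rel: "rel_ent n \<tau> \<rho> \<sigma> - rel_ent n \<tau> \<rho>N \<sigma>N = rec.rel_ent_diff"
  proof -
    have "emb n (\<rho> * mlog n \<rho> - \<rho> * mlog n \<sigma>)
        = emb n \<rho> * R1.fcalc (\<lambda>r. of_real (ln r)) - emb n \<rho> * R2.fcalc (\<lambda>r. of_real (ln r))"
      unfolding mlog_def emb_diff[OF mult_carrier_mat[OF c\<rho> c1] mult_carrier_mat[OF c\<rho> c2]]
        emb_mult[OF c\<rho> c1] emb_mult[OF c\<rho> c2] f1 f2 ..
    moreover have "\<rho> * mlog n \<rho> - \<rho> * mlog n \<sigma> \<in> carrier_mat n n"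
      unfolding mlog_def using mult_carrier_mat[OF c\<rho> c2] by (rule minus_carrier_mat)
    moreover have "emb n (\<rho>N * mlog n \<rho>N - \<rho>N * mlog n \<sigma>N)
        = emb n \<rho>N * R3.fcalc (\<lambda>r. of_real (ln r)) - emb n \<rho>N * R4.fcalc (\<lambda>r. of_real (ln r))"
      unfolding mlog_def emb_diff[OF mult_carrier_mat[OF \<rho>N(3) c3] mult_carrier_mat[OF \<rho>N(3) c4]]
        emb_mult[OF \<rho>N(3) c3] emb_mult[OF \<rho>N(3) c4] f3 f4 ..
    moreover have "\<rho>N * mlog n \<rho>N - \<rho>N * mlog n \<sigma>N \<in> carrier_mat n n"
      unfolding mlog_def using mult_carrier_mat[OF \<rho>N(3) c4] by (rule minus_carrier_mat)
    ultimately show ?thesis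
      unfolding rel_ent_def rec.rel_ent_diff_def \<rho>N(1)[symmetric] by (metis unemb_emb)
  qed
  have Rc: "Rrot n \<sigma> \<sigma>N s \<rho>N \<in> carrier_mat n n" and Re: "emb n (Rrot n \<sigma> \<sigma>N s \<rho>N) = rec.Rt s" for s
  proof -
    have m: "mpow n \<sigma> z \<in> carrier_mat n n" "mpow n \<sigma>N z \<in> carrier_mat n n"
      "emb n (mpow n \<sigma> z) = R2.fcalc (pw z)" "emb n (mpow n \<sigma>N z) = R4.fcalc (pw z)" for z
    proof -
      have "(\<lambda>x. exp (z * complex_of_real (ln x))) = pw z" by (simp add: fun_eq_iff pw_def)
      then show "mpow n \<sigma> z \<in> carrier_mat n n" "mpow n \<sigma>N z \<in> carrier_mat n n"
        "emb n (mpow n \<sigma> z) = R2.fcalc (pw z)" "emb n (mpow n \<sigma>N z) = R4.fcalc (pw z)"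
        unfolding mpow_def using c2 c4 f2 f4 by simp_all
    qed
    \<comment> \<open>The four exponents of \<open>Rrot\<close> are \<open>z\<close>,
      \<open>- z\<close> and their conjugates for \<open>z = 1/2 + \<i> s\<close>, the form used in
      \<open>Rt\<close>.\<close>
    have z: "cnj (1/2 + \<i> * of_real s) = 1/2 - \<i> * of_real s" "Complex (1/2) s = 1/2 + \<i> * of_real s"
      "- (1/2 - \<i> * of_real s) = -1/2 + \<i> * of_real s" "- (1/2 + \<i> * of_real s) = -1/2 - \<i> * of_real s"
      by (simp_all add: complex_eq_iff)
    note mc = mult_carrier_mat[where nr = n and n = n and nc = n]
    show "Rrot n \<sigma> \<sigma>N s \<rho>N \<in> carrier_mat n n"
      unfolding Rrot_def by (intro mc m \<rho>N(3))
    show "emb n (Rrot n \<sigma> \<sigma>N s \<rho>N) = rec.Rt s"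
      unfolding Rrot_def rec.Rt_def z
      by (subst emb_mult, (intro mc m \<rho>N(3))+)+ (simp only: m \<rho>N(1))
  qed
  have Uc: "Runiv n \<sigma> \<sigma>N \<rho>N \<in> carrier_mat n n" unfolding Runiv_def by simp
  have Ue: "emb n (Runiv n \<sigma> \<sigma>N \<rho>N) = rec.RU"
  proof (rule fsmat_eqI)
    fix i j
    show "ent (emb n (Runiv n \<sigma> \<sigma>N \<rho>N)) i j = ent rec.RU i j"
    proof (cases "i < n \<and> j < n")
      case True
      have "Rrot n \<sigma> \<sigma>N (s / 2) \<rho>N $$ (i, j) = ent (rec.Rt (s / 2)) i j" for s
        unfolding Re[symmetric] ent_emb using True by simp
      then show ?thesis using True unfolding rec.ent_RU rec.beta_def by (simp add: ent_emb Runiv_def)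
    next
      case False
      then show ?thesis using M.bounded[OF rec.RU_closed] unfolding bounded_by_def by (auto simp: ent_emb not_less)
    qed
  qed
  have main: "0 \<le> norm1 n \<tau> (\<rho> - X)" "\<exists>u. u \<in> ?M \<and> u * star u = idm n \<and> norm1 n \<tau> (\<rho> - X) = Re (?tr ((emb n \<rho> - x) * u))"
    if X: "X \<in> carrier_mat n n" "emb n X = x" "x \<in> ?M" "star x = x" for X x
  proof -
    have cX: "\<rho> - X \<in> carrier_mat n n" using X(1) by (rule minus_carrier_mat)
    have e: "emb n (\<rho> - X) = emb n \<rho> - x" using emb_diff[OF c\<rho> X(1)] X(2) by simp
    have m: "emb n (\<rho> - X) \<in> ?M" unfolding e by (intro M.closed X imageI \<rho>)
    have s: "star (emb n (\<rho> - X)) = emb n (\<rho> - X)" unfolding e by (simp add: star_diff h X)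
    obtain u w where u: "u \<in> ?M" "u * star u = idm n" "norm1 n \<tau> (\<rho> - X) = Re (?tr ((emb n \<rho> - x) * u))"
      and w: "w \<in> ?M" "(emb n \<rho> - x) * u = star w * w"
      using norm1_eq_tr[OF M.star_algebra_axioms cX m s, of \<tau>] unfolding e by metis
    show "0 \<le> norm1 n \<tau> (\<rho> - X)" unfolding u(3) w(2) by (rule M.tr_nonneg[OF w(1)])
    show "\<exists>u. u \<in> ?M \<and> u * star u = idm n \<and> norm1 n \<tau> (\<rho> - X) = Re (?tr ((emb n \<rho> - x) * u))"
      using u by blast
  qed
  let ?K = "1 / (4 * sqrt rec.chi + 4 + 1 / sqrt (\<epsilon> * exp 1))" and ?p = "1 / (1/2 - \<epsilon>)"
  have rot: "(?K * (pi / (2 * cosh (pi * s))) * norm1 n \<tau> (\<rho> - Rrot n \<sigma> \<sigma>N s \<rho>N)) powr ?p \<le> rec.rel_ent_diff" for s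
    using main[OF Rc Re rec.Rt_closed rec.star_Rt, of s] rec.entropy_bounds(1)[OF assms(7,8)] by (metis order_refl)
  have univ: "(?K * norm1 n \<tau> (\<rho> - Runiv n \<sigma> \<sigma>N \<rho>N)) powr ?p \<le> rec.rel_ent_diff"
    using main[OF Uc Ue rec.RU_closed rec.star_RU] rec.entropy_bounds(2)[OF assms(7,8)] by (metis order_refl)
  \<comment> \<open>Since \<open>cosh 0 = 1\<close>, the unrotated Petz map is the case
    \<open>s = 0\<close> of \<open>rot\<close>.\<close>
  show ?thesis
    unfolding Let_def \<rho>N_def[symmetric] \<sigma>N_def[symmetric] rel chi[symmetric]
    using rot[of 0] rot[of t] univ by simp
qed

end
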